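(* For $n=2,3$ and $\omega$ a complex number with $\omega^n=1$, the category $\mathcal{TT}_{n,\omega}$ exists only if $\omega=1$.
   Context: Let $\tau=\frac{1+\sqrt5}{2}$. $T_2$ denotes the unitary Fibonacci category (the even half of the Temperley–Lieb category $A_4$ with loop parameter $\tau$): two simple objects, the nontrivial one being symmetrically self-dual of dimension $\tau$ with square $\cong 1\oplus$ itself. In $T_2*T_2$ the nontrivial simple objects of the two copies are denoted $\rho$ and $\mu$, so $\rho\rho\cong1\oplus\rho$, $\mu\mu\cong1\oplus\mu$. The free product $T_2*T_2$ is the pivotal category whose objects are words in objects of the two copies and whose morphisms are linear combinations of planar disjoint unions of diagrams from the two copies (strands of different types may not cross), modulo the local relations of each. A quotient of a pivotal category $\mathcal C$ is a pivotal category $\mathcal D$ with a faithful, dominant tensor functor $\mathcal C\to\mathcal D$ preserving the pivotal structure (dominant: every simple object of $\mathcal D$ is a summand of the image of an object of $\mathcal C$); it is a unitary quotient if $\mathcal D$ is unitary and the functor preserves $*$. Categories are considered up to direct-sum and idempotent completion; tensor signs are omitted. Let $P_k=\rho\mu\rho\cdots$ and $Q_k=\mu\rho\mu\cdots$ be the alternating words with $k$ letters starting with $\rho$, resp. $\mu$. Let $x$ be the last letter of $P_n$ and $y$ the last letter of $Q_n$; thus $P_n=\rho Q_{n-1}=P_{n-1}x$ and $Q_n=\mu P_{n-1}=Q_{n-1}y$. For $n\ge2$ and $\omega^n=1$, $\mathcal{TT}_{n,\omega}$ denotes the unitary quotient of $T_2*T_2$ (provided it exists) such that $n$ is the least integer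 $\ge2$ with $P_n\cong Q_n$, and which is generated over $T_2*T_2$ by a unitary isomorphism $U:P_n\to Q_n$ satisfying $\mathcal F^{-1}(U)=U^*=\omega^{-1}\mathcal F(U)$, where $\mathcal F(U)=(\mathrm{id}_{P_n}\otimes \mathrm{ev}_y)(\mathrm{id}_\rho\otimes U\otimes \mathrm{id}_y)(\mathrm{coev}_\rho\otimes \mathrm{id}_{Q_n}):Q_n\to P_n$ and $\mathcal F^{-1}(U)=(\mathrm{ev}_\mu\otimes \mathrm{id}_{P_n})(\mathrm{id}_\mu\otimes U\otimes \mathrm{id}_x)(\mathrm{id}_{Q_n}\otimes \mathrm{coev}_x):Q_n\to P_n$, with $\mathrm{ev}_z:zz\to1$, $\mathrm{coev}_z:1\to zz$ the caps and cups. *)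

theory Defs
  imports Complex_Main
begin

section \<open>Unitary pivotal categories\<close>

text \<open>Categories are not assumed to be strict.  The duality data are a chosen dual, evaluation and
  coevaluation for each object, and the pivotal isomorphism from each object to its double dual.\<close>

record ('o, 'm) pivotal_data =
  Obj :: "'o set"
  Arr :: "'m set"
  dom :: "'m \<Rightarrow> 'o"
  cod :: "'m \<Rightarrow> 'o"
  ident :: "'o \<Rightarrow> 'm"  ("\<one>\<index> _" [90] 90)
  cmp :: "'m \<Rightarrow> 'm \<Rightarrow> 'm"  (infixr "\<cdot>\<index>" 70)
  azero :: "'o \<Rightarrow> 'o \<Rightarrow> 'm"
  aplus :: "'m \<Rightarrow> 'm \<Rightarrow> 'm"  (infixl "\<oplus>\<index>" 65)
  ascale :: "complex \<Rightarrow> 'm \<Rightarrow> 'm"  (infixr "\<odot>\<index>" 73)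
  star :: "'m \<Rightarrow> 'm"
  tunit :: "'o"
  tobj :: "'o \<Rightarrow> 'o \<Rightarrow> 'o"  (infixr "\<boxtimes>\<index>" 75)
  tarr :: "'m \<Rightarrow> 'm \<Rightarrow> 'm"  (infixr "\<otimes>\<index>" 75)
  assoc :: "'o \<Rightarrow> 'o \<Rightarrow> 'o \<Rightarrow> 'm"
  lunit :: "'o \<Rightarrow> 'm"
  runit :: "'o \<Rightarrow> 'm"
  dual :: "'o \<Rightarrow> 'o"
  ev :: "'o \<Rightarrow> 'm"
  coev :: "'o \<Rightarrow> 'm"
  piv :: "'o \<Rightarrow> 'm"

definition hom :: "('o, 'm) pivotal_data \<Rightarrow> 'o \<Rightarrow> 'o \<Rightarrow> 'm set" where
  "hom C X Y = {f \<in> Arr C. dom C f = X \<and> cod C f = Y}"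

definition is_inverse :: "('o, 'm) pivotal_data \<Rightarrow> 'm \<Rightarrow> 'm \<Rightarrow> bool" where
  "is_inverse C f g \<longleftrightarrow> g \<in> hom C (cod C f) (dom C f) \<and>
     cmp C g f = ident C (dom C f) \<and> cmp C f g = ident C (cod C f)"

definition iso :: "('o, 'm) pivotal_data \<Rightarrow> 'm \<Rightarrow> bool" where
  "iso C f \<longleftrightarrow> f \<in> Arr C \<and> (\<exists>g. is_inverse C f g)"

definition inverse_arr :: "('o, 'm) pivotal_data \<Rightarrow> 'm \<Rightarrow> 'm" where
  "inverse_arr C f = (THE g. is_inverse C f g)"

definition isomorphic :: "('o, 'm) pivotal_data \<Rightarrow> 'o \<Rightarrow> 'o \<Rightarrow> bool" where
  "isomorphic C X Y \<longleftrightarrow> (\<exists>f \<in> hom C X Y. iso C f)"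

definition unitary_arr :: "('o, 'm) pivotal_data \<Rightarrow> 'm \<Rightarrow> bool" where
  "unitary_arr C f \<longleftrightarrow> f \<in> Arr C \<and> is_inverse C f (star C f)"

fun lincomb :: "('o, 'm) pivotal_data \<Rightarrow> 'o \<Rightarrow> 'o \<Rightarrow> (complex \<times> 'm) list \<Rightarrow> 'm" where
  "lincomb C X Y [] = azero C X Y"
| "lincomb C X Y ((a, f) # xs) = aplus C (ascale C a f) (lincomb C X Y xs)"

locale linear_category =
  fixes C :: "('o, 'm) pivotal_data" (structure)
  assumes dom_Obj: "f \<in> Arr C \<Longrightarrow> dom C f \<in> Obj C"
    and cod_Obj: "f \<in> Arr C \<Longrightarrow> cod C f \<in> Obj C"
    and ident_hom: "X \<in> Obj C \<Longrightarrow> \<one> X \<in> hom C X X"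
    and cmp_hom: "\<lbrakk>g \<in> hom C Y Z; f \<in> hom C X Y\<rbrakk> \<Longrightarrow> g \<cdot> f \<in> hom C X Z"
    and cmp_ident: "f \<in> hom C X Y \<Longrightarrow> f \<cdot> \<one> X = f"
    and ident_cmp: "f \<in> hom C X Y \<Longrightarrow> \<one> Y \<cdot> f = f"
    and cmp_assoc: "\<lbrakk>h \<in> hom C Y Z; g \<in> hom C X Y; f \<in> hom C W X\<rbrakk> \<Longrightarrow> (h \<cdot> g) \<cdot> f = h \<cdot> (g \<cdot> f)"
    and zero_hom: "\<lbrakk>X \<in> Obj C; Y \<in> Obj C\<rbrakk> \<Longrightarrow> azero C X Y \<in> hom C X Y"
    and plus_hom: "\<lbrakk>f \<in> hom C X Y; g \<in> hom C X Y\<rbrakk> \<Longrightarrow> f \<oplus> g \<in> hom C X Y"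
    and scale_hom: "f \<in> hom C X Y \<Longrightarrow> a \<odot> f \<in> hom C X Y"
    and plus_assoc: "\<lbrakk>f \<in> hom C X Y; g \<in> hom C X Y; h \<in> hom C X Y\<rbrakk> \<Longrightarrow> (f \<oplus> g) \<oplus> h = f \<oplus> (g \<oplus> h)"
    and plus_comm: "\<lbrakk>f \<in> hom C X Y; g \<in> hom C X Y\<rbrakk> \<Longrightarrow> f \<oplus> g = g \<oplus> f"
    and plus_zero: "f \<in> hom C X Y \<Longrightarrow> f \<oplus> azero C X Y = f"
    and plus_neg: "f \<in> hom C X Y \<Longrightarrow> f \<oplus> (- 1) \<odot> f = azero C X Y"
    and scale_plus: "\<lbrakk>f \<in> hom C X Y; g \<in> hom C X Y\<rbrakk> \<Longrightarrow> a \<odot> (f \<oplus> g) = a \<odot> f \<oplus> a \<odot> g"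
    and plus_scale: "f \<in> hom C X Y \<Longrightarrow> (a + b) \<odot> f = a \<odot> f \<oplus> b \<odot> f"
    and scale_scale: "f \<in> hom C X Y \<Longrightarrow> a \<odot> b \<odot> f = (a * b) \<odot> f"
    and scale_one: "f \<in> hom C X Y \<Longrightarrow> 1 \<odot> f = f"
    and cmp_plus: "\<lbrakk>h \<in> hom C Y Z; f \<in> hom C X Y; g \<in> hom C X Y\<rbrakk> \<Longrightarrow> h \<cdot> (f \<oplus> g) = h \<cdot> f \<oplus> h \<cdot> g"
    and plus_cmp: "\<lbrakk>f \<in> hom C Y Z; g \<in> hom C Y Z; h \<in> hom C X Y\<rbrakk> \<Longrightarrow> (f \<oplus> g) \<cdot> h = f \<cdot> h \<oplus> g \<cdot> h"
    and cmp_scale: "\<lbrakk>g \<in> hom C Y Z; f \<in> hom C X Y\<rbrakk> \<Longrightarrow> g \<cdot> (a \<odot> f) = a \<odot> (g \<cdot> f)"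
    and scale_cmp: "\<lbrakk>g \<in> hom C Y Z; f \<in> hom C X Y\<rbrakk> \<Longrightarrow> (a \<odot> g) \<cdot> f = a \<odot> (g \<cdot> f)"

locale monoidal_category = linear_category +
  assumes unit_Obj: "tunit C \<in> Obj C"
    and tensor_Obj: "\<lbrakk>X \<in> Obj C; Y \<in> Obj C\<rbrakk> \<Longrightarrow> X \<boxtimes> Y \<in> Obj C"
    and tensor_hom: "\<lbrakk>f \<in> hom C X Y; g \<in> hom C X' Y'\<rbrakk> \<Longrightarrow> f \<otimes> g \<in> hom C (X \<boxtimes> X') (Y \<boxtimes> Y')"
    and tensor_ident: "\<lbrakk>X \<in> Obj C; Y \<in> Obj C\<rbrakk> \<Longrightarrow> \<one> X \<otimes> \<one> Y = \<one> (X \<boxtimes> Y)"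
    and tensor_cmp: "\<lbrakk>g \<in> hom C Y Z; f \<in> hom C X Y; g' \<in> hom C Y' Z'; f' \<in> hom C X' Y'\<rbrakk>
          \<Longrightarrow> (g \<cdot> f) \<otimes> (g' \<cdot> f') = (g \<otimes> g') \<cdot> (f \<otimes> f')"
    and tensor_plus: "\<lbrakk>h \<in> hom C X Y; f \<in> hom C X' Y'; g \<in> hom C X' Y'\<rbrakk>
          \<Longrightarrow> h \<otimes> (f \<oplus> g) = h \<otimes> f \<oplus> h \<otimes> g"
    and plus_tensor: "\<lbrakk>f \<in> hom C X Y; g \<in> hom C X Y; h \<in> hom C X' Y'\<rbrakk>
          \<Longrightarrow> (f \<oplus> g) \<otimes> h = f \<otimes> h \<oplus> g \<otimes> h"
    and tensor_scale: "\<lbrakk>f \<in> hom C X Y; g \<in> hom C X' Y'\<rbrakk> \<Longrightarrow> f \<otimes> (a \<odot> g) = a \<odot> (f \<otimes> g)"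
    and scale_tensor: "\<lbrakk>f \<in> hom C X Y; g \<in> hom C X' Y'\<rbrakk> \<Longrightarrow> (a \<odot> f) \<otimes> g = a \<odot> (f \<otimes> g)"
    and assoc_hom: "\<lbrakk>X \<in> Obj C; Y \<in> Obj C; Z \<in> Obj C\<rbrakk>
          \<Longrightarrow> assoc C X Y Z \<in> hom C ((X \<boxtimes> Y) \<boxtimes> Z) (X \<boxtimes> (Y \<boxtimes> Z))"
    and assoc_iso: "\<lbrakk>X \<in> Obj C; Y \<in> Obj C; Z \<in> Obj C\<rbrakk> \<Longrightarrow> iso C (assoc C X Y Z)"
    and assoc_natural: "\<lbrakk>f \<in> hom C X X'; g \<in> hom C Y Y'; h \<in> hom C Z Z'\<rbrakk>
          \<Longrightarrow> assoc C X' Y' Z' \<cdot> ((f \<otimes> g) \<otimes> h) = (f \<otimes> (g \<otimes> h)) \<cdot> assoc C X Y Z"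
    and lunit_hom: "X \<in> Obj C \<Longrightarrow> lunit C X \<in> hom C (tunit C \<boxtimes> X) X"
    and lunit_iso: "X \<in> Obj C \<Longrightarrow> iso C (lunit C X)"
    and lunit_natural: "f \<in> hom C X Y \<Longrightarrow> lunit C Y \<cdot> (\<one> (tunit C) \<otimes> f) = f \<cdot> lunit C X"
    and runit_hom: "X \<in> Obj C \<Longrightarrow> runit C X \<in> hom C (X \<boxtimes> tunit C) X"
    and runit_iso: "X \<in> Obj C \<Longrightarrow> iso C (runit C X)"
    and runit_natural: "f \<in> hom C X Y \<Longrightarrow> runit C Y \<cdot> (f \<otimes> \<one> (tunit C)) = f \<cdot> runit C X"
    and pentagon: "\<lbrakk>W \<in> Obj C; X \<in> Obj C; Y \<in> Obj C; Z \<in> Obj C\<rbrakk>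
          \<Longrightarrow> assoc C W X (Y \<boxtimes> Z) \<cdot> assoc C (W \<boxtimes> X) Y Z
            = (\<one> W \<otimes> assoc C X Y Z) \<cdot> assoc C W (X \<boxtimes> Y) Z \<cdot> (assoc C W X Y \<otimes> \<one> Z)"
    and triangle: "\<lbrakk>X \<in> Obj C; Y \<in> Obj C\<rbrakk>
          \<Longrightarrow> (\<one> X \<otimes> lunit C Y) \<cdot> assoc C X (tunit C) Y = runit C X \<otimes> \<one> Y"

text \<open>A pairing \<open>e : A \<otimes> X \<rightarrow> 1\<close> corresponds to the morphism \<open>mate C A X e : A \<rightarrow> X\<^sup>*\<close>, namely
  \<open>A \<rightarrow> A \<otimes> 1 \<rightarrow> A \<otimes> (X \<otimes> X\<^sup>*) \<rightarrow> (A \<otimes> X) \<otimes> X\<^sup>* \<rightarrow> 1 \<otimes> X\<^sup>* \<rightarrow> X\<^sup>*\<close>.  It gives the dual of a morphism,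
  the comparison \<open>Y\<^sup>* \<otimes> X\<^sup>* \<rightarrow> (X \<otimes> Y)\<^sup>*\<close>, and the comparison \<open>F(X\<^sup>*) \<rightarrow> F(X)\<^sup>*\<close> for tensor functors.\<close>

definition mate :: "('o, 'm) pivotal_data \<Rightarrow> 'o \<Rightarrow> 'o \<Rightarrow> 'm \<Rightarrow> 'm" where
  "mate C A X e =
     cmp C (lunit C (dual C X))
    (cmp C (tarr C e (ident C (dual C X)))
    (cmp C (inverse_arr C (assoc C A X (dual C X)))
    (cmp C (tarr C (ident C A) (coev C X))
           (inverse_arr C (runit C A)))))"

definition dual_arr :: "('o, 'm) pivotal_data \<Rightarrow> 'm \<Rightarrow> 'm" where
  "dual_arr C f = mate C (dual C (cod C f)) (dom C f)
     (cmp C (ev C (cod C f)) (tarr C (ident C (dual C (cod C f))) f))"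

text \<open>The pairing \<open>(Y\<^sup>* \<otimes> X\<^sup>*) \<otimes> (X \<otimes> Y) \<rightarrow> 1\<close> of nested caps.\<close>

definition ev_nested :: "('o, 'm) pivotal_data \<Rightarrow> 'o \<Rightarrow> 'o \<Rightarrow> 'm" where
  "ev_nested C X Y =
     cmp C (ev C Y)
    (cmp C (tarr C (ident C (dual C Y))
              (cmp C (lunit C Y)
              (cmp C (tarr C (ev C X) (ident C Y))
                     (inverse_arr C (assoc C (dual C X) X Y)))))
           (assoc C (dual C Y) (dual C X) (tobj C X Y)))"

definition dual_tensor :: "('o, 'm) pivotal_data \<Rightarrow> 'o \<Rightarrow> 'o \<Rightarrow> 'm" where
  "dual_tensor C X Y = mate C (tobj C (dual C Y) (dual C X)) (tobj C X Y) (ev_nested C X Y)"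

text \<open>Axiom \<open>piv_tensor\<close> says that the natural isomorphism \<open>piv\<close> is monoidal: the monoidal
  constraint of the double dual is \<open>dual_tensor C Y\<^sup>* X\<^sup>*\<close> followed by the inverse of the dual of
  \<open>dual_tensor C X Y\<close>.\<close>

locale pivotal_category = monoidal_category +
  assumes dual_Obj: "X \<in> Obj C \<Longrightarrow> dual C X \<in> Obj C"
    and ev_hom: "X \<in> Obj C \<Longrightarrow> ev C X \<in> hom C (dual C X \<boxtimes> X) (tunit C)"
    and coev_hom: "X \<in> Obj C \<Longrightarrow> coev C X \<in> hom C (tunit C) (X \<boxtimes> dual C X)"
    and zigzag: "X \<in> Obj C \<Longrightarrow>
          runit C X \<cdot> (\<one> X \<otimes> ev C X) \<cdot> assoc C X (dual C X) X \<cdot> (coev C X \<otimes> \<one> X)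
            \<cdot> inverse_arr C (lunit C X) = \<one> X"
    and zigzag_dual: "X \<in> Obj C \<Longrightarrow> mate C (dual C X) X (ev C X) = \<one> (dual C X)"
    and piv_hom: "X \<in> Obj C \<Longrightarrow> piv C X \<in> hom C X (dual C (dual C X))"
    and piv_iso: "X \<in> Obj C \<Longrightarrow> iso C (piv C X)"
    and piv_natural: "f \<in> hom C X Y \<Longrightarrow> piv C Y \<cdot> f = dual_arr C (dual_arr C f) \<cdot> piv C X"
    and piv_tensor: "\<lbrakk>X \<in> Obj C; Y \<in> Obj C\<rbrakk>
          \<Longrightarrow> dual_arr C (dual_tensor C X Y) \<cdot> piv C (X \<boxtimes> Y)
            = dual_tensor C (dual C Y) (dual C X) \<cdot> (piv C X \<otimes> piv C Y)"

text \<open>A unitary pivotal category is a semisimple C*-tensor category with simple unit and a compatible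
  pivotal structure.  For finite-dimensional morphism spaces the C*-condition amounts to
  \<open>star_definite\<close> and \<open>star_positive\<close>.  Semisimplicity comes from \<open>hom_finite_dim\<close>, closure under
  finite orthogonal direct sums and splitting of projections.  Axiom \<open>star_coev\<close> says that the
  involution reflects diagrams: the adjoint of the cup \<open>1 \<rightarrow> X \<otimes> X\<^sup>*\<close> is the cap \<open>X \<otimes> X\<^sup>* \<rightarrow> 1\<close>.\<close>

locale unitary_pivotal_category = pivotal_category +
  assumes star_hom: "f \<in> hom C X Y \<Longrightarrow> star C f \<in> hom C Y X"
    and star_star: "f \<in> Arr C \<Longrightarrow> star C (star C f) = f"
    and star_cmp: "\<lbrakk>g \<in> hom C Y Z; f \<in> hom C X Y\<rbrakk> \<Longrightarrow> star C (g \<cdot> f) = star C f \<cdot> star C g"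
    and star_plus: "\<lbrakk>f \<in> hom C X Y; g \<in> hom C X Y\<rbrakk> \<Longrightarrow> star C (f \<oplus> g) = star C f \<oplus> star C g"
    and star_scale: "f \<in> Arr C \<Longrightarrow> star C (a \<odot> f) = cnj a \<odot> star C f"
    and star_tensor: "\<lbrakk>f \<in> Arr C; g \<in> Arr C\<rbrakk> \<Longrightarrow> star C (f \<otimes> g) = star C f \<otimes> star C g"
    and assoc_unitary: "\<lbrakk>X \<in> Obj C; Y \<in> Obj C; Z \<in> Obj C\<rbrakk> \<Longrightarrow> unitary_arr C (assoc C X Y Z)"
    and lunit_unitary: "X \<in> Obj C \<Longrightarrow> unitary_arr C (lunit C X)"
    and runit_unitary: "X \<in> Obj C \<Longrightarrow> unitary_arr C (runit C X)"
    and piv_unitary: "X \<in> Obj C \<Longrightarrow> unitary_arr C (piv C X)"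
    and star_coev: "X \<in> Obj C \<Longrightarrow>
          star C (coev C X) = ev C (dual C X) \<cdot> (piv C X \<otimes> \<one> (dual C X))"
    and star_definite: "\<lbrakk>f \<in> hom C X Y; star C f \<cdot> f = azero C X X\<rbrakk> \<Longrightarrow> f = azero C X Y"
    and star_positive: "f \<in> hom C X Y \<Longrightarrow> \<exists>g \<in> hom C X X. star C f \<cdot> f = star C g \<cdot> g"
    and hom_finite_dim: "\<lbrakk>X \<in> Obj C; Y \<in> Obj C\<rbrakk> \<Longrightarrow>
          \<exists>bs. set bs \<subseteq> hom C X Y \<and>
            (\<forall>f \<in> hom C X Y. \<exists>as. length as = length bs \<and> f = lincomb C X Y (zip as bs))"
    and unit_simple: "f \<in> hom C (tunit C) (tunit C) \<Longrightarrow> \<exists>a. f = a \<odot> \<one> (tunit C)"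
    and unit_nonzero: "\<one> (tunit C) \<noteq> azero C (tunit C) (tunit C)"
    and zero_object: "\<exists>Z \<in> Obj C. \<one> Z = azero C Z Z"
    and direct_sums: "\<lbrakk>X \<in> Obj C; Y \<in> Obj C\<rbrakk> \<Longrightarrow>
          \<exists>Z \<in> Obj C. \<exists>i \<in> hom C X Z. \<exists>j \<in> hom C Y Z.
            star C i \<cdot> i = \<one> X \<and> star C j \<cdot> j = \<one> Y \<and>
            i \<cdot> star C i \<oplus> j \<cdot> star C j = \<one> Z"
    and projections_split: "\<lbrakk>p \<in> hom C X X; p \<cdot> p = p; star C p = p\<rbrakk> \<Longrightarrow>
          \<exists>Y \<in> Obj C. \<exists>v \<in> hom C Y X. star C v \<cdot> v = \<one> Y \<and> v \<cdot> star C v = p"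

definition simple :: "('o, 'm) pivotal_data \<Rightarrow> 'o \<Rightarrow> bool" where
  "simple C X \<longleftrightarrow> X \<in> Obj C \<and> ident C X \<noteq> azero C X X \<and>
     (\<forall>f \<in> hom C X X. \<exists>a. f = ascale C a (ident C X))"

definition summand :: "('o, 'm) pivotal_data \<Rightarrow> 'o \<Rightarrow> 'o \<Rightarrow> bool" where
  "summand C X Y \<longleftrightarrow> (\<exists>v \<in> hom C X Y. \<exists>w \<in> hom C Y X. cmp C w v = ident C X)"


section \<open>Unitary quotients\<close>

text \<open>A tensor functor has structure isomorphisms \<open>tmul F X Y : F X \<otimes> F Y \<rightarrow> F (X \<otimes> Y)\<close> and
  \<open>tone F : 1 \<rightarrow> F 1\<close>.\<close>

record ('o, 'm, 'p, 'q) tensor_functor_data =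
  fobj :: "'o \<Rightarrow> 'p"
  farr :: "'m \<Rightarrow> 'q"
  tmul :: "'o \<Rightarrow> 'o \<Rightarrow> 'q"
  tone :: "'q"

definition dual_comparison ::
    "('o, 'm) pivotal_data \<Rightarrow> ('p, 'q) pivotal_data \<Rightarrow> ('o, 'm, 'p, 'q) tensor_functor_data \<Rightarrow> 'o \<Rightarrow> 'q" where
  "dual_comparison C D F X = mate D (fobj F (dual C X)) (fobj F X)
     (cmp D (inverse_arr D (tone F)) (cmp D (farr F (ev C X)) (tmul F (dual C X) X)))"

locale tensor_functor =
  fixes C :: "('o, 'm) pivotal_data" and D :: "('p, 'q) pivotal_data"
    and F :: "('o, 'm, 'p, 'q) tensor_functor_data"
  assumes fobj_Obj: "X \<in> Obj C \<Longrightarrow> fobj F X \<in> Obj D"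
    and farr_hom: "f \<in> hom C X Y \<Longrightarrow> farr F f \<in> hom D (fobj F X) (fobj F Y)"
    and farr_ident: "X \<in> Obj C \<Longrightarrow> farr F (ident C X) = ident D (fobj F X)"
    and farr_cmp: "\<lbrakk>g \<in> hom C Y Z; f \<in> hom C X Y\<rbrakk> \<Longrightarrow> farr F (cmp C g f) = cmp D (farr F g) (farr F f)"
    and farr_plus: "\<lbrakk>f \<in> hom C X Y; g \<in> hom C X Y\<rbrakk> \<Longrightarrow> farr F (aplus C f g) = aplus D (farr F f) (farr F g)"
    and farr_scale: "f \<in> Arr C \<Longrightarrow> farr F (ascale C a f) = ascale D a (farr F f)"
    and tmul_hom: "\<lbrakk>X \<in> Obj C; Y \<in> Obj C\<rbrakk>
          \<Longrightarrow> tmul F X Y \<in> hom D (tobj D (fobj F X) (fobj F Y)) (fobj F (tobj C X Y))"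
    and tmul_iso: "\<lbrakk>X \<in> Obj C; Y \<in> Obj C\<rbrakk> \<Longrightarrow> iso D (tmul F X Y)"
    and tmul_natural: "\<lbrakk>f \<in> hom C X Y; g \<in> hom C X' Y'\<rbrakk>
          \<Longrightarrow> cmp D (tmul F Y Y') (tarr D (farr F f) (farr F g))
            = cmp D (farr F (tarr C f g)) (tmul F X X')"
    and tone_hom: "tone F \<in> hom D (tunit D) (fobj F (tunit C))"
    and tone_iso: "iso D (tone F)"
    and tmul_assoc: "\<lbrakk>X \<in> Obj C; Y \<in> Obj C; Z \<in> Obj C\<rbrakk>
          \<Longrightarrow> cmp D (farr F (assoc C X Y Z))
               (cmp D (tmul F (tobj C X Y) Z) (tarr D (tmul F X Y) (ident D (fobj F Z))))
            = cmp D (tmul F X (tobj C Y Z))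
               (cmp D (tarr D (ident D (fobj F X)) (tmul F Y Z))
                      (assoc D (fobj F X) (fobj F Y) (fobj F Z)))"
    and tmul_lunit: "X \<in> Obj C
          \<Longrightarrow> cmp D (farr F (lunit C X)) (cmp D (tmul F (tunit C) X) (tarr D (tone F) (ident D (fobj F X))))
            = lunit D (fobj F X)"
    and tmul_runit: "X \<in> Obj C
          \<Longrightarrow> cmp D (farr F (runit C X)) (cmp D (tmul F X (tunit C)) (tarr D (ident D (fobj F X)) (tone F)))
            = runit D (fobj F X)"

text \<open>The source \<open>C\<close> need not be closed under direct sums and summands.  A functor to \<open>D\<close> extends
  to the completion of \<open>C\<close>.  Every object of the completion is a summand of a finite direct sum of
  objects of \<open>C\<close>, so a simple object of \<open>D\<close> is a summand of the image of an object of the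
  completion iff it is a summand of the image of an object of \<open>C\<close>.\<close>

locale unitary_quotient = unitary_pivotal_category D + tensor_functor C D F
  for C :: "('o, 'm) pivotal_data" and D :: "('p, 'q) pivotal_data"
    and F :: "('o, 'm, 'p, 'q) tensor_functor_data" +
  assumes farr_faithful: "\<lbrakk>X \<in> Obj C; Y \<in> Obj C\<rbrakk> \<Longrightarrow> inj_on (farr F) (hom C X Y)"
    and fobj_dominant: "simple D Z \<Longrightarrow> \<exists>X \<in> Obj C. summand D Z (fobj F X)"
    and farr_piv: "X \<in> Obj C \<Longrightarrow>
          cmp D (dual_arr D (dual_comparison C D F X)) (piv D (fobj F X))
            = cmp D (dual_comparison C D F (dual C X)) (farr F (piv C X))"
    and farr_star: "f \<in> Arr C \<Longrightarrow> farr F (star C f) = star D (farr F f)"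
    and tmul_unitary: "\<lbrakk>X \<in> Obj C; Y \<in> Obj C\<rbrakk> \<Longrightarrow> unitary_arr D (tmul F X Y)"
    and tone_unitary: "unitary_arr D (tone F)"


section \<open>Two-coloured Temperley--Lieb diagrams\<close>

text \<open>The Temperley--Lieb category of type \<open>A\<^sub>4\<close> is generated by one symmetrically self-dual strand of
  dimension \<open>golden\<close>, modulo the fourth Jones--Wenzl projection.  Here there are two kinds of
  strand, one for each copy; there is no generator crossing them, so the morphisms are linear
  combinations of planar disjoint unions of diagrams from the two copies.  An object is the list of
  the colours of its strands.  Diagrams are represented by terms up to the congruence \<open>tl_eq\<close>
  generated by the axioms of strict monoidal linear categories, planar isotopy (the zigzag
  relations), and the local relations \<open>loop\<close> and \<open>jw4\<close> of each copy.\<close>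

definition golden :: real where
  "golden = (1 + sqrt 5) / 2"

datatype colour = Rho | Mu

datatype tl =
    Id "colour list"
  | Cap colour
  | Cup colour
  | Comp tl tl  (infixr "\<bullet>" 70)
  | Tens tl tl  (infixr "\<diamondop>" 75)
  | Zero "colour list" "colour list"
  | Plus tl tl
  | Scale complex tl

inductive typed :: "tl \<Rightarrow> colour list \<Rightarrow> colour list \<Rightarrow> bool" where
  "typed (Id u) u u"
| "typed (Cap c) [c, c] []"
| "typed (Cup c) [] [c, c]"
| "\<lbrakk>typed t v w; typed s u v\<rbrakk> \<Longrightarrow> typed (t \<bullet> s) u w"
| "\<lbrakk>typed s u v; typed t u' v'\<rbrakk> \<Longrightarrow> typed (s \<diamondop> t) (u @ u') (v @ v')"
| "typed (Zero u v) u v"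
| "\<lbrakk>typed s u v; typed t u v\<rbrakk> \<Longrightarrow> typed (Plus s t) u v"
| "typed s u v \<Longrightarrow> typed (Scale a s) u v"

text \<open>The quantum integers with \<open>[2] = golden\<close>, and Wenzl's recursion
  \<open>f\<^sub>n\<^sub>+\<^sub>1 = f\<^sub>n \<otimes> 1 - ([n] / [n+1]) (f\<^sub>n \<otimes> 1) e\<^sub>n (f\<^sub>n \<otimes> 1)\<close>.
  Since \<open>[5] = 0\<close>, the projection \<open>f\<^sub>4\<close> is the last one that is defined.\<close>

fun qint :: "nat \<Rightarrow> real" where
  "qint 0 = 0"
| "qint (Suc 0) = 1"
| "qint (Suc (Suc n)) = golden * qint (Suc n) - qint n"

fun jones_wenzl :: "colour \<Rightarrow> nat \<Rightarrow> tl" where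
  "jones_wenzl c 0 = Id []"
| "jones_wenzl c (Suc 0) = Id [c]"
| "jones_wenzl c (Suc (Suc n)) =
     (let f = jones_wenzl c (Suc n) \<diamondop> Id [c];
          e = Id (replicate n c) \<diamondop> (Cup c \<bullet> Cap c)
      in Plus f (Scale (complex_of_real (- (qint (Suc n) / qint (Suc (Suc n))))) (f \<bullet> e \<bullet> f)))"

inductive tl_eq :: "colour list \<Rightarrow> colour list \<Rightarrow> tl \<Rightarrow> tl \<Rightarrow> bool" where
  refl: "typed s u v \<Longrightarrow> tl_eq u v s s"
| sym: "tl_eq u v s t \<Longrightarrow> tl_eq u v t s"
| trans: "\<lbrakk>tl_eq u v r s; tl_eq u v s t\<rbrakk> \<Longrightarrow> tl_eq u v r t"
| comp_cong: "\<lbrakk>tl_eq v w t t'; tl_eq u v s s'\<rbrakk> \<Longrightarrow> tl_eq u w (t \<bullet> s) (t' \<bullet> s')"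
| tens_cong: "\<lbrakk>tl_eq u v s s'; tl_eq u' v' t t'\<rbrakk> \<Longrightarrow> tl_eq (u @ u') (v @ v') (s \<diamondop> t) (s' \<diamondop> t')"
| plus_cong: "\<lbrakk>tl_eq u v s s'; tl_eq u v t t'\<rbrakk> \<Longrightarrow> tl_eq u v (Plus s t) (Plus s' t')"
| scale_cong: "tl_eq u v s s' \<Longrightarrow> tl_eq u v (Scale a s) (Scale a s')"

| comp_id: "typed s u v \<Longrightarrow> tl_eq u v (s \<bullet> Id u) s"
| id_comp: "typed s u v \<Longrightarrow> tl_eq u v (Id v \<bullet> s) s"
| comp_assoc: "\<lbrakk>typed r w x; typed s v w; typed t u v\<rbrakk> \<Longrightarrow> tl_eq u x ((r \<bullet> s) \<bullet> t) (r \<bullet> s \<bullet> t)"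

| plus_assoc: "\<lbrakk>typed r u v; typed s u v; typed t u v\<rbrakk> \<Longrightarrow> tl_eq u v (Plus (Plus r s) t) (Plus r (Plus s t))"
| plus_comm: "\<lbrakk>typed s u v; typed t u v\<rbrakk> \<Longrightarrow> tl_eq u v (Plus s t) (Plus t s)"
| plus_zero: "typed s u v \<Longrightarrow> tl_eq u v (Plus s (Zero u v)) s"
| plus_neg: "typed s u v \<Longrightarrow> tl_eq u v (Plus s (Scale (- 1) s)) (Zero u v)"
| scale_plus: "\<lbrakk>typed s u v; typed t u v\<rbrakk> \<Longrightarrow> tl_eq u v (Scale a (Plus s t)) (Plus (Scale a s) (Scale a t))"
| plus_scale: "typed s u v \<Longrightarrow> tl_eq u v (Scale (a + b) s) (Plus (Scale a s) (Scale b s))"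
| scale_scale: "typed s u v \<Longrightarrow> tl_eq u v (Scale a (Scale b s)) (Scale (a * b) s)"
| scale_one: "typed s u v \<Longrightarrow> tl_eq u v (Scale 1 s) s"

| comp_plus: "\<lbrakk>typed r v w; typed s u v; typed t u v\<rbrakk> \<Longrightarrow> tl_eq u w (r \<bullet> Plus s t) (Plus (r \<bullet> s) (r \<bullet> t))"
| plus_comp: "\<lbrakk>typed r v w; typed s v w; typed t u v\<rbrakk> \<Longrightarrow> tl_eq u w (Plus r s \<bullet> t) (Plus (r \<bullet> t) (s \<bullet> t))"
| comp_scale: "\<lbrakk>typed s v w; typed t u v\<rbrakk> \<Longrightarrow> tl_eq u w (s \<bullet> Scale a t) (Scale a (s \<bullet> t))"
| scale_comp: "\<lbrakk>typed s v w; typed t u v\<rbrakk> \<Longrightarrow> tl_eq u w (Scale a s \<bullet> t) (Scale a (s \<bullet> t))"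

| tens_id: "tl_eq (u @ v) (u @ v) (Id u \<diamondop> Id v) (Id (u @ v))"
| tens_comp: "\<lbrakk>typed t v w; typed s u v; typed t' v' w'; typed s' u' v'\<rbrakk>
    \<Longrightarrow> tl_eq (u @ u') (w @ w') ((t \<bullet> s) \<diamondop> (t' \<bullet> s')) ((t \<diamondop> t') \<bullet> (s \<diamondop> s'))"
| tens_assoc: "\<lbrakk>typed r u v; typed s u' v'; typed t u'' v''\<rbrakk>
    \<Longrightarrow> tl_eq (u @ u' @ u'') (v @ v' @ v'') ((r \<diamondop> s) \<diamondop> t) (r \<diamondop> s \<diamondop> t)"
| unit_tens: "typed s u v \<Longrightarrow> tl_eq u v (Id [] \<diamondop> s) s"
| tens_unit: "typed s u v \<Longrightarrow> tl_eq u v (s \<diamondop> Id []) s"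
| tens_plus: "\<lbrakk>typed r u v; typed s u' v'; typed t u' v'\<rbrakk>
    \<Longrightarrow> tl_eq (u @ u') (v @ v') (r \<diamondop> Plus s t) (Plus (r \<diamondop> s) (r \<diamondop> t))"
| plus_tens: "\<lbrakk>typed r u v; typed s u v; typed t u' v'\<rbrakk>
    \<Longrightarrow> tl_eq (u @ u') (v @ v') (Plus r s \<diamondop> t) (Plus (r \<diamondop> t) (s \<diamondop> t))"
| tens_scale: "\<lbrakk>typed s u v; typed t u' v'\<rbrakk>
    \<Longrightarrow> tl_eq (u @ u') (v @ v') (s \<diamondop> Scale a t) (Scale a (s \<diamondop> t))"
| scale_tens: "\<lbrakk>typed s u v; typed t u' v'\<rbrakk>
    \<Longrightarrow> tl_eq (u @ u') (v @ v') (Scale a s \<diamondop> t) (Scale a (s \<diamondop> t))"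

| zigzag_left: "tl_eq [c] [c] ((Cap c \<diamondop> Id [c]) \<bullet> (Id [c] \<diamondop> Cup c)) (Id [c])"
| zigzag_right: "tl_eq [c] [c] ((Id [c] \<diamondop> Cap c) \<bullet> (Cup c \<diamondop> Id [c])) (Id [c])"
| loop: "tl_eq [] [] (Cap c \<bullet> Cup c) (Scale (complex_of_real golden) (Id []))"
| jw4: "tl_eq [c, c, c, c] [c, c, c, c] (jones_wenzl c 4) (Zero [c, c, c, c] [c, c, c, c])"

fun reflect :: "tl \<Rightarrow> tl" where
  "reflect (Id u) = Id u"
| "reflect (Cap c) = Cup c"
| "reflect (Cup c) = Cap c"
| "reflect (t \<bullet> s) = reflect s \<bullet> reflect t"
| "reflect (s \<diamondop> t) = reflect s \<diamondop> reflect t"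
| "reflect (Zero u v) = Zero v u"
| "reflect (Plus s t) = Plus (reflect s) (reflect t)"
| "reflect (Scale a s) = Scale (cnj a) (reflect s)"

text \<open>Nested caps from the reversed word followed by the word to the empty word, and nested cups from
  the empty word to the word followed by the reversed word.\<close>

fun caps :: "colour list \<Rightarrow> tl" where
  "caps [] = Id []"
| "caps (c # u) = caps u \<bullet> (Id (rev u) \<diamondop> Cap c \<diamondop> Id u)"

fun cups :: "colour list \<Rightarrow> tl" where
  "cups [] = Id []"
| "cups (c # u) = (Id [c] \<diamondop> cups u \<diamondop> Id [c]) \<bullet> Cup c"


section \<open>The free product of two Fibonacci categories\<close>

text \<open>The even half of the Temperley--Lieb category of type \<open>A\<^sub>4\<close> consists of the even numbers of
  strands, and its nontrivial simple object is the image of the second Jones--Wenzl projection.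
  So the letter \<open>Rho\<close> (or \<open>Mu\<close>) stands for two parallel strands of that colour, cut down by
  \<open>jones_wenzl c 2\<close>, and a word for the tensor product of its letters.  The category with these words
  as objects is the free product, up to completion under direct sums and summands: two strands of one
  colour are the direct sum of the unit and the letter of that colour.

  A morphism is a triple consisting of source, target, and the class of a diagram that is cut down
  on both sides.\<close>

definition strands :: "colour list \<Rightarrow> colour list" where
  "strands w = concat (map (\<lambda>c. [c, c]) w)"

definition proj :: "colour list \<Rightarrow> tl" where
  "proj w = foldr (\<lambda>c t. jones_wenzl c 2 \<diamondop> t) w (Id [])"

type_synonym fp_arr = "colour list \<times> colour list \<times> tl set"

definition cut :: "colour list \<Rightarrow> colour list \<Rightarrow> tl \<Rightarrow> fp_arr" where
  "cut w v t = (w, v, {s. tl_eq (strands w) (strands v) (proj v \<bullet> t \<bullet> proj w) s})"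

definition src :: "fp_arr \<Rightarrow> colour list" where
  "src f = fst f"

definition tgt :: "fp_arr \<Rightarrow> colour list" where
  "tgt f = fst (snd f)"

definition rep :: "fp_arr \<Rightarrow> tl" where
  "rep f = (SOME t. t \<in> snd (snd f))"

definition T2T2 :: "(colour list, fp_arr) pivotal_data" where
  "T2T2 = \<lparr>
     Obj = UNIV,
     Arr = {cut w v t | w v t. typed t (strands w) (strands v)},
     dom = src,
     cod = tgt,
     ident = (\<lambda>w. cut w w (Id (strands w))),
     cmp = (\<lambda>g f. cut (src f) (tgt g) (rep g \<bullet> rep f)),
     azero = (\<lambda>w v. cut w v (Zero (strands w) (strands v))),
     aplus = (\<lambda>f g. cut (src f) (tgt f) (Plus (rep f) (rep g))),
     ascale = (\<lambda>a f. cut (src f) (tgt f) (Scale a (rep f))),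
     star = (\<lambda>f. cut (tgt f) (src f) (reflect (rep f))),
     tunit = [],
     tobj = (@),
     tarr = (\<lambda>f g. cut (src f @ src g) (tgt f @ tgt g) (rep f \<diamondop> rep g)),
     assoc = (\<lambda>u v w. cut (u @ v @ w) (u @ v @ w) (Id (strands (u @ v @ w)))),
     lunit = (\<lambda>w. cut w w (Id (strands w))),
     runit = (\<lambda>w. cut w w (Id (strands w))),
     dual = rev,
     ev = (\<lambda>w. cut (rev w @ w) [] (caps (strands w))),
     coev = (\<lambda>w. cut [] (w @ rev w) (cups (strands w))),
     piv = (\<lambda>w. cut w w (Id (strands w)))\<rparr>"


section \<open>The quotients generated by a rotational eigenvector\<close>

fun other :: "colour \<Rightarrow> colour" where
  "other Rho = Mu"
| "other Mu = Rho"

fun alternating :: "colour \<Rightarrow> nat \<Rightarrow> colour list" where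
  "alternating c 0 = []"
| "alternating c (Suc k) = c # alternating (other c) k"

definition P :: "nat \<Rightarrow> colour list" where
  "P k = alternating Rho k"

definition Q :: "nat \<Rightarrow> colour list" where
  "Q k = alternating Mu k"

text \<open>For \<open>f : F a \<rightarrow> F b\<close> and \<open>g : F c \<rightarrow> F d\<close> this is \<open>f \<otimes> g\<close>, read as a morphism
  \<open>F (a \<otimes> c) \<rightarrow> F (b \<otimes> d)\<close> through the structure isomorphisms of \<open>F\<close>.\<close>

definition ftensor ::
    "('p, 'q) pivotal_data \<Rightarrow> (colour list, fp_arr, 'p, 'q) tensor_functor_data \<Rightarrow>
     colour list \<Rightarrow> colour list \<Rightarrow> colour list \<Rightarrow> colour list \<Rightarrow> 'q \<Rightarrow> 'q \<Rightarrow> 'q" where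
  "ftensor D F a b c d f g =
     cmp D (tmul F b d) (cmp D (tarr D f g) (inverse_arr D (tmul F a c)))"

text \<open>The rotations of \<open>U : F (P n) \<rightarrow> F (Q n)\<close>.  The letters of \<open>T2T2\<close> are their own duals, so
  \<open>ev T2T2 [z]\<close> and \<open>coev T2T2 [z]\<close> are the cap \<open>zz \<rightarrow> 1\<close> and the cup \<open>1 \<rightarrow> zz\<close>.\<close>

definition rotation ::
    "('p, 'q) pivotal_data \<Rightarrow> (colour list, fp_arr, 'p, 'q) tensor_functor_data \<Rightarrow> nat \<Rightarrow> 'q \<Rightarrow> 'q" where
  "rotation D F n U =
     (let y = last (Q n); one = (\<lambda>w. ident D (fobj F w)) in
       cmp D (ftensor D F (P n) (P n) [y, y] [] (one (P n)) (farr F (ev T2T2 [y])))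
      (cmp D (ftensor D F [Rho] [Rho] (P n @ [y]) (Q n @ [y]) (one [Rho])
                (ftensor D F (P n) (Q n) [y] [y] U (one [y])))
             (ftensor D F [] [Rho, Rho] (Q n) (Q n) (farr F (coev T2T2 [Rho])) (one (Q n)))))"

definition rotation_inv ::
    "('p, 'q) pivotal_data \<Rightarrow> (colour list, fp_arr, 'p, 'q) tensor_functor_data \<Rightarrow> nat \<Rightarrow> 'q \<Rightarrow> 'q" where
  "rotation_inv D F n U =
     (let x = last (P n); one = (\<lambda>w. ident D (fobj F w)) in
       cmp D (ftensor D F [Mu, Mu] [] (P n) (P n) (farr F (ev T2T2 [Mu])) (one (P n)))
      (cmp D (ftensor D F [Mu] [Mu] (P n @ [x]) (Q n @ [x]) (one [Mu])
                (ftensor D F (P n) (Q n) [x] [x] U (one [x])))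
             (ftensor D F (Q n) (Q n) [] [x, x] (one (Q n)) (farr F (coev T2T2 [x])))))"

inductive generated ::
    "('p, 'q) pivotal_data \<Rightarrow> (colour list, fp_arr, 'p, 'q) tensor_functor_data \<Rightarrow>
     colour list \<Rightarrow> colour list \<Rightarrow> 'q \<Rightarrow> colour list \<Rightarrow> colour list \<Rightarrow> 'q \<Rightarrow> bool"
  for D F p q U where
  image: "f \<in> hom T2T2 a b \<Longrightarrow> generated D F p q U a b (farr F f)"
| generator: "generated D F p q U p q U"
| cmp: "\<lbrakk>generated D F p q U b c g; generated D F p q U a b f\<rbrakk> \<Longrightarrow> generated D F p q U a c (cmp D g f)"
| tensor: "\<lbrakk>generated D F p q U a b f; generated D F p q U c d g\<rbrakk>
    \<Longrightarrow> generated D F p q U (a @ c) (b @ d) (ftensor D F a b c d f g)"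
| plus: "\<lbrakk>generated D F p q U a b f; generated D F p q U a b g\<rbrakk> \<Longrightarrow> generated D F p q U a b (aplus D f g)"
| scale: "generated D F p q U a b f \<Longrightarrow> generated D F p q U a b (ascale D z f)"
| star: "generated D F p q U a b f \<Longrightarrow> generated D F p q U b a (star D f)"

text \<open>\<open>TT n \<omega> D\<close>: the category \<open>D\<close> is a realisation of \<open>\<T>\<T>\<^sub>n\<^sub>,\<^sub>\<omega>\<close>.\<close>

definition TT :: "nat \<Rightarrow> complex \<Rightarrow> ('p, 'q) pivotal_data \<Rightarrow> bool" where
  "TT n \<omega> D \<longleftrightarrow> n \<ge> 2 \<and> \<omega> ^ n = 1 \<and>
     (\<exists>F U. unitary_quotient T2T2 D F \<and>
        isomorphic D (fobj F (P n)) (fobj F (Q n)) \<and>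
        (\<forall>k. 2 \<le> k \<and> k < n \<longrightarrow> \<not> isomorphic D (fobj F (P k)) (fobj F (Q k))) \<and>
        U \<in> hom D (fobj F (P n)) (fobj F (Q n)) \<and> unitary_arr D U \<and>
        rotation_inv D F n U = star D U \<and>
        star D U = ascale D (inverse \<omega>) (rotation D F n U) \<and>
        (\<forall>a b. \<forall>f \<in> hom D (fobj F a) (fobj F b). generated D F (P n) (Q n) U a b f))"

end

theory Submission
  imports Defs
begin

text \<open>Write \<open>\<rho>\<close>, \<open>\<mu>\<close> for the two letters and \<open>\<tau>\<close> for the golden ratio.  Besides cups and caps, the free product has a
trivalent vertex \<open>t\<^sub>c : cc \<rightarrow> c\<close> for each letter.  It is invariant under rotation, and the letters obey
\<open>1 = \<tau>\<^sup>-\<^sup>1 cup cap + \<tau>\<^sup>2 t\<^sub>c\<^sup>* t\<^sub>c\<close> on \<open>cc\<close>; this is what the vanishing of the fourth Jones--Wenzl projection says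
about the image of the second one (\<open>jw_tensor_jw\<close>, \<open>letter_decomposition\<close>).  The unitary
\<open>U : P\<^sub>n \<rightarrow> Q\<^sub>n\<close> is one more vertex, and the two rotation equations say that a cap on the last letter of
\<open>Q\<^sub>n\<close> can be slid across \<open>U\<close>: it becomes a cap on the first letter of \<open>P\<^sub>n\<close> and \<open>U\<close> becomes \<open>U\<^sup>*\<close>, with a factor
\<open>\<omega>\<close>; for \<open>U\<^sup>*\<close> in place of \<open>U\<close> the factor is \<open>1\<close> (\<open>cap_of_rotation\<close>, \<open>cap_of_inverse_rotation\<close>).
The theorem holds because sliding a trivalent vertex across \<open>U\<close> must be compatible with this.

Irreducibility makes vertices slide.  No letter of a unitary quotient contains the unit
(\<open>letter_no_vector\<close>): the complement of a copy of the unit in \<open>c\<close> would have dimension \<open>\<tau> - 1 < 1\<close>, and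
the Gram matrix of the two ways of joining four copies of it by cups would have a negative eigenvalue.
Bending strands and cutting \<open>cc\<close> into \<open>1\<close> and \<open>c\<close> then shows that \<open>Q\<^sub>n\<close> is irreducible for \<open>n = 2, 3\<close>, as
long as \<open>\<rho>\<close> and \<open>\<mu>\<close>, and for \<open>n = 3\<close> also \<open>\<rho>\<mu>\<close> and \<open>\<mu>\<rho>\<close>, are not isomorphic
(\<open>scalar_end_bend\<close>).  Hence, for a unitary \<open>U : c B \<rightarrow> B d\<close>,
  \<open>U (t\<^sub>c \<otimes> 1) = l (1 \<otimes> t\<^sub>d) (U \<otimes> 1) (1 \<otimes> U)\<close>
for some scalar \<open>l\<close>, and comparing this with its rotated adjoint gives \<open>l\<^sup>2 k = 1\<close>, where \<open>k\<close> is the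
factor for sliding a cap across \<open>U\<close> (\<open>trivalent_passes\<close>).  Used for \<open>U\<close> this gives \<open>l\<close> with \<open>l\<^sup>2 \<omega> = 1\<close>,
and for \<open>U\<^sup>*\<close> it gives a sign \<open>\<epsilon>\<close>.

For \<open>n = 2\<close> and \<open>\<rho>\<close>, \<open>\<mu>\<close> not isomorphic, slide a \<open>\<rho>\<close>-cap across a \<open>\<mu>\<close>-vertex.  On one side of the vertex
the cap crosses one strand, at the cost of \<open>\<omega>\<close>; on the other side it crosses two, at the cost of \<open>\<omega>\<^sup>2\<close>,
and the vertex itself has slid across two \<open>\<rho>\<close>-strands, at the cost of \<open>\<epsilon>\<^sup>-\<^sup>2 = 1\<close>.  So \<open>\<omega> = \<omega>\<^sup>2\<close>
(\<open>two_letters_disjoint\<close>).  If \<open>\<rho>\<close> and \<open>\<mu>\<close> are isomorphic, then \<open>U\<close> becomes an endomorphism of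
\<open>\<rho>\<rho>\<close>, that is, a combination of \<open>1\<close> and \<open>cup cap\<close>.  Both rotations exchange these two diagrams, so they
agree on \<open>U\<close> and again \<open>\<omega> = 1\<close> (\<open>two_letters_identified\<close>).

For \<open>n = 3\<close> the relations above also give \<open>U (1 \<otimes> t\<^sub>\<mu> \<otimes> 1) = m (1 \<otimes> t\<^sub>\<rho> \<otimes> 1) (1 \<otimes> cap \<otimes> 1) (U \<otimes> U) (1 \<otimes> cup \<otimes> 1)\<close>
with \<open>m = \<epsilon> / \<omega>\<close>.  In the diagram \<open>U (t\<^sub>\<rho> \<otimes> 1 \<otimes> t\<^sub>\<rho>) (1 \<otimes> U\<^sup>* \<otimes> 1)\<close> either of the two vertices can be
slid across \<open>U\<^sup>*\<close> first.  Both ways lead to the same diagram, with factors \<open>l m\<close> and \<open>m / \<epsilon>\<close>.  Hence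
\<open>l \<epsilon> = 1\<close>, so \<open>l\<close> is the sign \<open>\<epsilon>\<close> and \<open>\<omega> = l\<^sup>-\<^sup>2 = 1\<close> (\<open>three_letters\<close>).

Diagrams are lists of layers, each layer one arrow placed at a position of the current word.  The
interchange law is decided by a normal form of such lists that the simplifier computes.  This needs a
strict monoidal category.  A quotient is not strict, but the morphisms between images of words become
a strict category once the tensor product is read through the structure isomorphisms of the
functor.\<close>

section \<open>Strict monoidal linear categories and layered diagrams\<close>

text \<open>Objects are words, so that concatenation is strictly associative.  The source \<open>dm\<close> and target \<open>cd\<close> are
total functions given on compound arrows without side conditions; only \<open>arr\<close> says that an expression
is meaningful.  In this way the type of a diagram is computed by rewriting.\<close>

locale strict_linear_category =
  fixes arr :: "'a \<Rightarrow> bool"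
    and dm cd :: "'a \<Rightarrow> 'c list"
    and idn :: "'c list \<Rightarrow> 'a"
    and comp :: "'a \<Rightarrow> 'a \<Rightarrow> 'a"  (infixr "\<star>" 70)
    and tens :: "'a \<Rightarrow> 'a \<Rightarrow> 'a"  (infixr "\<parallel>" 75)
    and zero :: "'c list \<Rightarrow> 'c list \<Rightarrow> 'a"
    and add :: "'a \<Rightarrow> 'a \<Rightarrow> 'a"
    and scl :: "complex \<Rightarrow> 'a \<Rightarrow> 'a"
  assumes arr_idn [simp]: "arr (idn w)"
    and dm_idn [simp]: "dm (idn w) = w"
    and cd_idn [simp]: "cd (idn w) = w"
    and arr_comp [simp]: "\<lbrakk>arr g; arr f; dm g = cd f\<rbrakk> \<Longrightarrow> arr (g \<star> f)"
    and dm_comp [simp]: "dm (g \<star> f) = dm f"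
    and cd_comp [simp]: "cd (g \<star> f) = cd g"
    and arr_tens [simp]: "\<lbrakk>arr f; arr g\<rbrakk> \<Longrightarrow> arr (f \<parallel> g)"
    and dm_tens [simp]: "dm (f \<parallel> g) = dm f @ dm g"
    and cd_tens [simp]: "cd (f \<parallel> g) = cd f @ cd g"
    and arr_zero [simp]: "arr (zero u v)"
    and dm_zero [simp]: "dm (zero u v) = u"
    and cd_zero [simp]: "cd (zero u v) = v"
    and arr_add [simp]: "\<lbrakk>arr f; arr g; dm f = dm g; cd f = cd g\<rbrakk> \<Longrightarrow> arr (add f g)"
    and dm_add [simp]: "dm (add f g) = dm f"
    and cd_add [simp]: "cd (add f g) = cd f"
    and arr_scl [simp]: "arr f \<Longrightarrow> arr (scl a f)"
    and dm_scl [simp]: "dm (scl a f) = dm f"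
    and cd_scl [simp]: "cd (scl a f) = cd f"
    and comp_assoc: "\<lbrakk>arr h; arr g; arr f; dm h = cd g; dm g = cd f\<rbrakk> \<Longrightarrow> (h \<star> g) \<star> f = h \<star> g \<star> f"
    and idn_comp: "\<lbrakk>arr f; cd f = w\<rbrakk> \<Longrightarrow> idn w \<star> f = f"
    and comp_idn: "\<lbrakk>arr f; dm f = w\<rbrakk> \<Longrightarrow> f \<star> idn w = f"
    and tens_assoc: "\<lbrakk>arr f; arr g; arr h\<rbrakk> \<Longrightarrow> (f \<parallel> g) \<parallel> h = f \<parallel> g \<parallel> h"
    and idn_tens: "arr f \<Longrightarrow> idn [] \<parallel> f = f"
    and tens_idn: "arr f \<Longrightarrow> f \<parallel> idn [] = f"
    and idn_tens_idn: "idn u \<parallel> idn v = idn (u @ v)"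
    and interchange: "\<lbrakk>arr g; arr f; arr g'; arr f'; dm g = cd f; dm g' = cd f'\<rbrakk>
          \<Longrightarrow> (g \<parallel> g') \<star> (f \<parallel> f') = (g \<star> f) \<parallel> (g' \<star> f')"
    and add_assoc: "\<lbrakk>arr f; arr g; arr h; dm f = dm g; dm g = dm h; cd f = cd g; cd g = cd h\<rbrakk>
          \<Longrightarrow> add (add f g) h = add f (add g h)"
    and add_comm: "\<lbrakk>arr f; arr g; dm f = dm g; cd f = cd g\<rbrakk> \<Longrightarrow> add f g = add g f"
    and add_zero: "\<lbrakk>arr f; dm f = u; cd f = v\<rbrakk> \<Longrightarrow> add f (zero u v) = f"
    and add_neg: "\<lbrakk>arr f; dm f = u; cd f = v\<rbrakk> \<Longrightarrow> add f (scl (- 1) f) = zero u v"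
    and scl_add: "\<lbrakk>arr f; arr g; dm f = dm g; cd f = cd g\<rbrakk> \<Longrightarrow> scl a (add f g) = add (scl a f) (scl a g)"
    and add_scl: "arr f \<Longrightarrow> scl (a + b) f = add (scl a f) (scl b f)"
    and scl_scl: "arr f \<Longrightarrow> scl a (scl b f) = scl (a * b) f"
    and scl_one: "arr f \<Longrightarrow> scl 1 f = f"
    and comp_add: "\<lbrakk>arr h; arr f; arr g; dm f = dm g; cd f = cd g; dm h = cd f\<rbrakk>
          \<Longrightarrow> h \<star> add f g = add (h \<star> f) (h \<star> g)"
    and add_comp: "\<lbrakk>arr h; arr f; arr g; dm f = dm g; cd f = cd g; dm f = cd h\<rbrakk>
          \<Longrightarrow> add f g \<star> h = add (f \<star> h) (g \<star> h)"
    and comp_scl: "\<lbrakk>arr g; arr f; dm g = cd f\<rbrakk> \<Longrightarrow> g \<star> scl a f = scl a (g \<star> f)"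
    and scl_comp: "\<lbrakk>arr g; arr f; dm g = cd f\<rbrakk> \<Longrightarrow> scl a g \<star> f = scl a (g \<star> f)"
    and tens_add: "\<lbrakk>arr h; arr f; arr g; dm f = dm g; cd f = cd g\<rbrakk>
          \<Longrightarrow> h \<parallel> add f g = add (h \<parallel> f) (h \<parallel> g)"
    and add_tens: "\<lbrakk>arr h; arr f; arr g; dm f = dm g; cd f = cd g\<rbrakk>
          \<Longrightarrow> add f g \<parallel> h = add (f \<parallel> h) (g \<parallel> h)"
    and tens_scl: "\<lbrakk>arr f; arr g\<rbrakk> \<Longrightarrow> f \<parallel> scl a g = scl a (f \<parallel> g)"
    and scl_tens: "\<lbrakk>arr f; arr g\<rbrakk> \<Longrightarrow> scl a f \<parallel> g = scl a (f \<parallel> g)"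
begin

lemma scl_zero_left: "\<lbrakk>arr f; dm f = u; cd f = v\<rbrakk> \<Longrightarrow> scl 0 f = zero u v"
  using add_scl[of f 1 "-1"] add_neg[of f u v] scl_one[of f] by simp

lemma scl_zero: "scl a (zero u v) = zero u v"
  using scl_zero_left[of "zero u v" u v] scl_scl[of "zero u v" a 0] by simp

lemma zero_add: "\<lbrakk>arr f; dm f = u; cd f = v\<rbrakk> \<Longrightarrow> add (zero u v) f = f"
  using add_zero[of f u v] add_comm[of f "zero u v"] by simp

lemma zero_comp: "\<lbrakk>arr f; cd f = v; dm f = u\<rbrakk> \<Longrightarrow> zero v w \<star> f = zero u w"
  using scl_comp[of "zero v w" f 0] scl_zero[of 0 v w] scl_zero_left[of "zero v w \<star> f" u w] by simp

lemma add_cancel_left: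
  assumes "add f g = add f h" "arr f" "arr g" "arr h" "dm f = dm g" "dm f = dm h" "cd f = cd g" "cd f = cd h"
  shows "g = h"
proof -
  have *: "add (scl (- 1) f) (add f k) = k" if "arr k" "dm f = dm k" "cd f = cd k" for k
    using that assms(2) add_assoc[of "scl (-1) f" f k] add_comm[of f "scl (-1) f"] add_neg[of f "dm f" "cd f"]
      zero_add[of k "dm f" "cd f"] by simp
  show ?thesis
    using *[of g] *[of h] assms by metis
qed

text \<open>A layer \<open>(i, g)\<close> applies \<open>g\<close> to the letters of the current word from position \<open>i\<close> on, with identities
on both sides, so \<open>wh i g w\<close> is \<open>1 \<otimes> g \<otimes> 1\<close>.  A diagram is a list of layers, the first one being
applied first.\<close>

definition wh :: "nat \<Rightarrow> 'a \<Rightarrow> 'c list \<Rightarrow> 'a" where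
  "wh i g w = idn (take i w) \<parallel> g \<parallel> idn (drop (i + length (dm g)) w)"

definition act :: "nat \<Rightarrow> 'a \<Rightarrow> 'c list \<Rightarrow> 'c list" where
  "act i g w = take i w @ cd g @ drop (i + length (dm g)) w"

definition fits :: "nat \<Rightarrow> 'a \<Rightarrow> 'c list \<Rightarrow> bool" where
  "fits i g w \<longleftrightarrow> arr g \<and> i \<le> length w \<and> take (length (dm g)) (drop i w) = dm g"

fun run :: "'c list \<Rightarrow> (nat \<times> 'a) list \<Rightarrow> 'a" where
  "run w [] = idn w"
| "run w ((i, g) # ls) = run (act i g w) ls \<star> wh i g w"

fun ok :: "'c list \<Rightarrow> (nat \<times> 'a) list \<Rightarrow> bool" where
  "ok w [] \<longleftrightarrow> True"
| "ok w ((i, g) # ls) \<longleftrightarrow> fits i g w \<and> ok (act i g w) ls"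

fun tgt :: "'c list \<Rightarrow> (nat \<times> 'a) list \<Rightarrow> 'c list" where
  "tgt w [] = w"
| "tgt w ((i, g) # ls) = tgt (act i g w) ls"

definition shift :: "nat \<Rightarrow> (nat \<times> 'a) list \<Rightarrow> (nat \<times> 'a) list" where
  "shift k ls = map (\<lambda>(i, g). (k + i, g)) ls"

lemma shift_simps [simp]: "shift k [] = []" "shift k ((i, g) # ls) = (k + i, g) # shift k ls"
  by (simp_all add: shift_def)

lemma fitsE:
  assumes "fits i g w"
  obtains u v where "w = u @ dm g @ v" "i = length u" "arr g"
proof -
  have "w = take i w @ dm g @ drop (length (dm g)) (drop i w)"
    using assms append_take_drop_id[of "length (dm g)" "drop i w"] unfolding fits_def by simp
  then show ?thesis
    using that assms unfolding fits_def by (metis length_take min.absorb2)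
qed

lemma fits_mid [simp]: "arr g \<Longrightarrow> fits (length u) g (u @ dm g @ v)"
  by (simp add: fits_def)

lemma act_mid [simp]: "act (length u) g (u @ dm g @ v) = u @ cd g @ v"
  by (simp add: act_def)

lemma wh_mid [simp]: "wh (length u) g (u @ dm g @ v) = idn u \<parallel> g \<parallel> idn v"
  by (simp add: wh_def)

lemma wh_props:
  assumes "fits i g w"
  shows "arr (wh i g w)" "dm (wh i g w) = w" "cd (wh i g w) = act i g w"
  using assms by (auto elim!: fitsE)

lemma run_props:
  assumes "ok w ls"
  shows "arr (run w ls)" "dm (run w ls) = w" "cd (run w ls) = tgt w ls"
  using assms by (induction ls arbitrary: w) (auto simp: wh_props)

lemma tgt_append [simp]: "tgt w (xs @ ys) = tgt (tgt w xs) ys"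
  by (induction xs arbitrary: w) auto

lemma ok_append [simp]: "ok w (xs @ ys) \<longleftrightarrow> ok w xs \<and> ok (tgt w xs) ys"
  by (induction xs arbitrary: w) auto

lemma run_append: "ok w (xs @ ys) \<Longrightarrow> run w (xs @ ys) = run (tgt w xs) ys \<star> run w xs"
  by (induction xs arbitrary: w) (auto simp: comp_idn comp_assoc run_props wh_props)

lemma run_whisker:
  assumes "ok w ls"
  shows "run (u @ w @ v) (shift (length u) ls) = idn u \<parallel> run w ls \<parallel> idn v
    \<and> ok (u @ w @ v) (shift (length u) ls) \<and> tgt (u @ w @ v) (shift (length u) ls) = u @ tgt w ls @ v"
  using assms
proof (induction ls arbitrary: w)
  case Nil
  then show ?case by (simp add: idn_tens_idn)
next
  case (Cons l ls)
  obtain i g where l: "l = (i, g)" by (cases l)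
  obtain a b where w: "w = a @ dm g @ b" and i: "i = length a" and g: "arr g"
    using Cons.prems l by (auto elim: fitsE)
  have pos: "length u + length a = length (u @ a)" "u @ w @ v = (u @ a) @ dm g @ (b @ v)"
    by (simp_all add: w)
  have act: "act (length u + i) g (u @ w @ v) = u @ act i g w @ v"
    unfolding i pos act_mid by (simp add: w)
  have wh: "wh (length u + i) g (u @ w @ v) = idn u \<parallel> wh i g w \<parallel> idn v"
    unfolding i pos wh_mid using g by (simp add: w idn_tens_idn[symmetric] tens_assoc)
  have fits: "fits (length u + i) g (u @ w @ v)"
    unfolding i pos by (rule fits_mid[OF g])
  have ok: "ok (act i g w) ls" using Cons.prems l by simp
  note IH = Cons.IH[OF ok]
  have f: "fits i g w" using Cons.prems l by simp
  show ?case
    using IH fits run_props[OF ok] wh_props[OF f]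
    by (simp add: l act wh interchange idn_comp)
qed

text \<open>All equations between diagrams in the argument hold up to a scalar that has to be tracked.  With
\<open>c = 0\<close> the relation says that the left side vanishes.\<close>

definition rel :: "'c list \<Rightarrow> complex \<Rightarrow> (nat \<times> 'a) list \<Rightarrow> (nat \<times> 'a) list \<Rightarrow> bool" where
  "rel w c xs ys \<longleftrightarrow> ok w xs \<and> ok w ys \<and> run w xs = scl c (run w ys)"

lemma rel_trans [trans]: "rel w a xs ys \<Longrightarrow> rel w b ys zs \<Longrightarrow> rel w (a * b) xs zs"
  by (simp add: rel_def scl_scl run_props)

lemma rel_tgt: "rel w c xs ys \<Longrightarrow> tgt w xs = tgt w ys"
  unfolding rel_def using run_props(3) by (metis cd_scl)

lemma rel_refl: "ok w xs \<Longrightarrow> rel w 1 xs xs"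
  by (simp add: rel_def scl_one run_props)

lemma rel_sym: "rel w c xs ys \<Longrightarrow> c \<noteq> 0 \<Longrightarrow> rel w (1 / c) ys xs"
  by (auto simp: rel_def scl_scl scl_one run_props)

lemma rel_whisker:
  assumes "rel w c xs ys"
  shows "rel (u @ w @ v) c (shift (length u) xs) (shift (length u) ys)"
  using assms run_whisker[of w xs u v] run_whisker[of w ys u v]
  by (auto simp: rel_def tens_scl scl_tens run_props)

lemma rel_append:
  assumes "rel (tgt w pre) c xs ys" "ok w pre" "ok (tgt (tgt w pre) xs) post"
  shows "rel w c (pre @ xs @ post) (pre @ ys @ post)"
proof -
  have t: "tgt (tgt w pre) xs = tgt (tgt w pre) ys" using rel_tgt[OF assms(1)] .
  show ?thesis
    using assms t unfolding rel_def
    by (auto simp: run_append run_props comp_scl scl_comp)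
qed

text \<open>Two consecutive layers commute when the second acts entirely to the left of the first; the position
of the layer that is passed changes by the difference of the lengths of target and source.  A pass of
bubble sort moves layers that act further to the left towards the front, and as many passes as there
are layers give a normal form.  Its value is unchanged, so diagrams with a common normal form are
equal.\<close>

fun pass :: "(nat \<times> 'a) list \<Rightarrow> (nat \<times> 'a) list" where
  "pass [] = []"
| "pass [l] = [l]"
| "pass ((i, g) # (j, h) # ls) =
     (if j + length (dm h) \<le> i
      then (j, h) # pass ((i + length (cd h) - length (dm h), g) # ls)
      else (i, g) # pass ((j, h) # ls))"

fun passes :: "(nat \<times> 'a) list \<Rightarrow> (nat \<times> 'a) list \<Rightarrow> (nat \<times> 'a) list" where
  "passes [] ls = ls"
| "passes (k # ks) ls = passes ks (pass ls)"

definition nf :: "(nat \<times> 'a) list \<Rightarrow> (nat \<times> 'a) list" where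
  "nf ls = passes ls ls"

text \<open>The word splits as \<open>u @ dm h @ b @ dm g @ v\<close>.  Both orders of the two layers are then equal to the
same tensor product by the interchange law.\<close>

lemma run_swap:
  assumes "ok w ((i, g) # (j, h) # ls)" "j + length (dm h) \<le> i"
  shows "ok w ((j, h) # (i + length (cd h) - length (dm h), g) # ls) \<and>
    run w ((j, h) # (i + length (cd h) - length (dm h), g) # ls) = run w ((i, g) # (j, h) # ls)"
proof -
  from assms(1) have f: "fits i g w" and f': "fits j h (act i g w)" and k: "ok (act j h (act i g w)) ls"
    by auto
  from f obtain a v where w: "w = a @ dm g @ v" and i: "i = length a" and g: "arr g" by (elim fitsE)
  have act: "act i g w = a @ cd g @ v" unfolding w i by simp
  have j: "j + length (dm h) \<le> length a" using assms(2) i by simp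
  have h: "arr h" using f' by (simp add: fits_def)
  have "take (length (dm h)) (drop j a) = dm h"
    using f' j unfolding act fits_def by simp
  then have "fits j h a" using j h unfolding fits_def by simp
  then obtain u b where a: "a = u @ dm h @ b" and j: "j = length u" by (elim fitsE)
  have 1: "w = u @ dm h @ (b @ dm g @ v)" "w = (u @ dm h @ b) @ dm g @ v" by (simp_all add: w a)
  have 2: "i = length (u @ dm h @ b)" "i + length (cd h) - length (dm h) = length (u @ cd h @ b)"
    by (simp_all add: i a)
  have 3: "act j h w = (u @ cd h @ b) @ dm g @ v" unfolding 1(1) j act_mid by simp
  have 4: "act i g w = u @ dm h @ (b @ cd g @ v)" unfolding 1(2) 2(1) act_mid by simp
  have wh1: "wh j h w = idn u \<parallel> h \<parallel> idn b \<parallel> idn (dm g) \<parallel> idn v"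
    unfolding 1(1) j wh_mid by (simp add: idn_tens_idn)
  have wh2: "wh (length (u @ cd h @ b)) g ((u @ cd h @ b) @ dm g @ v)
      = idn u \<parallel> idn (cd h) \<parallel> idn b \<parallel> g \<parallel> idn v"
    unfolding wh_mid using g by (simp add: idn_tens_idn[symmetric] tens_assoc)
  have wh3: "wh i g w = idn u \<parallel> idn (dm h) \<parallel> idn b \<parallel> g \<parallel> idn v"
    unfolding 1(2) 2(1) wh_mid using g by (simp add: idn_tens_idn[symmetric] tens_assoc)
  have wh4: "wh (length u) h (u @ dm h @ (b @ cd g @ v)) = idn u \<parallel> h \<parallel> idn b \<parallel> idn (cd g) \<parallel> idn v"
    unfolding wh_mid by (simp add: idn_tens_idn)
  have eq: "act (length (u @ cd h @ b)) g ((u @ cd h @ b) @ dm g @ v) = act (length u) h (u @ dm h @ (b @ cd g @ v))"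
    unfolding act_mid by simp
  have k': "ok (act (length (u @ cd h @ b)) g ((u @ cd h @ b) @ dm g @ v)) ls"
    using k unfolding eq 4 j .
  have fa: "fits j h w" unfolding 1(1) j by (rule fits_mid[OF h])
  have fb: "fits (length (u @ cd h @ b)) g ((u @ cd h @ b) @ dm g @ v)" by (rule fits_mid[OF g])
  let ?R = "run (act (length u) h (u @ dm h @ (b @ cd g @ v))) ls"
  have dmR: "dm ?R = u @ cd h @ b @ cd g @ v" "arr ?R"
    using run_props[OF k'] unfolding eq by simp_all
  have okL: "ok w ((j, h) # (i + length (cd h) - length (dm h), g) # ls)"
    unfolding ok.simps 2(2) 3 using fa fb k' by blast
  have "run w ((j, h) # (i + length (cd h) - length (dm h), g) # ls)
      = (?R \<star> (idn u \<parallel> idn (cd h) \<parallel> idn b \<parallel> g \<parallel> idn v)) \<star> (idn u \<parallel> h \<parallel> idn b \<parallel> idn (dm g) \<parallel> idn v)"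
    unfolding run.simps 2(2) 3 wh1 wh2 eq ..
  also have "\<dots> = (?R \<star> (idn u \<parallel> h \<parallel> idn b \<parallel> idn (cd g) \<parallel> idn v)) \<star> (idn u \<parallel> idn (dm h) \<parallel> idn b \<parallel> g \<parallel> idn v)"
    using g h dmR by (simp add: comp_assoc interchange idn_comp comp_idn)
  also have "\<dots> = run w ((i, g) # (j, h) # ls)"
    unfolding run.simps wh3 4 j wh4 ..
  finally show ?thesis using okL by blast
qed

lemma pass_sound: "ok w ls \<Longrightarrow> ok w (pass ls) \<and> run w (pass ls) = run w ls"
proof (induction ls arbitrary: w rule: pass.induct)
  case (3 i g j h ls)
  show ?case
  proof (cases "j + length (dm h) \<le> i")
    case True
    have s: "ok w ((j, h) # (i + length (cd h) - length (dm h), g) # ls)"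
      "run w ((j, h) # (i + length (cd h) - length (dm h), g) # ls) = run w ((i, g) # (j, h) # ls)"
      using run_swap[OF 3(3) True] by auto
    have o: "ok (act j h w) ((i + length (cd h) - length (dm h), g) # ls)" using s(1) by simp
    show ?thesis
      using 3(1)[OF True o] s True by simp
  next
    case False
    have o: "ok (act i g w) ((j, h) # ls)" using 3(3) by simp
    show ?thesis using 3(2)[OF False o] 3(3) False by simp
  qed
qed auto

lemma nf_sound: "ok w ls \<Longrightarrow> ok w (nf ls) \<and> run w (nf ls) = run w ls"
proof -
  have "ok w ls \<Longrightarrow> ok w (passes ks ls) \<and> run w (passes ks ls) = run w ls" for ks ls
    by (induction ks arbitrary: ls) (auto simp: pass_sound)
  then show "ok w ls \<Longrightarrow> ?thesis" unfolding nf_def .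
qed

lemma rel_nf: "\<lbrakk>ok w xs; ok w ys; nf xs = nf ys\<rbrakk> \<Longrightarrow> rel w 1 xs ys"
  unfolding rel_def using nf_sound by (metis scl_one run_props(1))

text \<open>Rewriting inside a diagram: bring it by interchanges into a form where the left side of a rule stands
in consecutive layers, with \<open>pre\<close> before and \<open>post\<close> after it and \<open>i\<close> strands to its left, and replace it.
Naming \<open>pre\<close>, \<open>i\<close> and \<open>post\<close> leaves only computations for the simplifier.\<close>

definition plug :: "(nat \<times> 'a) list \<Rightarrow> nat \<Rightarrow> (nat \<times> 'a) list \<Rightarrow> (nat \<times> 'a) list \<Rightarrow> (nat \<times> 'a) list" where
  [simp]: "plug pre i post ls = pre @ shift i ls @ post"

lemma rel_at:
  assumes r: "rel w0 c ls rs"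
    and n: "nf xs = nf (plug pre i post ls)" "nf ys = nf (plug pre i post rs)"
    and o: "ok w xs" "ok w ys" "ok w pre"
    and w0: "i \<le> length (tgt w pre)" "take (length w0) (drop i (tgt w pre)) = w0"
    and o': "ok (tgt w pre) (shift i ls @ post)"
  shows "rel w c xs ys"
proof -
  obtain u v where uv: "tgt w pre = u @ w0 @ v" "i = length u"
    using w0 by (metis append_take_drop_id length_take min.absorb2)
  have R: "rel w c (plug pre i post ls) (plug pre i post rs)"
    unfolding plug_def by (rule rel_append) (use uv rel_whisker[OF r] o o' in auto)
  then have k: "ok w (plug pre i post ls)" "ok w (plug pre i post rs)"
    and e: "run w (plug pre i post ls) = scl c (run w (plug pre i post rs))"
    unfolding rel_def by auto
  have "run w xs = run w (plug pre i post ls)" using nf_sound[OF o(1)] nf_sound[OF k(1)] n(1) by metis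
  moreover have "run w ys = run w (plug pre i post rs)" using nf_sound[OF o(2)] nf_sound[OF k(2)] n(2) by metis
  ultimately show ?thesis using e o unfolding rel_def by simp
qed

lemma rel_back:
  assumes r: "rel w0 1 ls rs"
    and n: "nf xs = nf (plug pre i post rs)" "nf ys = nf (plug pre i post ls)"
    and "ok w xs" "ok w ys" "ok w pre"
    and "i \<le> length (tgt w pre)" "take (length w0) (drop i (tgt w pre)) = w0"
    and "ok (tgt w pre) (shift i rs @ post)"
  shows "rel w 1 xs ys"
  by (rule rel_at[OF _ n]) (use assms rel_sym[OF r] in simp_all)

text \<open>An arrow that is itself the value of a diagram may be replaced by the layers of that diagram.\<close>

lemma run_flatten:
  assumes "ok w0 ls" "ok w (pre @ (i, run w0 ls) # post)"
  shows "ok w (pre @ shift i ls @ post)" "run w (pre @ (i, run w0 ls) # post) = run w (pre @ shift i ls @ post)"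
proof -
  let ?w = "tgt w pre"
  have f: "fits i (run w0 ls) ?w" and p: "ok w pre" and q: "ok (act i (run w0 ls) ?w) post"
    using assms(2) by auto
  then obtain u v where uv: "?w = u @ w0 @ v" and i: "i = length u"
    using run_props[OF assms(1)] by (auto elim: fitsE)
  have a: "act i (run w0 ls) ?w = u @ tgt w0 ls @ v"
    using act_mid[of u "run w0 ls" v] run_props[OF assms(1)] uv i by simp
  have h: "wh i (run w0 ls) ?w = idn u \<parallel> run w0 ls \<parallel> idn v"
    using wh_mid[of u "run w0 ls" v] run_props[OF assms(1)] uv i by simp
  note W = run_whisker[OF assms(1), of u v]
  show "ok w (pre @ shift i ls @ post)" using p q W uv i a by simp
  then show "run w (pre @ (i, run w0 ls) # post) = run w (pre @ shift i ls @ post)"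
    using p q W uv i a h assms(2) by (simp add: run_append)
qed

lemma wh_add:
  assumes "fits i g w" "arr h" "dm h = dm g" "cd h = cd g"
  shows "wh i (add g h) w = add (wh i g w) (wh i h w)"
  using assms by (simp add: wh_def fits_def add_tens tens_add)

lemma wh_scl: "arr g \<Longrightarrow> wh i (scl a g) w = scl a (wh i g w)"
  by (simp add: wh_def tens_scl scl_tens)

lemma run_add:
  assumes o: "ok w (pre @ (i, g) # post)" and h: "arr h" "dm h = dm g" "cd h = cd g"
  shows "run w (pre @ (i, add g h) # post) = add (run w (pre @ (i, g) # post)) (run w (pre @ (i, h) # post))"
proof -
  let ?w = "tgt w pre"
  have f: "fits i g ?w" and p: "ok w pre" and q: "ok (act i g ?w) post" using o by auto
  have e: "act i (add g h) ?w = act i g ?w" "act i h ?w = act i g ?w" using h by (simp_all add: act_def)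
  have k: "fits i (add g h) ?w" "fits i h ?w" using f h by (auto simp: fits_def)
  show ?thesis
    using f p q k e h
    by (simp add: run_append run_props wh_props wh_add[OF f h] comp_add add_comp)
qed

lemma run_scl:
  assumes o: "ok w (pre @ (i, g) # post)"
  shows "run w (pre @ (i, scl a g) # post) = scl a (run w (pre @ (i, g) # post))"
proof -
  let ?w = "tgt w pre"
  have f: "fits i g ?w" and p: "ok w pre" and q: "ok (act i g ?w) post" using o by auto
  have e: "act i (scl a g) ?w = act i g ?w" by (simp add: act_def)
  have k: "fits i (scl a g) ?w" "arr g" using f by (auto simp: fits_def)
  show ?thesis
    using f p q k e
    by (simp add: run_append run_props wh_props wh_scl comp_scl scl_comp)
qed

text \<open>Diagrams are multilinear in their layers; this is the form in which a layer that is a linear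
combination of two diagrams is expanded.\<close>

lemma run_expand:
  assumes g: "g = add (run w0 xs) (scl a (run w0 ys))"
    and k: "ok w0 xs" "ok w0 ys" "tgt w0 xs = tgt w0 ys"
    and o: "ok w (pre @ (i, g) # post)"
  shows "run w (pre @ (i, g) # post)
      = add (run w (pre @ shift i xs @ post)) (scl a (run w (pre @ shift i ys @ post)))"
    and "ok w (pre @ shift i xs @ post)" and "ok w (pre @ shift i ys @ post)"
proof -
  have x: "ok w (pre @ (i, run w0 xs) # post)" "ok w (pre @ (i, run w0 ys) # post)"
    using o k run_props[OF k(1)] run_props[OF k(2)] unfolding g by (auto simp: fits_def act_def)
  show "run w (pre @ (i, g) # post)
      = add (run w (pre @ shift i xs @ post)) (scl a (run w (pre @ shift i ys @ post)))"
    unfolding g using run_add[OF x(1), of "scl a (run w0 ys)"] run_props[OF k(1)] run_props[OF k(2)]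
      run_scl[OF x(2)] run_flatten(2)[OF k(1) x(1)] run_flatten(2)[OF k(2) x(2)] k by simp
  show "ok w (pre @ shift i xs @ post)" "ok w (pre @ shift i ys @ post)"
    using run_flatten(1)[OF k(1) x(1)] run_flatten(1)[OF k(2) x(2)] .
qed

lemma run_tens:
  assumes "ok w xs" "ok v ys"
  shows "run w xs \<parallel> run v ys = run (w @ v) (xs @ shift (length (tgt w xs)) ys)"
    and "ok (w @ v) (xs @ shift (length (tgt w xs)) ys)"
proof -
  have 1: "run (w @ v) xs = run w xs \<parallel> idn v" "ok (w @ v) xs" "tgt (w @ v) xs = tgt w xs @ v"
    using run_whisker[OF assms(1), of "[]" v] run_props[OF assms(1)]
    by (auto simp: shift_def idn_tens case_prod_beta)
  have 2: "run (tgt w xs @ v) (shift (length (tgt w xs)) ys) = idn (tgt w xs) \<parallel> run v ys"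
    "ok (tgt w xs @ v) (shift (length (tgt w xs)) ys)"
    using run_whisker[OF assms(2), of "tgt w xs" "[]"] run_props[OF assms(2)]
    by (auto simp: tens_idn)
  show "ok (w @ v) (xs @ shift (length (tgt w xs)) ys)" using 1 2 by simp
  then show "run w xs \<parallel> run v ys = run (w @ v) (xs @ shift (length (tgt w xs)) ys)"
    using 1 2 run_props[OF assms(1)] run_props[OF assms(2)]
    by (simp add: run_append interchange idn_comp comp_idn)
qed

lemma run_comp: "\<lbrakk>ok w xs; ok v ys; v = tgt w xs\<rbrakk> \<Longrightarrow> run v ys \<star> run w xs = run w (xs @ ys)"
  by (simp add: run_append)

lemma run_single: "arr g \<Longrightarrow> w = dm g \<Longrightarrow> run w [(0, g)] = g"
  by (simp add: wh_def act_def idn_tens tens_idn idn_comp)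

lemma rel_zero_any: "\<lbrakk>rel w 0 xs ys; ok w zs; tgt w zs = tgt w xs\<rbrakk> \<Longrightarrow> rel w 0 xs zs"
  using rel_tgt[of w 0 xs ys] unfolding rel_def
  by (metis run_props scl_zero_left)

lemma rel_addI:
  assumes "run w xs = add (run w ys) (scl a (run w zs))" "ok w xs" "rel w b ys vs" "rel w d zs vs"
  shows "rel w (b + a * d) xs vs"
  using assms unfolding rel_def by (simp add: add_scl scl_scl run_props)

lemma rel_run: "rel w 1 xs ys \<Longrightarrow> run w xs = run w ys"
  by (simp add: rel_def scl_one run_props)

lemma rel_runI: "\<lbrakk>ok w xs; ok w ys; run w xs = run w ys\<rbrakk> \<Longrightarrow> rel w 1 xs ys"
  by (simp add: rel_def scl_one run_props)

end

section \<open>The strict category of Temperley--Lieb classes\<close>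

text \<open>The typing relation of terms is recast as computable source, target and well-typedness.\<close>

fun sr :: "tl \<Rightarrow> colour list" and tg :: "tl \<Rightarrow> colour list" where
  "sr (Id u) = u"
| "sr (Cap c) = [c, c]"
| "sr (Cup c) = []"
| "sr (t \<bullet> s) = sr s"
| "sr (s \<diamondop> t) = sr s @ sr t"
| "sr (Zero u v) = u"
| "sr (Plus s t) = sr s"
| "sr (Scale a s) = sr s"
| "tg (Id u) = u"
| "tg (Cap c) = []"
| "tg (Cup c) = [c, c]"
| "tg (t \<bullet> s) = tg t"
| "tg (s \<diamondop> t) = tg s @ tg t"
| "tg (Zero u v) = v"
| "tg (Plus s t) = tg s"
| "tg (Scale a s) = tg s"

fun wt :: "tl \<Rightarrow> bool" where
  "wt (t \<bullet> s) \<longleftrightarrow> wt t \<and> wt s \<and> sr t = tg s"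
| "wt (s \<diamondop> t) \<longleftrightarrow> wt s \<and> wt t"
| "wt (Plus s t) \<longleftrightarrow> wt s \<and> wt t \<and> sr s = sr t \<and> tg s = tg t"
| "wt (Scale a s) \<longleftrightarrow> wt s"
| "wt t \<longleftrightarrow> True"

lemma typed_iff: "typed t u v \<longleftrightarrow> wt t \<and> sr t = u \<and> tg t = v"
proof
  show "typed t u v \<Longrightarrow> wt t \<and> sr t = u \<and> tg t = v"
    by (induction rule: typed.induct) auto
  have "wt t \<Longrightarrow> typed t (sr t) (tg t)"
    by (induction t) (auto intro: typed.intros)
  then show "wt t \<and> sr t = u \<and> tg t = v \<Longrightarrow> typed t u v" by auto
qed

lemma replicate_append_two [simp]: "replicate n c @ [c, c] = c # c # replicate n c"
  by (induction n) auto

lemma replicate_four [simp]: "replicate 4 c = [c, c, c, c]"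
  by (simp add: numeral_eq_Suc)

lemma jones_wenzl_wt [simp]:
  "wt (jones_wenzl c n) \<and> sr (jones_wenzl c n) = replicate n c \<and> tg (jones_wenzl c n) = replicate n c"
  by (induction c n rule: jones_wenzl.induct) (auto simp: Let_def replicate_append_same)

lemma tl_eq_typed: "tl_eq u v s t \<Longrightarrow> typed s u v \<and> typed t u v"
  by (induction rule: tl_eq.induct)
    (auto simp: typed_iff simp del: jones_wenzl.simps)

lemma reflect_wt [simp]: "sr (reflect t) = tg t" "tg (reflect t) = sr t" "wt t \<Longrightarrow> wt (reflect t)"
proof -
  show "sr (reflect t) = tg t" "tg (reflect t) = sr t" by (induction t) auto
  have *: "sr (reflect t) = tg t \<and> tg (reflect t) = sr t" for t by (induction t) auto
  show "wt t \<Longrightarrow> wt (reflect t)" by (induction t) (auto simp: *)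
qed

text \<open>By induction along Wenzl's recursion, each projection is its own mirror image; only the bracketing of
the triple product has to be restored.\<close>

lemma reflect_jones_wenzl:
  "tl_eq (replicate n c) (replicate n c) (reflect (jones_wenzl c n)) (jones_wenzl c n)"
proof (induction c n rule: jones_wenzl.induct)
  case (3 c n)
  let ?f = "jones_wenzl c (Suc n) \<diamondop> Id [c]"
  let ?e = "Id (replicate n c) \<diamondop> (Cup c \<bullet> Cap c)"
  let ?w = "replicate (Suc (Suc n)) c"
  have w: "replicate (Suc n) c @ [c] = ?w" "replicate n c @ [c, c] = ?w"
    by (simp_all add: replicate_append_same)
  have f: "tl_eq ?w ?w (reflect ?f) ?f"
    using tl_eq.tens_cong[OF 3 tl_eq.refl[of "Id [c]" "[c]" "[c]"]]
    by (simp add: w typed_iff del: replicate.simps)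
  have te: "typed ?e ?w ?w" "typed ?f ?w ?w" "typed (reflect ?f) ?w ?w"
    using w by (auto simp: typed_iff simp del: jones_wenzl.simps)
  have "tl_eq ?w ?w (reflect ?f \<bullet> ?e \<bullet> reflect ?f) (?f \<bullet> ?e \<bullet> ?f)"
    by (rule tl_eq.comp_cong[OF f tl_eq.comp_cong[OF tl_eq.refl[OF te(1)] f]])
  then have "tl_eq ?w ?w ((reflect ?f \<bullet> ?e) \<bullet> reflect ?f) (?f \<bullet> ?e \<bullet> ?f)"
    by (rule tl_eq.trans[OF tl_eq.comp_assoc[OF te(3) te(1) te(3)]])
  then show ?case
    using f by (auto simp: Let_def simp del: replicate.simps intro!: tl_eq.plus_cong tl_eq.scale_cong)
qed (auto intro: tl_eq.refl simp: typed_iff)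

text \<open>Every defining relation is mapped to a defining relation read in one of its two directions, except that the last Jones--Wenzl projection
is mapped to its mirror image.\<close>

lemma tl_eq_reflect: "tl_eq u v s t \<Longrightarrow> tl_eq v u (reflect s) (reflect t)"
proof (induction rule: tl_eq.induct)
  case (jw4 c)
  have "tl_eq [c, c, c, c] [c, c, c, c] (reflect (jones_wenzl c 4)) (jones_wenzl c 4)"
    using reflect_jones_wenzl[of 4 c] by (simp del: jones_wenzl.simps)
  then show ?case using tl_eq.jw4[of c] by (auto intro: tl_eq.trans)
next
  case (comp_assoc r w x s v t u)
  then show ?case
    by (auto intro!: tl_eq.sym[OF tl_eq.comp_assoc] simp: typed_iff)
qed (auto simp: typed_iff intro: tl_eq.intros simp del: jones_wenzl.simps)

text \<open>Equivalence classes carry their source and target, so that typing remains computable.  Operations are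
defined on chosen representatives.\<close>

type_synonym tl_class = "colour list \<times> colour list \<times> tl set"

definition cls :: "tl \<Rightarrow> tl_class" where
  "cls t = (sr t, tg t, {s. tl_eq (sr t) (tg t) t s})"

definition tdm :: "tl_class \<Rightarrow> colour list" where "tdm x = fst x"
definition tcd :: "tl_class \<Rightarrow> colour list" where "tcd x = fst (snd x)"
definition trep :: "tl_class \<Rightarrow> tl" where "trep x = (SOME t. t \<in> snd (snd x))"
definition tarrow :: "tl_class \<Rightarrow> bool" where "tarrow x \<longleftrightarrow> (\<exists>t. wt t \<and> x = cls t)"

definition typed_cls :: "colour list \<Rightarrow> colour list \<Rightarrow> tl \<Rightarrow> tl_class" where
  "typed_cls u v t = (u, v, {s. tl_eq u v t s})"

definition tcomp :: "tl_class \<Rightarrow> tl_class \<Rightarrow> tl_class" where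
  "tcomp y x = typed_cls (tdm x) (tcd y) (trep y \<bullet> trep x)"
definition ttens :: "tl_class \<Rightarrow> tl_class \<Rightarrow> tl_class" where
  "ttens x y = typed_cls (tdm x @ tdm y) (tcd x @ tcd y) (trep x \<diamondop> trep y)"
definition tadd :: "tl_class \<Rightarrow> tl_class \<Rightarrow> tl_class" where
  "tadd x y = typed_cls (tdm x) (tcd x) (Plus (trep x) (trep y))"
definition tscl :: "complex \<Rightarrow> tl_class \<Rightarrow> tl_class" where
  "tscl a x = typed_cls (tdm x) (tcd x) (Scale a (trep x))"

lemma tl_eq_cls: "tl_eq u v s t \<Longrightarrow> cls s = cls t"
  using tl_eq_typed[of u v s t] unfolding cls_def typed_iff
  by (auto intro: tl_eq.trans tl_eq.sym)

lemma cls_tl_eq: "cls s = cls t \<Longrightarrow> wt t \<Longrightarrow> tl_eq (sr t) (tg t) s t"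
  unfolding cls_def using tl_eq.refl[of t "sr t" "tg t"] by (auto simp: typed_iff)

lemma cls_simps [simp]: "tdm (cls t) = sr t" "tcd (cls t) = tg t" "wt t \<Longrightarrow> tarrow (cls t)"
  unfolding cls_def tdm_def tcd_def tarrow_def by auto

lemma trep_cls: "wt t \<Longrightarrow> tl_eq (sr t) (tg t) t (trep (cls t))"
  unfolding trep_def using tl_eq.refl[of t "sr t" "tg t"]
  by (rule_tac someI2[of _ t]) (auto simp: cls_def typed_iff)

lemma typed_cls_eq: "sr t = u \<Longrightarrow> tg t = v \<Longrightarrow> typed_cls u v t = cls t"
  unfolding typed_cls_def cls_def by simp

lemma typed_cls_eqI: "tl_eq u v s t \<Longrightarrow> typed_cls u v s = cls t"
  using tl_eq_typed[of u v s t] tl_eq_cls[of u v s t] typed_cls_eq[of s u v] by (simp add: typed_iff)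

lemma tcomp_cls: "\<lbrakk>wt t; wt s; sr t = tg s\<rbrakk> \<Longrightarrow> tcomp (cls t) (cls s) = cls (t \<bullet> s)"
  unfolding tcomp_def using trep_cls[of t] trep_cls[of s]
  by (auto intro!: typed_cls_eqI tl_eq.comp_cong[of "sr t"] dest: tl_eq.sym)

lemma ttens_cls: "\<lbrakk>wt t; wt s\<rbrakk> \<Longrightarrow> ttens (cls t) (cls s) = cls (t \<diamondop> s)"
  unfolding ttens_def using trep_cls[of t] trep_cls[of s]
  by (auto intro!: typed_cls_eqI tl_eq.tens_cong dest: tl_eq.sym)

lemma tadd_cls: "\<lbrakk>wt t; wt s; sr t = sr s; tg t = tg s\<rbrakk> \<Longrightarrow> tadd (cls t) (cls s) = cls (Plus t s)"
  unfolding tadd_def using trep_cls[of t] trep_cls[of s]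
  by (auto intro!: typed_cls_eqI tl_eq.plus_cong dest: tl_eq.sym)

lemma tscl_cls: "wt t \<Longrightarrow> tscl a (cls t) = cls (Scale a t)"
  unfolding tscl_def using trep_cls[of t]
  by (auto intro!: typed_cls_eqI tl_eq.scale_cong dest: tl_eq.sym)

lemmas cls_ops = tcomp_cls ttens_cls tadd_cls tscl_cls

lemma ty: "wt t \<Longrightarrow> sr t = u \<Longrightarrow> tg t = v \<Longrightarrow> typed t u v"
  by (simp add: typed_iff)

lemma tarrowE: "tarrow x \<Longrightarrow> (\<And>t. wt t \<Longrightarrow> x = cls t \<Longrightarrow> R) \<Longrightarrow> R"
  unfolding tarrow_def by auto

interpretation TL: strict_linear_category tarrow tdm tcd "\<lambda>w. cls (Id w)" tcomp ttens "\<lambda>u v. cls (Zero u v)" tadd tscl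
proof (unfold_locales, goal_cases)
  case (4 g f) then show ?case by (auto elim!: tarrowE simp: cls_ops)
next
  case (5 g f) then show ?case by (simp add: tcomp_def typed_cls_def tdm_def)
next
  case (6 g f) then show ?case by (simp add: tcomp_def typed_cls_def tcd_def)
next
  case (7 f g) then show ?case by (auto elim!: tarrowE simp: cls_ops)
next
  case (8 f g) then show ?case by (simp add: ttens_def typed_cls_def tdm_def)
next
  case (9 f g) then show ?case by (simp add: ttens_def typed_cls_def tcd_def)
next
  case (13 f g) then show ?case by (auto elim!: tarrowE simp: cls_ops)
next
  case (14 f g) then show ?case by (simp add: tadd_def typed_cls_def tdm_def)
next
  case (15 f g) then show ?case by (simp add: tadd_def typed_cls_def tcd_def)
next
  case (16 f a) then show ?case by (auto elim!: tarrowE simp: cls_ops)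
next
  case (17 a f) then show ?case by (simp add: tscl_def typed_cls_def tdm_def)
next
  case (18 a f) then show ?case by (simp add: tscl_def typed_cls_def tcd_def)
next
  case (19 h g f) then show ?case by (auto simp: tarrow_def cls_ops intro!: tl_eq_cls[OF tl_eq.comp_assoc] ty)
next
  case (20 f w) then show ?case by (auto simp: tarrow_def cls_ops intro!: tl_eq_cls[OF tl_eq.id_comp] ty)
next
  case (21 f w) then show ?case by (auto simp: tarrow_def cls_ops intro!: tl_eq_cls[OF tl_eq.comp_id] ty)
next
  case (22 f g h) then show ?case by (auto simp: tarrow_def cls_ops intro!: tl_eq_cls[OF tl_eq.tens_assoc] ty)
next
  case (23 f) then show ?case by (auto simp: tarrow_def cls_ops intro!: tl_eq_cls[OF tl_eq.unit_tens] ty)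
next
  case (24 f) then show ?case by (auto simp: tarrow_def cls_ops intro!: tl_eq_cls[OF tl_eq.tens_unit] ty)
next
  case (25 u v) then show ?case by (auto simp: cls_ops intro!: tl_eq_cls[OF tl_eq.tens_id])
next
  case (26 g f g' f') then show ?case
    by (auto simp: tarrow_def cls_ops intro!: tl_eq_cls[OF tl_eq.tens_comp, symmetric] ty)
next
  case (27 f g h) then show ?case by (auto simp: tarrow_def cls_ops intro!: tl_eq_cls[OF tl_eq.plus_assoc] ty)
next
  case (28 f g) then show ?case by (auto simp: tarrow_def cls_ops intro!: tl_eq_cls[OF tl_eq.plus_comm] ty)
next
  case (29 f u v) then show ?case by (auto simp: tarrow_def cls_ops intro!: tl_eq_cls[OF tl_eq.plus_zero] ty)
next
  case (30 f u v) then show ?case by (auto simp: tarrow_def cls_ops intro!: tl_eq_cls[OF tl_eq.plus_neg] ty)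
next
  case (31 f g a) then show ?case by (auto simp: tarrow_def cls_ops intro!: tl_eq_cls[OF tl_eq.scale_plus] ty)
next
  case (32 f a b) then show ?case by (auto simp: tarrow_def cls_ops intro!: tl_eq_cls[OF tl_eq.plus_scale] ty)
next
  case (33 f a b) then show ?case by (auto simp: tarrow_def cls_ops intro!: tl_eq_cls[OF tl_eq.scale_scale] ty)
next
  case (34 f) then show ?case by (auto simp: tarrow_def cls_ops intro!: tl_eq_cls[OF tl_eq.scale_one] ty)
next
  case (35 h f g) then show ?case by (auto simp: tarrow_def cls_ops intro!: tl_eq_cls[OF tl_eq.comp_plus] ty)
next
  case (36 h f g) then show ?case by (auto simp: tarrow_def cls_ops intro!: tl_eq_cls[OF tl_eq.plus_comp] ty)
next
  case (37 g f a) then show ?case by (auto simp: tarrow_def cls_ops intro!: tl_eq_cls[OF tl_eq.comp_scale] ty)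
next
  case (38 g f a) then show ?case by (auto simp: tarrow_def cls_ops intro!: tl_eq_cls[OF tl_eq.scale_comp] ty)
next
  case (39 h f g) then show ?case by (auto simp: tarrow_def cls_ops intro!: tl_eq_cls[OF tl_eq.tens_plus] ty)
next
  case (40 h f g) then show ?case by (auto simp: tarrow_def cls_ops intro!: tl_eq_cls[OF tl_eq.plus_tens] ty)
next
  case (41 f g a) then show ?case by (auto simp: tarrow_def cls_ops intro!: tl_eq_cls[OF tl_eq.tens_scale] ty)
next
  case (42 f g a) then show ?case by (auto simp: tarrow_def cls_ops intro!: tl_eq_cls[OF tl_eq.scale_tens] ty)
qed auto

section \<open>The second Jones--Wenzl projection\<close>

definition cp :: "colour \<Rightarrow> tl_class" where "cp c = cls (Cap c)"
definition cu :: "colour \<Rightarrow> tl_class" where "cu c = cls (Cup c)"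
definition jw :: "colour \<Rightarrow> tl_class" where "jw c = cls (jones_wenzl c 2)"

lemma letter_arrows [simp]:
  "tarrow (cp c)" "tdm (cp c) = [c, c]" "tcd (cp c) = []"
  "tarrow (cu c)" "tdm (cu c) = []" "tcd (cu c) = [c, c]"
  "tarrow (jw c)" "tdm (jw c) = [c, c]" "tcd (jw c) = [c, c]"
  by (simp_all add: cp_def cu_def jw_def numeral_eq_Suc Let_def)

lemmas layer = TL.fits_def TL.act_def TL.nf_def

lemma golden_sq: "golden * golden = golden + 1"
  unfolding golden_def by (simp add: field_simps)

lemma golden_pos: "golden > 0" unfolding golden_def by (simp add: add_pos_nonneg)

abbreviation \<tau> :: complex where "\<tau> \<equiv> complex_of_real golden"

lemma tau_sq: "\<tau> * \<tau> = \<tau> + 1"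
  using golden_sq by (metis of_real_1 of_real_add of_real_mult)

lemma tau_nz: "\<tau> \<noteq> 0" using golden_pos by simp

lemma strand_relations: "TL.rel [c] 1 [(1, cu c), (0, cp c)] []" "TL.rel [c] 1 [(0, cu c), (1, cp c)] []"
  "TL.rel [] \<tau> [(0, cu c), (0, cp c)] []"
proof -
  have "TL.run [c] [(1, cu c), (0, cp c)] = cls (Id [c])"
    using tl_eq_cls[OF tl_eq.zigzag_left[of c]]
    by (simp add: TL.wh_def TL.act_def TL.idn_tens TL.tens_idn TL.idn_comp TL.comp_idn cls_ops[symmetric] cp_def cu_def)
  then show "TL.rel [c] 1 [(1, cu c), (0, cp c)] []" by (simp add: TL.rel_def layer TL.scl_one)
  have "TL.run [c] [(0, cu c), (1, cp c)] = cls (Id [c])"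
    using tl_eq_cls[OF tl_eq.zigzag_right[of c]]
    by (simp add: TL.wh_def TL.act_def TL.idn_tens TL.tens_idn TL.idn_comp TL.comp_idn cls_ops[symmetric] cp_def cu_def)
  then show "TL.rel [c] 1 [(0, cu c), (1, cp c)] []" by (simp add: TL.rel_def layer TL.scl_one)
  have "TL.run [] [(0, cu c), (0, cp c)] = cls (Scale \<tau> (Id []))"
    using tl_eq_cls[OF tl_eq.loop[of c]]
    by (simp add: TL.wh_def TL.act_def TL.idn_tens TL.tens_idn TL.idn_comp TL.comp_idn cls_ops[symmetric] cp_def cu_def)
  then show "TL.rel [] \<tau> [(0, cu c), (0, cp c)] []" by (simp add: TL.rel_def layer cls_ops)
qed

lemmas strand_zigzag_left = strand_relations(1) and strand_zigzag_right = strand_relations(2)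
  and strand_loop = strand_relations(3)

lemma jw_expand: "jw c = tadd (TL.run [c, c] []) (tscl (- 1 / \<tau>) (TL.run [c, c] [(0, cp c), (0, cu c)]))"
proof -
  have "jw c = tadd (cls (Id [c] \<diamondop> Id [c])) (tscl (- 1 / \<tau>)
      (cls (((Id [c] \<diamondop> Id [c]) \<bullet> (Id [] \<diamondop> (Cup c \<bullet> Cap c)) \<bullet> (Id [c] \<diamondop> Id [c])))))"
    by (simp add: jw_def numeral_eq_Suc Let_def cls_ops)
  then show ?thesis
    by (simp add: TL.wh_def TL.act_def TL.idn_tens TL.tens_idn TL.idn_comp cls_ops[symmetric] cp_def cu_def
      TL.idn_tens_idn TL.comp_idn TL.comp_assoc)
qed

lemmas jw_run = TL.run_expand[OF jw_expand]

text \<open>Capping \<open>f\<^sub>2 = 1 - \<tau>\<^sup>-\<^sup>1 cup cap\<close> creates a loop, and \<open>1 - \<tau>\<^sup>-\<^sup>1 \<tau> = 0\<close>.\<close>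

lemma jw_cap: "TL.rel [c, c] 0 [(0, jw c), (0, cp c)] [(0, cp c)]"
proof -
  have "TL.rel [c, c] (1 + (- 1 / \<tau>) * \<tau>) [(0, jw c), (0, cp c)] [(0, cp c)]"
  proof (rule TL.rel_addI)
    show "TL.run [c, c] [(0, jw c), (0, cp c)] = tadd (TL.run [c, c] [(0, cp c)])
        (tscl (- 1 / \<tau>) (TL.run [c, c] [(0, cp c), (0, cu c), (0, cp c)]))"
      using jw_run(1)[of c "[c, c]" "[]" 0 "[(0, cp c)]"] by (simp add: layer)
    show "TL.rel [c, c] \<tau> [(0, cp c), (0, cu c), (0, cp c)] [(0, cp c)]"
      by (rule TL.rel_at[OF strand_loop, of _ "[(0, cp c)]" 0 "[]"])
        (simp_all add: layer)
  qed (simp_all add: layer TL.rel_refl)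
  then show ?thesis using tau_nz by simp
qed

lemma jw_cup: "TL.rel [] 0 [(0, cu c), (0, jw c)] [(0, cu c)]"
proof -
  have "TL.rel [] (1 + (- 1 / \<tau>) * \<tau>) [(0, cu c), (0, jw c)] [(0, cu c)]"
  proof (rule TL.rel_addI)
    show "TL.run [] [(0, cu c), (0, jw c)] = tadd (TL.run [] [(0, cu c)])
        (tscl (- 1 / \<tau>) (TL.run [] [(0, cu c), (0, cp c), (0, cu c)]))"
      using jw_run(1)[of c "[]" "[(0, cu c)]" 0 "[]"] by (simp add: layer)
    show "TL.rel [] \<tau> [(0, cu c), (0, cp c), (0, cu c)] [(0, cu c)]"
      by (rule TL.rel_at[OF strand_loop, of _ "[]" 0 "[(0, cu c)]"])
        (simp_all add: layer)
  qed (simp_all add: layer TL.rel_refl)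
  then show ?thesis using tau_nz by simp
qed

lemma jw_jw: "TL.rel [c, c] 1 [(0, jw c), (0, jw c)] [(0, jw c)]"
proof -
  have "TL.rel [c, c] (1 + (- 1 / \<tau>) * 0) [(0, jw c), (0, jw c)] [(0, jw c)]"
  proof (rule TL.rel_addI)
    show "TL.run [c, c] [(0, jw c), (0, jw c)] = tadd (TL.run [c, c] [(0, jw c)])
        (tscl (- 1 / \<tau>) (TL.run [c, c] [(0, jw c), (0, cp c), (0, cu c)]))"
      using jw_run(1)[of c "[c, c]" "[(0, jw c)]" 0 "[]"] by (simp add: layer)
    have "TL.rel [c, c] 0 [(0, jw c), (0, cp c), (0, cu c)] [(0, cp c), (0, cu c)]"
      by (rule TL.rel_at[OF jw_cap, of _ "[]" 0 "[(0, cu c)]"])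
        (simp_all add: layer)
    then show "TL.rel [c, c] 0 [(0, jw c), (0, cp c), (0, cu c)] [(0, jw c)]"
      by (rule TL.rel_zero_any) (simp_all add: layer)
  qed (simp_all add: layer TL.rel_refl)
  then show ?thesis by simp
qed

text \<open>The projection slides along a pair of nested caps because it is a combination of \<open>1\<close> and \<open>cup cap\<close>,
both of which are symmetric under a half turn.\<close>

lemma jw_slide_cap: "TL.rel [c, c, c, c] 1 [(2, jw c), (1, cp c), (0, cp c)] [(0, jw c), (1, cp c), (0, cp c)]"
proof -
  let ?w = "[c, c, c, c]"
  have "TL.rel ?w 1 [(2, cp c), (2, cu c), (1, cp c), (0, cp c)] [(2, cp c), (0, cp c)]"
    by (rule TL.rel_at[OF strand_zigzag_left, of _ "[(2, cp c)]" 1 "[(0, cp c)]"])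
      (simp_all add: layer)
  moreover have "TL.rel ?w 1 [(0, cp c), (0, cu c), (1, cp c), (0, cp c)] [(2, cp c), (0, cp c)]"
    by (rule TL.rel_at[OF strand_zigzag_right, of _ "[(0, cp c)]" 0 "[(0, cp c)]"])
      (simp_all add: layer)
  ultimately have "TL.run ?w [(2, cp c), (2, cu c), (1, cp c), (0, cp c)]
      = TL.run ?w [(0, cp c), (0, cu c), (1, cp c), (0, cp c)]"
    by (auto dest!: TL.rel_run)
  then have "TL.run ?w [(2, jw c), (1, cp c), (0, cp c)] = TL.run ?w [(0, jw c), (1, cp c), (0, cp c)]"
    using jw_run(1)[of c ?w "[]" 2 "[(1, cp c), (0, cp c)]"] jw_run(1)[of c ?w "[]" 0 "[(1, cp c), (0, cp c)]"]
    by (simp add: layer numeral_eq_Suc del: TL.run.simps)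
  then show ?thesis by (intro TL.rel_runI) (simp_all add: layer del: TL.run.simps)
qed

lemma jw_slide_cup: "TL.rel [] 1 [(0, cu c), (1, cu c), (2, jw c)] [(0, cu c), (1, cu c), (0, jw c)]"
proof -
  let ?w = "[]"
  have "TL.rel ?w 1 [(0, cu c), (1, cu c), (2, cp c), (2, cu c)] [(0, cu c), (2, cu c)]"
    by (rule TL.rel_at[OF strand_zigzag_right, of _ "[(0, cu c)]" 1 "[(2, cu c)]"])
      (simp_all add: layer)
  moreover have "TL.rel ?w 1 [(0, cu c), (1, cu c), (0, cp c), (0, cu c)] [(0, cu c), (2, cu c)]"
    by (rule TL.rel_at[OF strand_zigzag_left, of _ "[(0, cu c)]" 0 "[(0, cu c)]"])
      (simp_all add: layer)
  ultimately have "TL.run ?w [(0, cu c), (1, cu c), (2, cp c), (2, cu c)]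
      = TL.run ?w [(0, cu c), (1, cu c), (0, cp c), (0, cu c)]"
    by (auto dest!: TL.rel_run)
  then have "TL.run ?w [(0, cu c), (1, cu c), (2, jw c)] = TL.run ?w [(0, cu c), (1, cu c), (0, jw c)]"
    using jw_run(1)[of c ?w "[(0, cu c), (1, cu c)]" 2 "[]"] jw_run(1)[of c ?w "[(0, cu c), (1, cu c)]" 0 "[]"]
    by (simp add: layer numeral_eq_Suc del: TL.run.simps)
  then show ?thesis by (intro TL.rel_runI) (simp_all add: layer del: TL.run.simps)
qed

definition jw3 :: "colour \<Rightarrow> tl_class" where "jw3 c = cls (jones_wenzl c 3)"

lemma jw3_arrow [simp]: "tarrow (jw3 c)" "tdm (jw3 c) = [c, c, c]" "tcd (jw3 c) = [c, c, c]"
  using jones_wenzl_wt[of c 3] unfolding jw3_def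
  by (simp_all del: jones_wenzl_wt jones_wenzl.simps add: numeral_eq_Suc)

text \<open>Wenzl's recursion for classes.  With \<open>[1] = 1\<close>, \<open>[2] = \<tau>\<close>, \<open>[3] = \<tau>\<close> and \<open>[4] = 1\<close>, the ratios are
\<open>[2]/[3] = 1\<close> for \<open>f\<^sub>3\<close> and \<open>[3]/[4] = \<tau>\<close> for \<open>f\<^sub>4 = 0\<close>.\<close>

lemma jw_Suc:
  assumes "qint (Suc n) / qint (Suc (Suc n)) = r"
  shows "cls (jones_wenzl c (Suc (Suc n))) = (let f = ttens (cls (jones_wenzl c (Suc n))) (cls (Id [c]));
      e = ttens (cls (Id (replicate n c))) (tcomp (cu c) (cp c)) in
      tadd f (tscl (- complex_of_real r) (tcomp f (tcomp e f))))"
  unfolding jones_wenzl.simps Let_def cu_def cp_def assms[symmetric]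
  by (simp add: cls_ops replicate_append_same del: jones_wenzl.simps qint.simps)

lemma jw3_expand: "jw3 c = tadd (TL.run [c, c, c] [(0, jw c)])
    (tscl (- 1) (TL.run [c, c, c] [(0, jw c), (1, cp c), (1, cu c), (0, jw c)]))"
proof -
  have q: "qint (Suc 1) / qint (Suc (Suc 1)) = 1"
    using golden_sq golden_pos by simp
  have "jw3 c = (let f = ttens (jw c) (cls (Id [c])); e = ttens (cls (Id [c])) (tcomp (cu c) (cp c)) in
      tadd f (tscl (- 1) (tcomp f (tcomp e f))))"
    using jw_Suc[OF q, of c] unfolding jw3_def jw_def Let_def
    by (simp add: numeral_eq_Suc del: jones_wenzl.simps)
  moreover have "ttens (cls (Id [c])) (tcomp (cu c) (cp c))
     = tcomp (ttens (cls (Id [c])) (cu c)) (ttens (cls (Id [c])) (cp c))"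
    by (simp add: TL.interchange TL.idn_comp)
  ultimately show ?thesis
    by (simp add: Let_def TL.wh_def TL.act_def TL.idn_tens TL.tens_idn TL.idn_comp TL.comp_idn TL.idn_tens_idn
      TL.comp_assoc)
qed

lemma jw4_expand: "tadd (TL.run [c, c, c, c] [(0, jw3 c)])
    (tscl (- \<tau>) (TL.run [c, c, c, c] [(0, jw3 c), (2, cp c), (2, cu c), (0, jw3 c)]))
    = cls (Zero [c, c, c, c] [c, c, c, c])"
proof -
  have q: "qint (Suc 2) / qint (Suc (Suc 2)) = golden"
    using golden_sq by (simp add: numeral_eq_Suc)
  have "cls (jones_wenzl c 4) = (let f = ttens (jw3 c) (cls (Id [c])); e = ttens (cls (Id [c, c])) (tcomp (cu c) (cp c)) in
      tadd f (tscl (- \<tau>) (tcomp f (tcomp e f))))"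
    using jw_Suc[OF q, of c] unfolding jw3_def Let_def
    by (simp add: numeral_eq_Suc del: jones_wenzl.simps)
  moreover have "ttens (cls (Id [c, c])) (tcomp (cu c) (cp c))
     = tcomp (ttens (cls (Id [c, c])) (cu c)) (ttens (cls (Id [c, c])) (cp c))"
    by (simp add: TL.interchange TL.idn_comp)
  moreover have "cls (jones_wenzl c 4) = cls (Zero [c, c, c, c] [c, c, c, c])"
    by (rule tl_eq_cls[OF tl_eq.jw4])
  ultimately show ?thesis
    by (simp add: Let_def TL.wh_def TL.act_def TL.idn_tens TL.tens_idn TL.idn_comp TL.comp_idn TL.idn_tens_idn
      TL.comp_assoc)
qed

lemmas jw3_run = TL.run_expand[OF jw3_expand]

lemma (in strict_linear_category) solve_linear:
  assumes "add (add A (scl a B)) (scl b (add B (scl d X))) = zero u v"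
    and "arr A" "arr B" "arr X" "dm A = u" "dm B = u" "dm X = u" "cd A = v" "cd B = v" "cd X = v"
  shows "A = add (scl (- a - b) B) (scl (- b * d) X)"
proof -
  have 1: "add (add A (scl a B)) (scl b (add B (scl d X))) = add A (add (scl (a + b) B) (scl (b * d) X))"
    using assms(2-) by (simp add: scl_add scl_scl add_scl add_assoc)
  have "add (add (scl (a + b) B) (scl (b * d) X)) A
      = add (add (scl (a + b) B) (scl (b * d) X)) (scl (- 1) (add (scl (a + b) B) (scl (b * d) X)))"
    using assms 1 add_comm[of A "add (scl (a + b) B) (scl (b * d) X)"]
      add_neg[of "add (scl (a + b) B) (scl (b * d) X)" u v] by simp
  then have "A = scl (- 1) (add (scl (a + b) B) (scl (b * d) X))"
    by (rule add_cancel_left) (use assms in auto)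
  also have "\<dots> = add (scl (- a - b) B) (scl (- b * d) X)"
    using assms by (simp add: scl_add scl_scl)
  finally show ?thesis .
qed

lemma (in strict_linear_category) rel_zero_run: "rel w 0 xs ys \<Longrightarrow> v = tgt w xs \<Longrightarrow> run w xs = zero w v"
  using rel_tgt[of w 0 xs ys] unfolding rel_def using scl_zero_left[of "run w ys"] run_props[of w ys] by auto

lemma (in strict_linear_category) run_zero:
  assumes "ok w (pre @ (i, zero u v) # post)" "x = tgt w (pre @ (i, zero u v) # post)"
  shows "run w (pre @ (i, zero u v) # post) = zero w x"
  using run_scl[OF assms(1), of 0] scl_zero[of 0 u v] run_props[OF assms(1)] assms(2)
  by (simp add: scl_zero_left[of _ w x])

text \<open>The relation \<open>f\<^sub>4 = 0\<close> is expanded by Wenzl's recursion between two copies of \<open>f\<^sub>2 \<otimes> f\<^sub>2\<close>.  All terms in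
which a cap or cup meets \<open>f\<^sub>2\<close> vanish.  What is left is \<open>f\<^sub>2 \<otimes> f\<^sub>2 - B - \<tau> (B - \<tau>\<^sup>-\<^sup>1 X) = 0\<close>, where \<open>B\<close> has one
cap and cup between the two pairs of strands and \<open>X\<close> has two nested ones.\<close>

lemma jw_tensor_jw:
  fixes c :: colour
  defines "w \<equiv> [c, c, c, c]"
  defines "B \<equiv> TL.run w [(0, jw c), (2, jw c), (1, cp c), (1, cu c), (0, jw c), (2, jw c)]"
  defines "X \<equiv> TL.run w [(0, jw c), (2, jw c), (1, cp c), (0, cp c), (0, cu c), (1, cu c), (0, jw c), (2, jw c)]"
  shows "TL.run w [(0, jw c), (2, jw c)] = tadd (tscl (1 + \<tau>) B) (tscl (- 1) X)"
proof -
  let ?p = "[(0, jw c), (2, jw c)]"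
  let ?A = "TL.run w ?p"
  let ?Z = "cls (Zero w w)"
  note [simp del] = TL.run.simps
  \<comment> \<open>The zero morphism in the middle stands for the fourth projection.\<close>
  have ok4: "TL.ok w (?p @ (0, cls (Zero w w)) # ?p)" by (simp add: layer w_def)
  have "TL.run w (?p @ (0, cls (Zero w w)) # ?p) = ?Z"
    by (rule TL.run_zero[OF ok4]) (simp add: layer w_def)
  moreover have "TL.run w (?p @ (0, cls (Zero w w)) # ?p)
      = tadd (TL.run w (?p @ (0, jw3 c) # ?p))
         (tscl (- \<tau>) (TL.run w (?p @ [(0, jw3 c), (2, cp c), (2, cu c), (0, jw3 c)] @ ?p)))"
    using TL.run_expand(1)[OF jw4_expand[of c, symmetric], of w ?p 0 ?p] by (simp add: layer w_def numeral_eq_Suc)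
  moreover have "TL.run w (?p @ (0, jw3 c) # ?p) = tadd ?A (tscl (- 1) B)"
  proof -
    have "TL.run w (?p @ (0, jw3 c) # ?p) = tadd (TL.run w (?p @ [(0, jw c)] @ ?p))
        (tscl (- 1) (TL.run w (?p @ [(0, jw c), (1, cp c), (1, cu c), (0, jw c)] @ ?p)))"
      using jw3_run(1)[of c w ?p 0 ?p] by (simp add: layer w_def)
    moreover have "TL.rel w 1 (?p @ [(0, jw c)] @ ?p) ?p"
    proof -
      have "TL.rel w 1 (?p @ [(0, jw c)] @ ?p) (?p @ ?p)"
        by (rule TL.rel_at[OF jw_jw, of _ "[(2, jw c)]" 0 ?p])
          (simp_all add: layer w_def)
      also have "TL.rel w 1 (?p @ ?p) [(0, jw c), (2, jw c), (2, jw c)]"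
        by (rule TL.rel_at[OF jw_jw, of _ "[]" 0 "[(2, jw c), (2, jw c)]"])
          (simp_all add: layer w_def)
      also have "TL.rel w 1 [(0, jw c), (2, jw c), (2, jw c)] ?p"
        by (rule TL.rel_at[OF jw_jw, of _ "[(0, jw c)]" 2 "[]"])
          (simp_all add: layer w_def)
      finally show ?thesis by simp
    qed
    moreover have "TL.rel w 1 (?p @ [(0, jw c), (1, cp c), (1, cu c), (0, jw c)] @ ?p)
        (?p @ [(1, cp c), (1, cu c)] @ ?p)"
    proof -
      have "TL.rel w 1 (?p @ [(0, jw c), (1, cp c), (1, cu c), (0, jw c)] @ ?p)
          (?p @ [(1, cp c), (1, cu c), (0, jw c)] @ ?p)"
        by (rule TL.rel_at[OF jw_jw, of _ "[(2, jw c)]" 0 "[(1, cp c), (1, cu c), (0, jw c)] @ ?p"])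
          (simp_all add: layer w_def)
      also have "TL.rel w 1 (?p @ [(1, cp c), (1, cu c), (0, jw c)] @ ?p) (?p @ [(1, cp c), (1, cu c)] @ ?p)"
        by (rule TL.rel_at[OF jw_jw, of _ "?p @ [(1, cp c), (1, cu c)]" 0 "[(2, jw c)]"])
          (simp_all add: layer w_def)
      finally show ?thesis by simp
    qed
    ultimately show ?thesis unfolding B_def by (auto dest!: TL.rel_run)
  qed
  moreover have "TL.run w (?p @ [(0, jw3 c), (2, cp c), (2, cu c), (0, jw3 c)] @ ?p)
      = tadd B (tscl (- 1 / \<tau>) X)"
  proof -
    let ?q = "[(2, cp c), (2, cu c)]"
    let ?r = "[(0, jw c), (1, cp c), (1, cu c), (0, jw c)]"
    have "TL.run w (?p @ [(0, jw3 c), (2, cp c), (2, cu c), (0, jw3 c)] @ ?p)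
        = tadd (TL.run w (?p @ (0, jw c) # ?q @ [(0, jw3 c)] @ ?p))
           (tscl (- 1) (TL.run w (?p @ ?r @ ?q @ (0, jw3 c) # ?p)))"
      using jw3_run(1)[of c w ?p 0 "?q @ (0, jw3 c) # ?p"] by (simp add: layer w_def)
    \<comment> \<open>A copy of \<open>f\<^sub>3\<close> that contributes its leading term \<open>f\<^sub>2 \<otimes> 1\<close> leaves a cap or cup on \<open>f\<^sub>2\<close>.\<close>
    moreover have "TL.run w (?p @ (0, jw c) # ?q @ [(0, jw3 c)] @ ?p) = ?Z"
    proof (rule TL.rel_zero_run)
      show "TL.rel w 0 (?p @ (0, jw c) # ?q @ [(0, jw3 c)] @ ?p) ([(0, jw c), (0, jw c)] @ ?q @ [(0, jw3 c)] @ ?p)"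
        by (rule TL.rel_at[OF jw_cap, of _ "[(0, jw c), (0, jw c)]" 2 "[(2, cu c), (0, jw3 c)] @ ?p"])
          (simp_all add: layer w_def)
    qed (simp add: layer w_def)
    moreover have "TL.run w (?p @ ?r @ ?q @ (0, jw3 c) # ?p)
        = tadd (TL.run w (?p @ ?r @ ?q @ (0, jw c) # ?p)) (tscl (- 1) (TL.run w (?p @ ?r @ ?q @ ?r @ ?p)))"
      using jw3_run(1)[of c w "?p @ ?r @ ?q" 0 ?p] by (simp add: layer w_def)
    moreover have "TL.run w (?p @ ?r @ ?q @ (0, jw c) # ?p) = ?Z"
    proof (rule TL.rel_zero_run)
      show "TL.rel w 0 (?p @ ?r @ ?q @ (0, jw c) # ?p) (?p @ ?r @ [(2, cp c), (0, jw c), (2, cu c), (0, jw c)])"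
        by (rule TL.rel_at[OF jw_cup, of _ "?p @ ?r @ [(2, cp c), (0, jw c)]" 2 "[(0, jw c)]"])
          (simp_all add: layer w_def)
    qed (simp add: layer w_def)
    moreover have "TL.rel w 1 (?p @ ?r @ ?q @ ?r @ ?p) (?p @ [(1, cp c), (1, cu c), (0, jw c)] @ ?q @ [(1, cp c), (1, cu c)] @ ?p)"
    proof -
      have "TL.rel w 1 (?p @ ?r @ ?q @ ?r @ ?p) (?p @ [(1, cp c), (1, cu c), (0, jw c)] @ ?q @ ?r @ ?p)"
        by (rule TL.rel_at[OF jw_jw, of _ "[(2, jw c)]" 0 "[(1, cp c), (1, cu c), (0, jw c)] @ ?q @ ?r @ ?p"])
          (simp_all add: layer w_def)
      also have "TL.rel w 1 \<dots> (?p @ [(1, cp c), (1, cu c), (0, jw c)] @ ?q @ [(1, cp c), (1, cu c), (0, jw c)] @ ?p)"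
        by (rule TL.rel_at[OF jw_jw, of _ "?p @ [(1, cp c), (1, cu c)]" 0 "?q @ [(1, cp c), (1, cu c), (0, jw c)] @ ?p"])
          (simp_all add: layer w_def)
      also have "TL.rel w 1 \<dots> (?p @ [(1, cp c), (1, cu c), (0, jw c)] @ ?q @ [(1, cp c), (1, cu c)] @ ?p)"
        by (rule TL.rel_at[OF jw_jw, of _ "?p @ [(1, cp c), (1, cu c), (0, jw c)] @ ?q @ [(1, cp c), (1, cu c)]" 0 "[(2, jw c)]"])
          (simp_all add: layer w_def)
      finally show ?thesis by simp
    qed
    moreover have "TL.run w (?p @ [(1, cp c), (1, cu c), (0, jw c)] @ ?q @ [(1, cp c), (1, cu c)] @ ?p)
        = tadd (TL.run w (?p @ [(1, cp c), (1, cu c)] @ ?q @ [(1, cp c), (1, cu c)] @ ?p))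
          (tscl (- 1 / \<tau>) (TL.run w (?p @ [(1, cp c), (1, cu c), (0, cp c), (0, cu c)] @ ?q @ [(1, cp c), (1, cu c)] @ ?p)))"
      using jw_run(1)[of c w "?p @ [(1, cp c), (1, cu c)]" 0 "?q @ [(1, cp c), (1, cu c)] @ ?p"] by (simp add: layer w_def)
    moreover have "TL.rel w 1 (?p @ [(1, cp c), (1, cu c)] @ ?q @ [(1, cp c), (1, cu c)] @ ?p)
        (?p @ [(1, cp c), (1, cu c)] @ ?p)"
    proof -
      have "TL.rel w 1 (?p @ [(1, cp c), (1, cu c)] @ ?q @ [(1, cp c), (1, cu c)] @ ?p)
         (?p @ [(1, cp c), (2, cu c), (1, cp c), (1, cu c)] @ ?p)"
        by (rule TL.rel_at[OF strand_zigzag_right, of _ "?p @ [(1, cp c)]" 1 "[(2, cu c), (1, cp c), (1, cu c)] @ ?p"])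
          (simp_all add: layer w_def)
      also have "TL.rel w 1 \<dots> (?p @ [(1, cp c), (1, cu c)] @ ?p)"
        by (rule TL.rel_at[OF strand_zigzag_left, of _ "?p @ [(1, cp c)]" 1 "[(1, cu c)] @ ?p"])
          (simp_all add: layer w_def)
      finally show ?thesis by simp
    qed
    moreover have "TL.rel w 1 (?p @ [(1, cp c), (1, cu c), (0, cp c), (0, cu c)] @ ?q @ [(1, cp c), (1, cu c)] @ ?p)
        (?p @ [(1, cp c), (0, cp c), (0, cu c), (1, cu c)] @ ?p)"
    proof -
      have "TL.rel w 1 (?p @ [(1, cp c), (1, cu c), (0, cp c), (0, cu c)] @ ?q @ [(1, cp c), (1, cu c)] @ ?p)
         (?p @ [(1, cp c), (0, cu c)] @ ?q @ [(1, cp c), (1, cu c)] @ ?p)"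
        by (rule TL.rel_at[OF strand_zigzag_left, of _ "?p @ [(1, cp c)]" 0 "[(0, cu c)] @ ?q @ [(1, cp c), (1, cu c)] @ ?p"])
          (simp_all add: layer w_def)
      also have "TL.rel w 1 \<dots> (?p @ [(1, cp c), (0, cp c), (0, cu c), (1, cu c)] @ ?p)"
        by (rule TL.rel_at[OF strand_zigzag_left, of _ "?p @ [(1, cp c), (0, cp c), (0, cu c)]" 1 "[(1, cu c)] @ ?p"])
          (simp_all add: layer w_def)
      finally show ?thesis by simp
    qed
    moreover have "tadd ?Z (tscl (- 1) (tadd ?Z (tscl (- 1) (tadd B (tscl (- 1 / \<tau>) X)))))
        = tadd B (tscl (- 1 / \<tau>) X)"
    proof -
      have "tarrow (tadd B (tscl (- 1 / \<tau>) X))" "tdm (tadd B (tscl (- 1 / \<tau>) X)) = w"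
        "tcd (tadd B (tscl (- 1 / \<tau>) X)) = w"
        unfolding B_def X_def by (simp_all add: TL.run_props layer w_def)
      then show ?thesis by (simp only: TL.zero_add TL.scl_scl TL.scl_one TL.arr_scl TL.dm_scl TL.cd_scl) (simp add: TL.scl_one)
    qed
    ultimately show ?thesis
      unfolding B_def X_def by (auto dest!: TL.rel_run)
  qed
  ultimately have "tadd (tadd ?A (tscl (- 1) B)) (tscl (- \<tau>) (tadd B (tscl (- 1 / \<tau>) X))) = ?Z"
    by simp
  from TL.solve_linear[OF this] show ?thesis
    using tau_nz unfolding B_def X_def
    by (simp add: TL.run_props layer w_def)
qed

section \<open>Morphisms of the free product as Temperley--Lieb classes\<close>

text \<open>Arrows of the free product are translated into Temperley--Lieb classes between the doubled words.  The
class of an arrow absorbs the projections \<open>pr\<close> of its source and target, and so the operations on arrows,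
which cut down chosen representatives, become the operations on classes.\<close>

definition pr :: "colour list \<Rightarrow> tl_class" where "pr w = cls (proj w)"

lemma strands_simps [simp]: "strands [] = []" "strands (c # w) = c # c # strands w"
  "strands (u @ v) = strands u @ strands v"
  by (simp_all add: strands_def)

lemma proj_wt [simp]: "wt (proj w) \<and> sr (proj w) = strands w \<and> tg (proj w) = strands w"
  by (induction w) (auto simp: proj_def numeral_eq_Suc Let_def)

lemma pr_arrow [simp]: "tarrow (pr w)" "tdm (pr w) = strands w" "tcd (pr w) = strands w"
  by (simp_all add: pr_def)

lemma pr_Nil: "pr [] = cls (Id [])" by (simp add: pr_def proj_def)

lemma pr_Cons: "pr (c # w) = ttens (jw c) (pr w)"
  using jones_wenzl_wt[of c 2] proj_wt[of w] unfolding pr_def jw_def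
  by (simp add: ttens_cls proj_def del: jones_wenzl.simps jones_wenzl_wt)

lemma jw_idem: "tcomp (jw c) (jw c) = jw c"
  using TL.rel_run[OF jw_jw[of c]] by (simp add: TL.wh_def TL.act_def TL.idn_tens TL.tens_idn TL.idn_comp)

lemma pr_idem: "tcomp (pr w) (pr w) = pr w"
  by (induction w) (simp_all add: pr_Nil pr_Cons TL.interchange jw_idem TL.idn_comp)

lemma pr_append: "pr (u @ v) = ttens (pr u) (pr v)"
  by (induction u) (simp_all add: pr_Nil pr_Cons TL.idn_tens TL.tens_assoc)

definition tcl :: "fp_arr \<Rightarrow> tl_class" where
  "tcl f = (strands (src f), strands (tgt f), snd (snd f))"

lemma fp_eqI: "\<lbrakk>tcl f = tcl g; src f = src g; tgt f = tgt g\<rbrakk> \<Longrightarrow> f = g"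
  unfolding tcl_def src_def tgt_def by (simp add: prod_eq_iff)

lemma cut_ends [simp]: "src (cut w v t) = w" "tgt (cut w v t) = v"
  by (simp_all add: cut_def src_def tgt_def)

lemma tcl_cut:
  assumes "wt t" "sr t = strands w" "tg t = strands v"
  shows "tcl (cut w v t) = tcomp (pr v) (tcomp (cls t) (pr w))"
proof -
  have "tcomp (pr v) (tcomp (cls t) (pr w)) = cls (proj v \<bullet> t \<bullet> proj w)"
    using assms by (simp add: pr_def cls_ops)
  then show ?thesis using assms by (simp add: tcl_def cut_def src_def tgt_def cls_def)
qed

lemma T2T2_hom: "f \<in> hom T2T2 u v \<longleftrightarrow> f \<in> Arr T2T2 \<and> src f = u \<and> tgt f = v"
  by (simp add: hom_def T2T2_def)

lemma cut_Arr: "\<lbrakk>wt t; sr t = strands w; tg t = strands v\<rbrakk> \<Longrightarrow> cut w v t \<in> Arr T2T2"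
  by (auto simp: T2T2_def typed_iff)

lemma Arr_cut:
  assumes "f \<in> Arr T2T2"
  obtains t where "f = cut (src f) (tgt f) t" "wt t" "sr t = strands (src f)" "tg t = strands (tgt f)"
  using assms by (auto simp: T2T2_def typed_iff)

lemma tcl_arrow:
  assumes "f \<in> Arr T2T2"
  shows "tarrow (tcl f)" "tdm (tcl f) = strands (src f)" "tcd (tcl f) = strands (tgt f)"
    "tcomp (pr (tgt f)) (tcl f) = tcl f" "tcomp (tcl f) (pr (src f)) = tcl f"
proof -
  obtain t where t: "f = cut (src f) (tgt f) t" "wt t" "sr t = strands (src f)" "tg t = strands (tgt f)"
    using assms by (rule Arr_cut)
  have e: "tcl f = tcomp (pr (tgt f)) (tcomp (cls t) (pr (src f)))"
    using tcl_cut[OF t(2-4)] t(1) by simp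
  show "tarrow (tcl f)" "tdm (tcl f) = strands (src f)" "tcd (tcl f) = strands (tgt f)"
    "tcomp (pr (tgt f)) (tcl f) = tcl f" "tcomp (tcl f) (pr (src f)) = tcl f"
    unfolding e using t by (simp_all add: TL.comp_assoc pr_idem)
      (simp_all add: TL.comp_assoc[symmetric] pr_idem)
qed

lemma rep_props:
  assumes "f \<in> Arr T2T2"
  shows "wt (rep f)" "sr (rep f) = strands (src f)" "tg (rep f) = strands (tgt f)" "cls (rep f) = tcl f"
proof -
  have "trep (tcl f) = rep f" by (simp add: trep_def rep_def tcl_def)
  obtain s where s: "wt s" "tcl f = cls s" using tcl_arrow(1)[OF assms] by (auto simp: tarrow_def)
  have "tl_eq (sr s) (tg s) s (trep (tcl f))" unfolding s(2) by (rule trep_cls[OF s(1)])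
  then have r: "tl_eq (sr s) (tg s) s (rep f)" by (simp add: \<open>trep (tcl f) = rep f\<close>)
  show "cls (rep f) = tcl f" using tl_eq_cls[OF r] s(2) by simp
  have "sr s = strands (src f)" "tg s = strands (tgt f)" using tcl_arrow(2,3)[OF assms] s by simp_all
  then show "wt (rep f)" "sr (rep f) = strands (src f)" "tg (rep f) = strands (tgt f)"
    using tl_eq_typed[OF r] by (simp_all add: typed_iff)
qed

lemma tcl_cmp:
  assumes "g \<in> Arr T2T2" "f \<in> Arr T2T2" "src g = tgt f"
  shows "cmp T2T2 g f \<in> Arr T2T2" "src (cmp T2T2 g f) = src f" "tgt (cmp T2T2 g f) = tgt g"
    "tcl (cmp T2T2 g f) = tcomp (tcl g) (tcl f)"
proof -
  note r = rep_props[OF assms(1)] rep_props[OF assms(2)] tcl_arrow[OF assms(1)] tcl_arrow[OF assms(2)]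
  have c: "cmp T2T2 g f = cut (src f) (tgt g) (rep g \<bullet> rep f)" by (simp add: T2T2_def)
  show "cmp T2T2 g f \<in> Arr T2T2" "src (cmp T2T2 g f) = src f" "tgt (cmp T2T2 g f) = tgt g"
    unfolding c using r assms(3) by (auto intro!: cut_Arr)
  have "tcl (cmp T2T2 g f) = tcomp (pr (tgt g)) (tcomp (tcomp (tcl g) (tcl f)) (pr (src f)))"
    unfolding c using r assms(3) by (subst tcl_cut) (auto simp: tcomp_cls[symmetric])
  also have "\<dots> = tcomp (tcomp (pr (tgt g)) (tcl g)) (tcomp (tcl f) (pr (src f)))"
    using r(9-11) r(14-16) assms(3) by (simp add: TL.comp_assoc)
  finally show "tcl (cmp T2T2 g f) = tcomp (tcl g) (tcl f)" using r by simp
qed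

lemma tcl_tarr:
  assumes "g \<in> Arr T2T2" "f \<in> Arr T2T2"
  shows "tarr T2T2 g f \<in> Arr T2T2" "src (tarr T2T2 g f) = src g @ src f" "tgt (tarr T2T2 g f) = tgt g @ tgt f"
    "tcl (tarr T2T2 g f) = ttens (tcl g) (tcl f)"
proof -
  note r = rep_props[OF assms(1)] rep_props[OF assms(2)] tcl_arrow[OF assms(1)] tcl_arrow[OF assms(2)]
  have c: "tarr T2T2 g f = cut (src g @ src f) (tgt g @ tgt f) (rep g \<diamondop> rep f)" by (simp add: T2T2_def)
  show "tarr T2T2 g f \<in> Arr T2T2" "src (tarr T2T2 g f) = src g @ src f" "tgt (tarr T2T2 g f) = tgt g @ tgt f"
    unfolding c using r by (auto intro!: cut_Arr)
  have "tcl (tarr T2T2 g f) = tcomp (pr (tgt g @ tgt f)) (tcomp (ttens (tcl g) (tcl f)) (pr (src g @ src f)))"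
    unfolding c using r by (subst tcl_cut) (auto simp: ttens_cls[symmetric])
  then show "tcl (tarr T2T2 g f) = ttens (tcl g) (tcl f)"
    using r by (simp add: pr_append TL.interchange)
qed

lemma tcl_aplus:
  assumes "g \<in> Arr T2T2" "f \<in> Arr T2T2" "src g = src f" "tgt g = tgt f"
  shows "aplus T2T2 g f \<in> Arr T2T2" "src (aplus T2T2 g f) = src f" "tgt (aplus T2T2 g f) = tgt f"
    "tcl (aplus T2T2 g f) = tadd (tcl g) (tcl f)"
proof -
  note r = rep_props[OF assms(1)] rep_props[OF assms(2)] tcl_arrow[OF assms(1)] tcl_arrow[OF assms(2)]
  have c: "aplus T2T2 g f = cut (src f) (tgt f) (Plus (rep g) (rep f))" using assms by (simp add: T2T2_def)
  show "aplus T2T2 g f \<in> Arr T2T2" "src (aplus T2T2 g f) = src f" "tgt (aplus T2T2 g f) = tgt f"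
    unfolding c using r assms by (auto intro!: cut_Arr)
  have "tcl (aplus T2T2 g f) = tcomp (pr (tgt f)) (tcomp (tadd (tcl g) (tcl f)) (pr (src f)))"
    unfolding c using r assms by (subst tcl_cut) (auto simp: tadd_cls[symmetric])
  then show "tcl (aplus T2T2 g f) = tadd (tcl g) (tcl f)"
    using r assms by (simp add: TL.add_comp TL.comp_add)
qed

lemma tcl_ascale:
  assumes "f \<in> Arr T2T2"
  shows "ascale T2T2 a f \<in> Arr T2T2" "src (ascale T2T2 a f) = src f" "tgt (ascale T2T2 a f) = tgt f"
    "tcl (ascale T2T2 a f) = tscl a (tcl f)"
proof -
  note r = rep_props[OF assms] tcl_arrow[OF assms]
  have c: "ascale T2T2 a f = cut (src f) (tgt f) (Scale a (rep f))" by (simp add: T2T2_def)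
  show "ascale T2T2 a f \<in> Arr T2T2" "src (ascale T2T2 a f) = src f" "tgt (ascale T2T2 a f) = tgt f"
    unfolding c using r by (auto intro!: cut_Arr)
  have "tcl (ascale T2T2 a f) = tcomp (pr (tgt f)) (tcomp (tscl a (tcl f)) (pr (src f)))"
    unfolding c using r by (subst tcl_cut) (auto simp: tscl_cls[symmetric])
  then show "tcl (ascale T2T2 a f) = tscl a (tcl f)"
    using r by (simp add: TL.scl_comp TL.comp_scl)
qed

lemma tcl_ident: "ident T2T2 w \<in> Arr T2T2" "src (ident T2T2 w) = w" "tgt (ident T2T2 w) = w"
    "tcl (ident T2T2 w) = pr w"
proof -
  have c: "ident T2T2 w = cut w w (Id (strands w))" by (simp add: T2T2_def)
  show "ident T2T2 w \<in> Arr T2T2" "src (ident T2T2 w) = w" "tgt (ident T2T2 w) = w"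
    unfolding c by (auto intro!: cut_Arr)
  show "tcl (ident T2T2 w) = pr w" unfolding c by (subst tcl_cut) (auto simp: TL.idn_comp pr_idem)
qed

lemma reflect_proj: "cls (reflect (proj w)) = pr w"
proof (induction w)
  case Nil
  then show ?case by (simp add: proj_def pr_def)
next
  case (Cons c w)
  have "cls (reflect (jones_wenzl c 2)) = jw c"
    unfolding jw_def by (rule tl_eq_cls[OF reflect_jones_wenzl])
  moreover have "cls (reflect (proj (c # w))) = ttens (cls (reflect (jones_wenzl c 2))) (cls (reflect (proj w)))"
    using jones_wenzl_wt[of c 2] by (simp add: proj_def ttens_cls proj_wt[unfolded proj_def] del: jones_wenzl.simps)
  ultimately show ?case using Cons by (simp add: pr_Cons)
qed

text \<open>The involution is defined by reflecting a chosen representative, so this is where compatibility of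
reflection with the congruence enters.\<close>

lemma tcl_star_cut:
  assumes t: "wt t" "sr t = strands w" "tg t = strands v"
  shows "star T2T2 (cut w v t) \<in> Arr T2T2" "src (star T2T2 (cut w v t)) = v" "tgt (star T2T2 (cut w v t)) = w"
    "tcl (star T2T2 (cut w v t)) = tcomp (pr w) (tcomp (cls (reflect t)) (pr v))"
proof -
  let ?f = "cut w v t"
  have f: "?f \<in> Arr T2T2" using assms by (rule cut_Arr)
  note r = rep_props[OF f]
  have c: "star T2T2 ?f = cut v w (reflect (rep ?f))" by (simp add: T2T2_def)
  show "star T2T2 ?f \<in> Arr T2T2" "src (star T2T2 ?f) = v" "tgt (star T2T2 ?f) = w"
    unfolding c using r by (auto intro!: cut_Arr)
  have "cls (rep ?f) = cls (proj v \<bullet> t \<bullet> proj w)"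
    using r(4) tcl_cut[OF assms] assms by (simp add: pr_def cls_ops)
  then have "tl_eq (strands w) (strands v) (rep ?f) (proj v \<bullet> t \<bullet> proj w)"
    using cls_tl_eq[of "rep ?f" "proj v \<bullet> t \<bullet> proj w"] assms by simp
  then have "cls (reflect (rep ?f)) = cls (reflect (proj v \<bullet> t \<bullet> proj w))"
    by (rule tl_eq_cls[OF tl_eq_reflect])
  also have "\<dots> = tcomp (tcomp (pr w) (cls (reflect t))) (pr v)"
    using assms by (simp add: tcomp_cls[symmetric] reflect_proj)
  finally have e: "cls (reflect (rep ?f)) = tcomp (tcomp (pr w) (cls (reflect t))) (pr v)" .
  have "tcl (star T2T2 ?f) = tcomp (pr w) (tcomp (cls (reflect (rep ?f))) (pr v))"
    unfolding c using r by (subst tcl_cut) auto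
  then show "tcl (star T2T2 ?f) = tcomp (pr w) (tcomp (cls (reflect t)) (pr v))"
    unfolding e using assms by (simp add: TL.comp_assoc pr_idem)
      (simp add: TL.comp_assoc[symmetric] pr_idem)
qed

section \<open>The trivalent vertex of a letter\<close>

text \<open>The vertex joins two letters, that is, four strands, into one by a cap on the inner two strands.\<close>

definition trivalent :: "colour \<Rightarrow> fp_arr" where
  "trivalent c = cut [c, c] [c] (Id [c] \<diamondop> Cap c \<diamondop> Id [c])"

lemmas run_unfold = TL.wh_def TL.act_def TL.idn_tens TL.tens_idn TL.idn_comp TL.comp_idn TL.idn_tens_idn
      TL.comp_assoc

lemma pr_run: "pr [] = TL.run [] []" "pr [c] = TL.run [c, c] [(0, jw c)]"
  "pr [c, c] = TL.run [c, c, c, c] [(0, jw c), (2, jw c)]"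
  by (simp_all add: pr_Nil pr_Cons run_unfold TL.interchange)

lemma tcl_comp_run:
  assumes "x = TL.run (strands w) ls" "TL.ok (strands w) (ps @ ls @ qs)"
    "pr w = TL.run (strands w) ps" "pr v = TL.run (strands v) qs" "TL.tgt (strands w) ps = strands w"
    "TL.tgt (strands w) ls = strands v"
  shows "tcomp (pr v) (tcomp x (pr w)) = TL.run (strands w) (ps @ ls @ qs)"
  using assms by (simp add: TL.run_append TL.comp_assoc TL.run_props)

lemma pr_run_strands: "pr [] = TL.run (strands []) []" "pr [c] = TL.run (strands [c]) [(0, jw c)]"
  "pr [c, c] = TL.run (strands [c, c]) [(0, jw c), (2, jw c)]"
  by (simp_all only: pr_run strands_simps)

lemma ev_letter: "ev T2T2 [c] \<in> Arr T2T2" "src (ev T2T2 [c]) = [c, c]" "tgt (ev T2T2 [c]) = []"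
  "tcl (ev T2T2 [c]) = TL.run [c, c, c, c] [(0, jw c), (2, jw c), (1, cp c), (0, cp c)]"
proof -
  have e: "ev T2T2 [c] = cut [c, c] [] (caps [c, c])" by (simp add: T2T2_def)
  show "ev T2T2 [c] \<in> Arr T2T2" "src (ev T2T2 [c]) = [c, c]" "tgt (ev T2T2 [c]) = []"
    unfolding e by (auto intro!: cut_Arr)
  have "cls (caps [c, c]) = TL.run (strands [c, c]) [(1, cp c), (0, cp c)]"
    by (simp add: run_unfold cls_ops[symmetric] cp_def)
  from tcl_comp_run[OF this _ pr_run_strands(3) pr_run_strands(1)]
  show "tcl (ev T2T2 [c]) = TL.run [c, c, c, c] [(0, jw c), (2, jw c), (1, cp c), (0, cp c)]"
    unfolding e by (subst tcl_cut) (simp_all add: layer del: TL.run.simps caps.simps, simp_all)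
qed

lemma coev_letter: "coev T2T2 [c] \<in> Arr T2T2" "src (coev T2T2 [c]) = []" "tgt (coev T2T2 [c]) = [c, c]"
  "tcl (coev T2T2 [c]) = TL.run [] [(0, cu c), (1, cu c), (0, jw c), (2, jw c)]"
  "star T2T2 (coev T2T2 [c]) = ev T2T2 [c]"
proof -
  have e: "coev T2T2 [c] = cut [] [c, c] (cups [c, c])" by (simp add: T2T2_def)
  show "coev T2T2 [c] \<in> Arr T2T2" "src (coev T2T2 [c]) = []" "tgt (coev T2T2 [c]) = [c, c]"
    unfolding e by (auto intro!: cut_Arr)
  have "cls (cups [c, c]) = TL.run (strands []) [(0, cu c), (1, cu c)]"
    by (simp add: run_unfold cls_ops[symmetric] cu_def)
  from tcl_comp_run[OF this _ pr_run_strands(1) pr_run_strands(3)]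
  show "tcl (coev T2T2 [c]) = TL.run [] [(0, cu c), (1, cu c), (0, jw c), (2, jw c)]"
    unfolding e by (subst tcl_cut) (simp_all add: layer del: TL.run.simps cups.simps, simp_all)
  have r: "cls (reflect (cups [c, c])) = TL.run (strands [c, c]) [(1, cp c), (0, cp c)]"
    by (simp add: run_unfold cls_ops[symmetric] cp_def)
  show "star T2T2 (coev T2T2 [c]) = ev T2T2 [c]"
  proof (rule fp_eqI)
    have w: "wt (cups [c, c])" "sr (cups [c, c]) = strands []" "tg (cups [c, c]) = strands [c, c]" by simp_all
    note S = tcl_star_cut[OF w]
    show "src (star T2T2 (coev T2T2 [c])) = src (ev T2T2 [c])" "tgt (star T2T2 (coev T2T2 [c])) = tgt (ev T2T2 [c])"
      unfolding e S ev_letter by simp_all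
    show "tcl (star T2T2 (coev T2T2 [c])) = tcl (ev T2T2 [c])"
      unfolding e S(4) ev_letter
      using tcl_comp_run[OF r _ pr_run_strands(3) pr_run_strands(1)]
      by (simp add: layer del: TL.run.simps)
  qed
qed

lemma trivalent_letter: "trivalent c \<in> Arr T2T2" "src (trivalent c) = [c, c]" "tgt (trivalent c) = [c]"
  "tcl (trivalent c) = TL.run [c, c, c, c] [(0, jw c), (2, jw c), (1, cp c), (0, jw c)]"
  "star T2T2 (trivalent c) \<in> Arr T2T2" "src (star T2T2 (trivalent c)) = [c]" "tgt (star T2T2 (trivalent c)) = [c, c]"
  "tcl (star T2T2 (trivalent c)) = TL.run [c, c] [(0, jw c), (1, cu c), (0, jw c), (2, jw c)]"
proof -
  let ?t = "Id [c] \<diamondop> Cap c \<diamondop> Id [c]"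
  have w: "wt ?t" "sr ?t = strands [c, c]" "tg ?t = strands [c]" by simp_all
  show "trivalent c \<in> Arr T2T2" "src (trivalent c) = [c, c]" "tgt (trivalent c) = [c]"
    unfolding trivalent_def by (auto intro!: cut_Arr)
  have r: "cls ?t = TL.run (strands [c, c]) [(1, cp c)]"
    by (simp add: run_unfold cls_ops[symmetric] cp_def)
  show "tcl (trivalent c) = TL.run [c, c, c, c] [(0, jw c), (2, jw c), (1, cp c), (0, jw c)]"
    unfolding trivalent_def tcl_cut[OF w]
    using tcl_comp_run[OF r _ pr_run_strands(3) pr_run_strands(2)]
    by (simp add: layer del: TL.run.simps)
  have r': "cls (reflect ?t) = TL.run (strands [c]) [(1, cu c)]"
    by (simp add: run_unfold cls_ops[symmetric] cu_def)
  note S = tcl_star_cut[OF w, folded trivalent_def]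
  show "star T2T2 (trivalent c) \<in> Arr T2T2" "src (star T2T2 (trivalent c)) = [c]" "tgt (star T2T2 (trivalent c)) = [c, c]"
    using S by simp_all
  show "tcl (star T2T2 (trivalent c)) = TL.run [c, c] [(0, jw c), (1, cu c), (0, jw c), (2, jw c)]"
    unfolding S(4)
    using tcl_comp_run[OF r' _ pr_run_strands(2) pr_run_strands(3)]
    by (simp add: layer del: TL.run.simps)
qed

lemmas fp_letter = ev_letter(1-3) coev_letter(1-3) trivalent_letter(1-3,5-7) tcl_ident(1-3)
lemmas fp_value = tcl_cmp tcl_tarr tcl_aplus tcl_ascale fp_letter ev_letter(4) coev_letter(4) trivalent_letter(4,8)
  tcl_ident(4) pr_run

lemma TL_run_tens: "\<lbrakk>TL.ok w xs; TL.ok v ys; u = w @ v; zs = xs @ TL.shift (length (TL.tgt w xs)) ys\<rbrakk>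
    \<Longrightarrow> ttens (TL.run w xs) (TL.run v ys) = TL.run u zs"
  using TL.run_tens by simp

text \<open>All projections merge into one; expanding it gives a pair of concentric loops and, with coefficient
\<open>-\<tau>\<^sup>-\<^sup>1\<close>, a single loop.  The value is \<open>\<tau>\<^sup>2 - 1 = \<tau>\<close>.\<close>

lemma letter_loop: "cmp T2T2 (ev T2T2 [c]) (coev T2T2 [c]) = ascale T2T2 \<tau> (ident T2T2 [])"
proof (rule fp_eqI)
  let ?c = "[(0, cu c), (1, cu c)]" and ?e = "[(1, cp c), (0, cp c)]"
  have "TL.rel [] 1 (?c @ [(0, jw c), (2, jw c), (0, jw c), (2, jw c)] @ ?e) (?c @ [(0, jw c), (2, jw c), (2, jw c)] @ ?e)"
    by (rule TL.rel_at[OF jw_jw, of _ ?c 0 "[(2, jw c), (2, jw c)] @ ?e"])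
      (simp_all add: layer)
  also have "TL.rel [] 1 \<dots> (?c @ [(0, jw c), (2, jw c)] @ ?e)"
    by (rule TL.rel_at[OF jw_jw, of _ "?c @ [(0, jw c)]" 2 ?e])
      (simp_all add: layer)
  also have "TL.rel [] 1 \<dots> (?c @ [(0, jw c), (0, jw c)] @ ?e)"
    by (rule TL.rel_at[OF jw_slide_cap, of _ "?c @ [(0, jw c)]" 0 "[]"])
      (simp_all add: layer)
  also have "TL.rel [] 1 \<dots> (?c @ [(0, jw c)] @ ?e)"
    by (rule TL.rel_at[OF jw_jw, of _ ?c 0 ?e])
      (simp_all add: layer)
  \<comment> \<open>Concentric loops, and a single loop from the correction term.\<close>
  also have "TL.rel [] (\<tau> * \<tau> + (- 1 / \<tau>) * \<tau>) (?c @ [(0, jw c)] @ ?e) []"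
  proof (rule TL.rel_addI)
    show "TL.run [] (?c @ [(0, jw c)] @ ?e) = tadd (TL.run [] (?c @ ?e))
        (tscl (- 1 / \<tau>) (TL.run [] (?c @ [(0, cp c), (0, cu c)] @ ?e)))"
      using jw_run(1)[of c "[]" ?c 0 ?e] by (simp add: layer)
    have "TL.rel [] \<tau> (?c @ ?e) [(0, cu c), (0, cp c)]"
      by (rule TL.rel_at[OF strand_loop, of _ "[(0, cu c)]" 1 "[(0, cp c)]"])
        (simp_all add: layer)
    also note strand_loop
    finally show "TL.rel [] (\<tau> * \<tau>) (?c @ ?e) []" .
    have "TL.rel [] 1 (?c @ [(0, cp c), (0, cu c)] @ ?e) ([(0, cu c), (0, cu c)] @ ?e)"
      by (rule TL.rel_at[OF strand_zigzag_left, of _ "[(0, cu c)]" 0 "[(0, cu c)] @ ?e"])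
        (simp_all add: layer)
    also have "TL.rel [] 1 \<dots> [(0, cu c), (0, cp c)]"
      by (rule TL.rel_at[OF strand_zigzag_right, of _ "[(0, cu c)]" 0 "[(0, cp c)]"])
        (simp_all add: layer)
    also note strand_loop
    finally show "TL.rel [] \<tau> (?c @ [(0, cp c), (0, cu c)] @ ?e) []" by simp
  qed (simp add: layer)
  finally have "TL.rel [] \<tau> (?c @ [(0, jw c), (2, jw c), (0, jw c), (2, jw c)] @ ?e) []"
    using tau_sq tau_nz by simp
  then show "tcl (cmp T2T2 (ev T2T2 [c]) (coev T2T2 [c])) = tcl (ascale T2T2 \<tau> (ident T2T2 []))"
    by (simp add: fp_value TL.run_comp TL.rel_def layer del: TL.run.simps)
qed (simp_all add: fp_value)

declare TL.run.simps [simp del]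

lemma jw_merge: "TL.rel w 1 (pre @ (i, jw c) # (i, jw c) # post) (pre @ (i, jw c) # post)"
  if "TL.ok w (pre @ (i, jw c) # post)"
proof -
  have f: "TL.fits i (jw c) (TL.tgt w pre)" using that by simp
  then have a: "TL.act i (jw c) (TL.tgt w pre) = TL.tgt w pre"
  proof (elim TL.fitsE)
    fix u v assume "TL.tgt w pre = u @ tdm (jw c) @ v" "i = length u"
    then show ?thesis using TL.act_mid[of u "jw c" v] by simp
  qed
  show ?thesis
    by (rule TL.rel_at[OF jw_jw[of c], where pre = pre and i = i and post = post])
      (use that f a in \<open>simp_all add: TL.fits_def\<close>)
qed

lemma jw_absorb:
  "TL.ok w (pre @ (i, jw c) # post) \<Longrightarrow>
    TL.rel w 1 (pre @ replicate k (i, jw c) @ (i, jw c) # post) (pre @ (i, jw c) # post)"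
proof (induction k)
  case 0
  then show ?case by (simp add: TL.rel_refl)
next
  case (Suc k)
  then have ok: "TL.ok w (pre @ (i, jw c) # replicate k (i, jw c) @ post)"
    by (simp add: TL.rel_def replicate_app_Cons_same)
  show ?case
    using TL.rel_trans[OF jw_merge[OF ok] _] Suc
    by (simp add: replicate_app_Cons_same)
qed

text \<open>The projections slide along the caps onto the strand at the left, where they merge into one; two zigzags
of single strands are left.\<close>

lemma letter_zigzag_left:
  "cmp T2T2 (tarr T2T2 (ev T2T2 [c]) (ident T2T2 [c])) (tarr T2T2 (ident T2T2 [c]) (coev T2T2 [c])) = ident T2T2 [c]"
proof (rule fp_eqI)
  let ?f = "\<lambda>i. (i :: nat, jw c)"
  let ?w = "[c, c]"
  let ?e = "[(1, cp c), (0, cp c)]" and ?d = "[(2, cu c), (3, cu c)]"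
  have "TL.rel ?w 1 ([?f 0] @ ?d @ [?f 2, ?f 4, ?f 0, ?f 2] @ ?e @ [?f 0]) ([?f 0] @ ?d @ [?f 2, ?f 4, ?f 0, ?f 0] @ ?e @ [?f 0])"
    by (rule TL.rel_at[OF jw_slide_cap, of _ "[?f 0] @ ?d @ [?f 2, ?f 4, ?f 0]" 0 "[?f 0]"])
      (simp_all add: layer)
  also have "TL.rel ?w 1 \<dots> ([?f 0] @ ?d @ [?f 4, ?f 0, ?f 0, ?f 0] @ ?e @ [?f 0])"
    by (rule TL.rel_at[OF jw_slide_cap, of _ "[?f 0] @ ?d @ [?f 4, ?f 0, ?f 0]" 0 "[?f 0]"])
      (simp_all add: layer)
  also have "TL.rel ?w 1 \<dots> ([?f 0, ?f 0, ?f 0, ?f 0] @ [(2, cu c), (1, cp c), (1, cu c), (0, cp c)] @ [?f 0, ?f 0])"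
    by (rule TL.rel_nf) (simp_all add: layer)
  also have "TL.rel ?w 1 \<dots> ([?f 0, ?f 0, ?f 0, ?f 0] @ [(1, cu c), (0, cp c)] @ [?f 0, ?f 0])"
    by (rule TL.rel_at[OF strand_zigzag_left, of _ "[?f 0, ?f 0, ?f 0, ?f 0]" 1 "[(1, cu c), (0, cp c)] @ [?f 0, ?f 0]"])
      (simp_all add: layer)
  also have "TL.rel ?w 1 \<dots> ([?f 0, ?f 0, ?f 0, ?f 0, ?f 0, ?f 0])"
    by (rule TL.rel_at[OF strand_zigzag_left, of _ "[?f 0, ?f 0, ?f 0, ?f 0]" 0 "[?f 0, ?f 0]"])
      (simp_all add: layer)
  also have "TL.rel ?w 1 \<dots> [?f 0]"
    using jw_absorb[of ?w "[]" 0 c "[]" 5] by (simp add: layer numeral_eq_Suc)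
  finally have "TL.run ?w ([?f 0] @ ?d @ [?f 2, ?f 4, ?f 0, ?f 2] @ ?e @ [?f 0]) = TL.run ?w [?f 0]"
    by (auto dest!: TL.rel_run)
  moreover have "tcl (tarr T2T2 (ident T2T2 [c]) (coev T2T2 [c])) = TL.run ?w ([?f 0] @ ?d @ [?f 2, ?f 4])"
    by (subst tcl_tarr(4), simp_all only: fp_letter fp_value, rule TL_run_tens) (simp_all add: layer)
  moreover have "tcl (tarr T2T2 (ev T2T2 [c]) (ident T2T2 [c])) = TL.run [c, c, c, c, c, c] ([?f 0, ?f 2] @ ?e @ [?f 0])"
    by (subst tcl_tarr(4), simp_all only: fp_letter fp_value, rule TL_run_tens) (simp_all add: layer)
  ultimately show "tcl (cmp T2T2 (tarr T2T2 (ev T2T2 [c]) (ident T2T2 [c])) (tarr T2T2 (ident T2T2 [c]) (coev T2T2 [c]))) = tcl (ident T2T2 [c])"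
    by (simp add: tcl_cmp tcl_tarr(1-3) fp_letter TL.run_comp layer tcl_ident pr_run del: TL.run.simps)
qed (simp_all add: fp_value)

lemma letter_zigzag_right:
  "cmp T2T2 (tarr T2T2 (ident T2T2 [c]) (ev T2T2 [c])) (tarr T2T2 (coev T2T2 [c]) (ident T2T2 [c])) = ident T2T2 [c]"
proof (rule fp_eqI)
  let ?f = "\<lambda>i. (i :: nat, jw c)"
  let ?w = "[c, c]"
  let ?e = "[(3, cp c), (2, cp c)]" and ?d = "[(0, cu c), (1, cu c)]"
  have "TL.rel ?w 1 (?d @ [?f 0, ?f 2, ?f 4, ?f 0, ?f 2, ?f 4] @ ?e) (?d @ [?f 0, ?f 2, ?f 2, ?f 4, ?f 0, ?f 2] @ ?e)"
    by (rule TL.rel_at[OF jw_slide_cap, of _ "?d @ [?f 0, ?f 2, ?f 4, ?f 0, ?f 2]" 2 "[]"])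
      (simp_all add: layer)
  also have "TL.rel ?w 1 \<dots> (?d @ [?f 0, ?f 2, ?f 2, ?f 2, ?f 0, ?f 2] @ ?e)"
    by (rule TL.rel_at[OF jw_slide_cap, of _ "?d @ [?f 0, ?f 2, ?f 2, ?f 0, ?f 2]" 2 "[]"])
      (simp_all add: layer)
  also have "TL.rel ?w 1 \<dots> (?d @ [?f 0, ?f 2, ?f 2, ?f 0, ?f 2] @ ?e)"
    by (rule TL.rel_at[OF jw_jw, of _ "?d @ [?f 0, ?f 2, ?f 2]" 2 "[?f 0] @ ?e"])
      (simp_all add: layer)
  also have "TL.rel ?w 1 \<dots> (?d @ [?f 0, ?f 2, ?f 0, ?f 2] @ ?e)"
    by (rule TL.rel_at[OF jw_jw, of _ "?d @ [?f 0, ?f 2]" 2 "[?f 0] @ ?e"])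
      (simp_all add: layer)
  also have "TL.rel ?w 1 \<dots> (?d @ [?f 0, ?f 0, ?f 2] @ ?e)"
    by (rule TL.rel_at[OF jw_jw, of _ "?d @ [?f 0, ?f 0]" 2 "?e"])
      (simp_all add: layer)
  also have "TL.rel ?w 1 \<dots> (?d @ [?f 0, ?f 0, ?f 0] @ ?e)"
    by (rule TL.rel_at[OF jw_slide_cup, of _ "[]" 0 "[?f 0, ?f 0] @ ?e"])
      (simp_all add: layer)
  also have "TL.rel ?w 1 \<dots> ([(0, cu c), (1, cp c), (1, cu c), (2, cp c)] @ [?f 0, ?f 0, ?f 0])"
    by (rule TL.rel_nf) (simp_all add: layer)
  also have "TL.rel ?w 1 \<dots> ([(1, cu c), (2, cp c)] @ [?f 0, ?f 0, ?f 0])"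
    by (rule TL.rel_at[OF strand_zigzag_right, of _ "[]" 0 "[(1, cu c), (2, cp c)] @ [?f 0, ?f 0, ?f 0]"])
      (simp_all add: layer)
  also have "TL.rel ?w 1 \<dots> ([?f 0, ?f 0, ?f 0])"
    by (rule TL.rel_at[OF strand_zigzag_right, of _ "[]" 1 "[?f 0, ?f 0, ?f 0]"])
      (simp_all add: layer)
  also have "TL.rel ?w 1 \<dots> [?f 0]"
    using jw_absorb[of ?w "[]" 0 c "[]" 2] by (simp add: layer numeral_eq_Suc)
  finally have "TL.run ?w (?d @ [?f 0, ?f 2, ?f 4, ?f 0, ?f 2, ?f 4] @ ?e) = TL.run ?w [?f 0]"
    by (auto dest!: TL.rel_run)
  moreover have "tcl (tarr T2T2 (coev T2T2 [c]) (ident T2T2 [c])) = TL.run ?w (?d @ [?f 0, ?f 2, ?f 4])"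
    by (subst tcl_tarr(4), simp_all only: fp_letter fp_value, rule TL_run_tens) (simp_all add: layer)
  moreover have "tcl (tarr T2T2 (ident T2T2 [c]) (ev T2T2 [c])) = TL.run [c, c, c, c, c, c] ([?f 0, ?f 2, ?f 4] @ ?e)"
    by (subst tcl_tarr(4), simp_all only: fp_letter fp_value, rule TL_run_tens) (simp_all add: layer)
  ultimately show "tcl (cmp T2T2 (tarr T2T2 (ident T2T2 [c]) (ev T2T2 [c])) (tarr T2T2 (coev T2T2 [c]) (ident T2T2 [c]))) = tcl (ident T2T2 [c])"
    by (simp add: tcl_cmp tcl_tarr(1-3) fp_letter TL.run_comp layer tcl_ident pr_run del: TL.run.simps)
qed (simp_all add: fp_value)

abbreviation (input) "costar c \<equiv> star T2T2 (trivalent c)"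

text \<open>Bending the adjoint of the vertex to the left straightens one strand; as before, all projections can
be moved next to the one on the same letter.\<close>

lemma trivalent_rotation_left:
  "cmp T2T2 (tarr T2T2 (ev T2T2 [c]) (ident T2T2 [c])) (tarr T2T2 (ident T2T2 [c]) (costar c)) = trivalent c"
proof (rule fp_eqI)
  let ?f = "\<lambda>i. (i :: nat, jw c)"
  let ?w = "[c, c, c, c]"
  let ?e = "[(1, cp c), (0, cp c)]"
  have "TL.rel ?w 1 ([?f 0, ?f 2, (3, cu c), ?f 2, ?f 4, ?f 0, ?f 2] @ ?e @ [?f 0]) ([?f 0, ?f 2, (3, cu c), ?f 2, ?f 4, ?f 0, ?f 0] @ ?e @ [?f 0])"
    by (rule TL.rel_at[OF jw_slide_cap, of _ "[?f 0, ?f 2, (3, cu c), ?f 2, ?f 4, ?f 0]" 0 "[?f 0]"])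
      (simp_all add: layer)
  also have "TL.rel ?w 1 \<dots> ([?f 0, ?f 2, (3, cu c), ?f 0, ?f 4, ?f 0, ?f 0] @ ?e @ [?f 0])"
    by (rule TL.rel_at[OF jw_slide_cap, of _ "[?f 0, ?f 2, (3, cu c), ?f 4, ?f 0, ?f 0]" 0 "[?f 0]"])
      (simp_all add: layer)
  also have "TL.rel ?w 1 \<dots> ([?f 0, ?f 0, ?f 0, ?f 0, ?f 2] @ [(1, cp c), (1, cu c), (0, cp c)] @ [?f 0, ?f 0])"
    by (rule TL.rel_nf) (simp_all add: layer)
  also have "TL.rel ?w 1 \<dots> ([?f 0, ?f 0, ?f 0, ?f 0, ?f 2] @ [(1, cp c)] @ [?f 0, ?f 0])"
    by (rule TL.rel_at[OF strand_zigzag_left, of _ "[?f 0, ?f 0, ?f 0, ?f 0, ?f 2] @ [(1, cp c)]" 0 "[?f 0, ?f 0]"])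
      (simp_all add: layer)
  also have "TL.rel ?w 1 \<dots> ([?f 0, ?f 2] @ [(1, cp c)] @ [?f 0, ?f 0])"
    using jw_absorb[of ?w "[]" 0 c "[?f 2] @ [(1, cp c)] @ [?f 0, ?f 0]" 3] by (simp add: layer numeral_eq_Suc)
  also have "TL.rel ?w 1 \<dots> ([?f 0, ?f 2] @ [(1, cp c)] @ [?f 0])"
    using jw_merge[of ?w "[?f 0, ?f 2] @ [(1, cp c)]" 0 c "[]"] by (simp add: layer)
  finally have "TL.run ?w ([?f 0, ?f 2, (3, cu c), ?f 2, ?f 4, ?f 0, ?f 2] @ ?e @ [?f 0])
      = TL.run ?w ([?f 0, ?f 2] @ [(1, cp c)] @ [?f 0])"
    by (auto dest!: TL.rel_run)
  moreover have "tcl (tarr T2T2 (ident T2T2 [c]) (costar c)) = TL.run ?w [?f 0, ?f 2, (3, cu c), ?f 2, ?f 4]"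
    by (subst tcl_tarr(4), simp_all only: fp_letter fp_value, rule TL_run_tens) (simp_all add: layer)
  moreover have "tcl (tarr T2T2 (ev T2T2 [c]) (ident T2T2 [c])) = TL.run [c, c, c, c, c, c] ([?f 0, ?f 2] @ ?e @ [?f 0])"
    by (subst tcl_tarr(4), simp_all only: fp_letter fp_value, rule TL_run_tens) (simp_all add: layer)
  ultimately show "tcl (cmp T2T2 (tarr T2T2 (ev T2T2 [c]) (ident T2T2 [c])) (tarr T2T2 (ident T2T2 [c]) (costar c))) = tcl (trivalent c)"
    by (simp add: tcl_cmp tcl_tarr(1-3) fp_letter TL.run_comp layer trivalent_letter(4) del: TL.run.simps)
qed (simp_all add: fp_value)

lemma trivalent_rotation_right:
  "cmp T2T2 (tarr T2T2 (ident T2T2 [c]) (ev T2T2 [c])) (tarr T2T2 (costar c) (ident T2T2 [c])) = trivalent c"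
proof (rule fp_eqI)
  let ?f = "\<lambda>i. (i :: nat, jw c)"
  let ?w = "[c, c, c, c]"
  let ?e = "[(3, cp c), (2, cp c)]"
  note slide = TL.rel_sym[OF jw_slide_cap, simplified]
  have "TL.rel ?w 1 ([?f 0, (1, cu c), ?f 0, ?f 2, ?f 4, ?f 0, ?f 2, ?f 4] @ ?e)
      ([?f 0, (1, cu c), ?f 0, ?f 2, ?f 4, ?f 0, ?f 4, ?f 4] @ ?e)"
    by (rule TL.rel_at[OF slide, of _ "[?f 0, (1, cu c), ?f 0, ?f 2, ?f 4, ?f 0, ?f 4]" 2 "[]"])
      (simp_all add: layer)
  also have "TL.rel ?w 1 \<dots> ([?f 0, (1, cu c), ?f 0, ?f 4, ?f 4, ?f 0, ?f 4, ?f 4] @ ?e)"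
    by (rule TL.rel_at[OF slide, of _ "[?f 0, (1, cu c), ?f 0, ?f 4, ?f 0, ?f 4, ?f 4]" 2 "[]"])
      (simp_all add: layer)
  also have "TL.rel ?w 1 \<dots> ([?f 0, ?f 2, ?f 2, ?f 2, ?f 2] @ [(1, cp c), (1, cu c), (2, cp c)] @ [?f 0, ?f 0])"
    by (rule TL.rel_nf) (simp_all add: layer)
  also have "TL.rel ?w 1 \<dots> ([?f 0, ?f 2, ?f 2, ?f 2, ?f 2] @ [(1, cp c)] @ [?f 0, ?f 0])"
    by (rule TL.rel_at[OF strand_zigzag_right, of _ "[?f 0, ?f 2, ?f 2, ?f 2, ?f 2] @ [(1, cp c)]" 1 "[?f 0, ?f 0]"])
      (simp_all add: layer)
  also have "TL.rel ?w 1 \<dots> ([?f 0, ?f 2] @ [(1, cp c)] @ [?f 0, ?f 0])"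
    using jw_absorb[of ?w "[?f 0]" 2 c "[(1, cp c)] @ [?f 0, ?f 0]" 3] by (simp add: layer numeral_eq_Suc)
  also have "TL.rel ?w 1 \<dots> ([?f 0, ?f 2] @ [(1, cp c)] @ [?f 0])"
    using jw_merge[of ?w "[?f 0, ?f 2] @ [(1, cp c)]" 0 c "[]"] by (simp add: layer)
  finally have "TL.run ?w ([?f 0, (1, cu c), ?f 0, ?f 2, ?f 4, ?f 0, ?f 2, ?f 4] @ ?e)
      = TL.run ?w ([?f 0, ?f 2] @ [(1, cp c)] @ [?f 0])"
    by (auto dest!: TL.rel_run)
  moreover have "tcl (tarr T2T2 (costar c) (ident T2T2 [c])) = TL.run ?w [?f 0, (1, cu c), ?f 0, ?f 2, ?f 4]"
    by (subst tcl_tarr(4), simp_all only: fp_letter fp_value, rule TL_run_tens) (simp_all add: layer)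
  moreover have "tcl (tarr T2T2 (ident T2T2 [c]) (ev T2T2 [c])) = TL.run [c, c, c, c, c, c] ([?f 0, ?f 2, ?f 4] @ ?e)"
    by (subst tcl_tarr(4), simp_all only: fp_letter fp_value, rule TL_run_tens) (simp_all add: layer)
  ultimately show "tcl (cmp T2T2 (tarr T2T2 (ident T2T2 [c]) (ev T2T2 [c])) (tarr T2T2 (costar c) (ident T2T2 [c]))) = tcl (trivalent c)"
    by (simp add: tcl_cmp tcl_tarr(1-3) fp_letter TL.run_comp layer trivalent_letter(4) del: TL.run.simps)
qed (simp_all add: fp_value)

lemma (in strict_linear_category) regroup_linear:
  assumes "arr B" "arr X" "dm X = dm B" "cd X = cd B"
  shows "add (scl a X) (scl b (add B (scl d X))) = add (scl b B) (scl (a + b * d) X)"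
  using assms add_comm[of "scl a X" "scl b B"] add_assoc[of "scl b B" "scl a X" "scl (b * d) X"]
    add_assoc[of "scl a X" "scl b B" "scl (b * d) X"]
  by (simp add: scl_add scl_scl add_scl)

text \<open>In terms of the diagrams \<open>B\<close> and \<open>X\<close> of \<open>jw_tensor_jw\<close>, the first summand is \<open>X\<close> up to a scalar and
\<open>t\<^sub>c\<^sup>* t\<^sub>c = B - \<tau>\<^sup>-\<^sup>1 X\<close>.  The coefficients solve \<open>\<tau>\<^sup>-\<^sup>1 X + \<tau>\<^sup>2 (B - \<tau>\<^sup>-\<^sup>1 X) = (1 + \<tau>) B - X\<close>.\<close>

lemma letter_decomposition:
  "ident T2T2 [c, c] = aplus T2T2 (ascale T2T2 (1 / \<tau>) (cmp T2T2 (coev T2T2 [c]) (ev T2T2 [c])))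
     (ascale T2T2 (\<tau> * \<tau>) (cmp T2T2 (costar c) (trivalent c)))"
proof (rule fp_eqI)
  let ?f = "\<lambda>i. (i :: nat, jw c)"
  let ?w = "[c, c, c, c]"
  let ?p = "[?f 0, ?f 2]"
  let ?B = "TL.run ?w (?p @ [(1, cp c), (1, cu c)] @ ?p)"
  let ?X = "TL.run ?w (?p @ [(1, cp c), (0, cp c), (0, cu c), (1, cu c)] @ ?p)"
  have "TL.rel ?w 1 (?p @ [(1, cp c), ?f 0, ?f 0, (1, cu c)] @ ?p) (?p @ [(1, cp c), ?f 0, (1, cu c)] @ ?p)"
    using jw_merge[of ?w "?p @ [(1, cp c)]" 0 c "[(1, cu c)] @ ?p"] by (simp add: layer)
  moreover have "TL.run ?w (?p @ [(1, cp c), ?f 0, (1, cu c)] @ ?p) = tadd ?B (tscl (- 1 / \<tau>) ?X)"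
    using jw_run(1)[of c ?w "?p @ [(1, cp c)]" 0 "[(1, cu c)] @ ?p"] by (simp add: layer)
  ultimately have T: "TL.run ?w (?p @ [(1, cp c), ?f 0, ?f 0, (1, cu c)] @ ?p) = tadd ?B (tscl (- 1 / \<tau>) ?X)"
    by (auto dest!: TL.rel_run)
  have "1 / \<tau> + \<tau> * \<tau> * (- 1 / \<tau>) = - 1"
    using tau_nz tau_sq by (simp add: field_simps)
  then have "tadd (tscl (1 / \<tau>) ?X) (tscl (\<tau> * \<tau>) (tadd ?B (tscl (- 1 / \<tau>) ?X)))
      = tadd (tscl (1 + \<tau>) ?B) (tscl (- 1) ?X)"
    using TL.regroup_linear[of ?B ?X "1 / \<tau>" "\<tau> * \<tau>" "- 1 / \<tau>"] tau_sq
    by (simp add: TL.run_props layer add.commute)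
  also have "\<dots> = TL.run ?w ?p"
    using jw_tensor_jw[of c] by simp
  finally have "TL.run ?w ?p = tadd (tscl (1 / \<tau>) ?X)
      (tscl (\<tau> * \<tau>) (TL.run ?w (?p @ [(1, cp c), ?f 0, ?f 0, (1, cu c)] @ ?p)))"
    unfolding T by simp
  then show "tcl (ident T2T2 [c, c]) = tcl (aplus T2T2 (ascale T2T2 (1 / \<tau>) (cmp T2T2 (coev T2T2 [c]) (ev T2T2 [c])))
     (ascale T2T2 (\<tau> * \<tau>) (cmp T2T2 (costar c) (trivalent c))))"
    by (simp add: fp_value TL.run_comp layer)
qed (simp_all add: fp_value)

section \<open>The strict category of words in a quotient\<close>

lemma (in linear_category) inverse_unique:
  assumes "is_inverse C f g" "is_inverse C f h" "f \<in> hom C X Y"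
  shows "g = h"
proof -
  have g: "g \<in> hom C Y X" "cmp C g f = ident C X" and h: "h \<in> hom C Y X" "cmp C f h = ident C Y"
    using assms unfolding is_inverse_def hom_def by auto
  have "g = cmp C g (cmp C f h)" using cmp_ident[OF g(1)] h by simp
  also have "\<dots> = h" using cmp_assoc[OF g(1) assms(3) h(1)] g(2) ident_cmp[OF h(1)] by simp
  finally show ?thesis .
qed

lemma (in linear_category) inverse_arr:
  assumes "iso C f" "f \<in> hom C X Y"
  shows "inverse_arr C f \<in> hom C Y X" "cmp C (inverse_arr C f) f = ident C X" "cmp C f (inverse_arr C f) = ident C Y"
proof -
  obtain g where g: "is_inverse C f g" using assms(1) by (auto simp: iso_def)
  have "inverse_arr C f = g"
    unfolding inverse_arr_def using g inverse_unique[OF _ g assms(2)] by (rule the_equality)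
  then show "inverse_arr C f \<in> hom C Y X" "cmp C (inverse_arr C f) f = ident C X" "cmp C f (inverse_arr C f) = ident C Y"
    using g assms(2) by (auto simp: is_inverse_def hom_def)
qed

lemma (in linear_category) cancel_iso:
  assumes "iso C f" "f \<in> hom C X Y" "g \<in> hom C Y Z" "h \<in> hom C Y Z" "cmp C g f = cmp C h f"
  shows "g = h"
proof -
  note i = inverse_arr[OF assms(1,2)]
  have "g = cmp C (cmp C g f) (inverse_arr C f)"
    using cmp_assoc[OF assms(3,2) i(1)] i(3) cmp_ident[OF assms(3)] by simp
  also have "\<dots> = h"
    unfolding assms(5) using cmp_assoc[OF assms(4,2) i(1)] i(3) cmp_ident[OF assms(4)] by simp
  finally show ?thesis .
qed

lemma (in linear_category) isoI:
  assumes "f \<in> hom C X Y" "g \<in> hom C Y X" "cmp C g f = ident C X" "cmp C f g = ident C Y"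
  shows "iso C f"
  using assms unfolding iso_def is_inverse_def hom_def by auto

lemma (in linear_category) cmp_iso:
  assumes "iso C f" "f \<in> hom C X Y" "iso C g" "g \<in> hom C Y Z"
  shows "iso C (cmp C g f)"
proof -
  note f = inverse_arr[OF assms(1,2)] and g = inverse_arr[OF assms(3,4)]
  show ?thesis
  proof (rule isoI)
    show 1: "cmp C g f \<in> hom C X Z" by (rule cmp_hom[OF assms(4,2)])
    show 2: "cmp C (inverse_arr C f) (inverse_arr C g) \<in> hom C Z X" by (rule cmp_hom[OF f(1) g(1)])
    have "cmp C (cmp C (inverse_arr C f) (inverse_arr C g)) (cmp C g f)
        = cmp C (inverse_arr C f) (cmp C (cmp C (inverse_arr C g) g) f)"
      using cmp_assoc[OF f(1) g(1) 1] cmp_assoc[OF g(1) assms(4,2)] by simp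
    then show "cmp C (cmp C (inverse_arr C f) (inverse_arr C g)) (cmp C g f) = ident C X"
      using f g ident_cmp[OF assms(2)] by simp
    have "cmp C (cmp C g f) (cmp C (inverse_arr C f) (inverse_arr C g))
        = cmp C g (cmp C (cmp C f (inverse_arr C f)) (inverse_arr C g))"
      using cmp_assoc[OF assms(4,2) 2] cmp_assoc[OF assms(2) f(1) g(1)] by simp
    then show "cmp C (cmp C g f) (cmp C (inverse_arr C f) (inverse_arr C g)) = ident C Z"
      using f g ident_cmp[OF g(1)] by simp
  qed
qed

lemma (in monoidal_category) tensor_iso:
  assumes "iso C f" "f \<in> hom C X Y" "iso C g" "g \<in> hom C X' Y'"
  shows "iso C (tarr C f g)"
proof -
  note f = inverse_arr[OF assms(1,2)] and g = inverse_arr[OF assms(3,4)]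
  have o: "X \<in> Obj C" "Y \<in> Obj C" "X' \<in> Obj C" "Y' \<in> Obj C"
    using assms dom_Obj cod_Obj by (auto simp: hom_def)
  show ?thesis
    by (rule isoI[OF tensor_hom[OF assms(2,4)] tensor_hom[OF f(1) g(1)]])
      (use f g o in \<open>simp_all add: tensor_cmp[OF f(1) assms(2) g(1) assms(4), symmetric]
        tensor_cmp[OF assms(2) f(1) assms(4) g(1), symmetric] tensor_ident\<close>)
qed

lemma (in linear_category) ident_iso: "X \<in> Obj C \<Longrightarrow> iso C (ident C X)"
  using isoI[OF ident_hom ident_hom] cmp_ident[OF ident_hom] by blast

text \<open>In a quotient \<open>F\<close>, a morphism \<open>F a \<rightarrow> F b\<close> is remembered together with the words \<open>a\<close> and \<open>b\<close>, which
\<open>F\<close> need not determine.  Tensor products are read through the structure isomorphisms of \<open>F\<close>, as in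
\<open>ftensor\<close>.\<close>

type_synonym 'q warr = "colour list \<times> colour list \<times> 'q"

locale free_product_quotient = unitary_quotient T2T2 D F
  for D :: "('p, 'q) pivotal_data" and F :: "(colour list, fp_arr, 'p, 'q) tensor_functor_data"
begin

definition H :: "colour list \<Rightarrow> colour list \<Rightarrow> 'q set" where
  "H a b = hom D (fobj F a) (fobj F b)"

lemma T2T2_simps [simp]: "Obj T2T2 = UNIV" "tobj T2T2 = (@)" "tunit T2T2 = []"
  by (simp_all add: T2T2_def)

lemma Fobj [simp]: "fobj F a \<in> Obj D"
  using fobj_Obj by simp

lemma mul_hom: "tmul F a b \<in> hom D (tobj D (fobj F a) (fobj F b)) (fobj F (a @ b))"
  using tmul_hom[of a b] by simp

lemma mul_iso: "iso D (tmul F a b)"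
  using tmul_iso[of a b] by simp

abbreviation ft where "ft a b c d f g \<equiv> ftensor D F a b c d f g"

lemma ft_hom: "f \<in> H a b \<Longrightarrow> g \<in> H c d \<Longrightarrow> ft a b c d f g \<in> H (a @ c) (b @ d)"
  unfolding H_def ftensor_def
  by (rule cmp_hom[OF mul_hom cmp_hom[OF tensor_hom inverse_arr(1)[OF mul_iso mul_hom]]])

lemma ft_mul: "f \<in> H a b \<Longrightarrow> g \<in> H c d \<Longrightarrow>
    cmp D (ft a b c d f g) (tmul F a c) = cmp D (tmul F b d) (tarr D f g)"
proof -
  assume "f \<in> H a b" "g \<in> H c d"
  then have t: "tarr D f g \<in> hom D (tobj D (fobj F a) (fobj F c)) (tobj D (fobj F b) (fobj F d))"
    unfolding H_def by (rule tensor_hom)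
  note i = inverse_arr[OF mul_iso mul_hom, of a c]
  note ti = cmp_hom[OF t i(1)]
  show ?thesis
    unfolding ftensor_def
    using cmp_assoc[OF mul_hom ti mul_hom] cmp_assoc[OF t i(1) mul_hom] i(2) cmp_ident[OF t] by simp
qed

text \<open>The product \<open>ft a b c d f g\<close> is the only morphism that corresponds to \<open>f \<otimes> g\<close> under the structure
isomorphisms.  All its properties are proved by checking this correspondence.\<close>

lemma ft_eqI:
  assumes "x \<in> H (a @ c) (b @ d)" "f \<in> H a b" "g \<in> H c d"
    "cmp D x (tmul F a c) = cmp D (tmul F b d) (tarr D f g)"
  shows "ft a b c d f g = x"
  using cancel_iso[OF mul_iso mul_hom _ _ HOL.trans[OF ft_mul[OF assms(2,3)] assms(4)[symmetric]]]
    assms(1) ft_hom[OF assms(2,3)] unfolding H_def by blast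

lemma one_hom: "ident D (fobj F a) \<in> H a a"
  unfolding H_def by (rule ident_hom) simp

lemma ft_one: "ft a a b b (ident D (fobj F a)) (ident D (fobj F b)) = ident D (fobj F (a @ b))"
  by (rule ft_eqI[OF one_hom one_hom one_hom])
    (simp add: tensor_ident cmp_ident[OF mul_hom] ident_cmp[OF mul_hom])

lemma ft_cmp:
  assumes "g \<in> H b c" "f \<in> H a b" "g' \<in> H b' c'" "f' \<in> H a' b'"
  shows "cmp D (ft b c b' c' g g') (ft a b a' b' f f') = ft a c a' c' (cmp D g f) (cmp D g' f')"
proof (rule ft_eqI[symmetric])
  note h = assms[unfolded H_def]
  show "cmp D (ft b c b' c' g g') (ft a b a' b' f f') \<in> H (a @ a') (c @ c')"
    using ft_hom[OF assms(1,3)] ft_hom[OF assms(2,4)] unfolding H_def by (rule cmp_hom)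
  show "cmp D g f \<in> H a c" "cmp D g' f' \<in> H a' c'"
    using h unfolding H_def by (auto intro: cmp_hom)
  have "cmp D (cmp D (ft b c b' c' g g') (ft a b a' b' f f')) (tmul F a a')
      = cmp D (ft b c b' c' g g') (cmp D (tmul F b b') (tarr D f f'))"
    using cmp_assoc[OF ft_hom[OF assms(1,3), unfolded H_def] ft_hom[OF assms(2,4), unfolded H_def] mul_hom]
      ft_mul[OF assms(2,4)] by simp
  also have "\<dots> = cmp D (cmp D (tmul F c c') (tarr D g g')) (tarr D f f')"
    using cmp_assoc[OF ft_hom[OF assms(1,3), unfolded H_def] mul_hom tensor_hom[OF h(2,4)]]
      ft_mul[OF assms(1,3)] by simp
  also have "\<dots> = cmp D (tmul F c c') (tarr D (cmp D g f) (cmp D g' f'))"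
    using cmp_assoc[OF mul_hom tensor_hom[OF h(1,3)] tensor_hom[OF h(2,4)]] tensor_cmp[OF h] by simp
  finally show "cmp D (cmp D (ft b c b' c' g g') (ft a b a' b' f f')) (tmul F a a')
      = cmp D (tmul F c c') (tarr D (cmp D g f) (cmp D g' f'))" .
qed

lemma mul_assoc:
  "cmp D (tmul F (a @ b) c) (tarr D (tmul F a b) (ident D (fobj F c)))
    = cmp D (tmul F a (b @ c)) (cmp D (tarr D (ident D (fobj F a)) (tmul F b c))
        (assoc D (fobj F a) (fobj F b) (fobj F c)))"
proof -
  have "assoc T2T2 a b c = ident T2T2 (a @ b @ c)" by (simp add: T2T2_def)
  then have "farr F (assoc T2T2 a b c) = ident D (fobj F ((a @ b) @ c))"
    using farr_ident[of "a @ b @ c"] by simp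
  moreover have "cmp D (tmul F (a @ b) c) (tarr D (tmul F a b) (ident D (fobj F c)))
      \<in> hom D (tobj D (tobj D (fobj F a) (fobj F b)) (fobj F c)) (fobj F ((a @ b) @ c))"
    by (intro cmp_hom[OF mul_hom] tensor_hom mul_hom ident_hom) simp
  ultimately show ?thesis
    using tmul_assoc[of a b c] ident_cmp by simp
qed

lemma mul_assoc_hom:
  "cmp D (tmul F (a @ b) c) (tarr D (tmul F a b) (ident D (fobj F c)))
      \<in> hom D (tobj D (tobj D (fobj F a) (fobj F b)) (fobj F c)) (fobj F (a @ b @ c))"
  "iso D (cmp D (tmul F (a @ b) c) (tarr D (tmul F a b) (ident D (fobj F c))))"
proof -
  have t: "tarr D (tmul F a b) (ident D (fobj F c))
      \<in> hom D (tobj D (tobj D (fobj F a) (fobj F b)) (fobj F c)) (tobj D (fobj F (a @ b)) (fobj F c))"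
    by (intro tensor_hom mul_hom ident_hom) simp
  show "cmp D (tmul F (a @ b) c) (tarr D (tmul F a b) (ident D (fobj F c)))
      \<in> hom D (tobj D (tobj D (fobj F a) (fobj F b)) (fobj F c)) (fobj F (a @ b @ c))"
    using cmp_hom[OF mul_hom t] by simp
  have "iso D (tarr D (tmul F a b) (ident D (fobj F c)))"
    by (rule tensor_iso[OF mul_iso mul_hom ident_iso ident_hom]) simp_all
  then show "iso D (cmp D (tmul F (a @ b) c) (tarr D (tmul F a b) (ident D (fobj F c))))"
    by (rule cmp_iso[OF _ t mul_iso mul_hom])
qed

text \<open>The associators of \<open>T2T2\<close> are identities, so the coherence of \<open>F\<close> says that the associator of \<open>D\<close> is
absorbed when a triple tensor product is identified with the image of a word.  Both sides therefore
correspond to the same morphism on the triple tensor product.\<close>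

lemma ft_assoc:
  assumes f: "f \<in> H a a'" and g: "g \<in> H b b'" and h: "h \<in> H c c'"
  shows "ft (a @ b) (a' @ b') c c' (ft a a' b b' f g) h = ft a a' (b @ c) (b' @ c') f (ft b b' c c' g h)"
    (is "?L = ?R")
proof -
  let ?i = "\<lambda>w. ident D (fobj F w)"
  let ?M = "\<lambda>a b c. cmp D (tmul F (a @ b) c) (tarr D (tmul F a b) (?i c))"
  let ?N = "\<lambda>a b c. cmp D (tmul F a (b @ c)) (tarr D (?i a) (tmul F b c))"
  let ?a = "\<lambda>a b c. assoc D (fobj F a) (fobj F b) (fobj F c)"
  note fh = f[unfolded H_def] and gh = g[unfolded H_def] and hh = h[unfolded H_def]
  have fg: "ft a a' b b' f g \<in> H (a @ b) (a' @ b')" and gh': "ft b b' c c' g h \<in> H (b @ c) (b' @ c')"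
    using ft_hom f g h by auto
  have L: "?L \<in> H (a @ b @ c) (a' @ b' @ c')" and R: "?R \<in> H (a @ b @ c) (a' @ b' @ c')"
    using ft_hom[OF fg h] ft_hom[OF f gh'] by simp_all
  have i: "?i w \<in> hom D (fobj F w) (fobj F w)" for w by (rule ident_hom) simp
  have tl: "tarr D (tmul F x y) (?i z) \<in> hom D (tobj D (tobj D (fobj F x) (fobj F y)) (fobj F z)) (tobj D (fobj F (x @ y)) (fobj F z))" for x y z
    by (rule tensor_hom[OF mul_hom i])
  have tr: "tarr D (?i x) (tmul F y z) \<in> hom D (tobj D (fobj F x) (tobj D (fobj F y) (fobj F z))) (tobj D (fobj F x) (fobj F (y @ z)))" for x y z
    by (rule tensor_hom[OF i mul_hom])
  have as: "?a x y z \<in> hom D (tobj D (tobj D (fobj F x) (fobj F y)) (fobj F z)) (tobj D (fobj F x) (tobj D (fobj F y) (fobj F z)))" for x y z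
    by (rule assoc_hom) simp_all
  have N: "?N x y z \<in> hom D (tobj D (fobj F x) (tobj D (fobj F y) (fobj F z))) (fobj F (x @ y @ z))" for x y z
    by (rule cmp_hom[OF mul_hom tr])
  have MN: "?M x y z = cmp D (?N x y z) (?a x y z)" for x y z
    using mul_assoc[of x y z] cmp_assoc[OF mul_hom tr as] by simp
  note m1 = mul_hom[of "a @ b" c, simplified]
  have "cmp D ?L (?M a b c) = cmp D (cmp D ?L (tmul F (a @ b) c)) (tarr D (tmul F a b) (?i c))"
    using cmp_assoc[OF L[unfolded H_def] m1 tl] by simp
  also have "\<dots> = cmp D (tmul F (a' @ b') c') (cmp D (tarr D (ft a a' b b' f g) h) (tarr D (tmul F a b) (?i c)))"
    unfolding ft_mul[OF fg h]
    by (rule cmp_assoc[OF mul_hom tensor_hom[OF fg[unfolded H_def] hh] tl])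
  also have "cmp D (tarr D (ft a a' b b' f g) h) (tarr D (tmul F a b) (?i c))
      = cmp D (tarr D (tmul F a' b') (?i c')) (tarr D (tarr D f g) h)"
    using tensor_cmp[OF fg[unfolded H_def] mul_hom hh i] tensor_cmp[OF mul_hom tensor_hom[OF fh gh] i hh]
      ft_mul[OF f g] cmp_ident[OF hh] ident_cmp[OF hh] by simp
  also have "cmp D (tmul F (a' @ b') c') \<dots> = cmp D (?M a' b' c') (tarr D (tarr D f g) h)"
    using cmp_assoc[OF mul_hom tl tensor_hom[OF tensor_hom[OF fh gh] hh]] by simp
  also have "\<dots> = cmp D (?N a' b' c') (cmp D (tarr D f (tarr D g h)) (?a a b c))"
    unfolding MN using cmp_assoc[OF N as tensor_hom[OF tensor_hom[OF fh gh] hh]]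
      assoc_natural[OF fh gh hh] by simp
  also have "\<dots> = cmp D (cmp D (?N a' b' c') (tarr D f (tarr D g h))) (?a a b c)"
    using cmp_assoc[OF N tensor_hom[OF fh tensor_hom[OF gh hh]] as] by simp
  also have "cmp D (?N a' b' c') (tarr D f (tarr D g h)) = cmp D ?R (?N a b c)"
  proof -
    have "cmp D (?N a' b' c') (tarr D f (tarr D g h))
        = cmp D (tmul F a' (b' @ c')) (cmp D (tarr D (?i a') (tmul F b' c')) (tarr D f (tarr D g h)))"
      by (rule cmp_assoc[OF mul_hom tr tensor_hom[OF fh tensor_hom[OF gh hh]]])
    also have "cmp D (tarr D (?i a') (tmul F b' c')) (tarr D f (tarr D g h))
        = cmp D (tarr D f (ft b b' c c' g h)) (tarr D (?i a) (tmul F b c))"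
      using tensor_cmp[OF i fh mul_hom tensor_hom[OF gh hh]] tensor_cmp[OF fh i gh'[unfolded H_def] mul_hom]
        ft_mul[OF g h] cmp_ident[OF fh] ident_cmp[OF fh] by simp
    also have "cmp D (tmul F a' (b' @ c')) \<dots> = cmp D (cmp D ?R (tmul F a (b @ c))) (tarr D (?i a) (tmul F b c))"
      unfolding ft_mul[OF f gh']
      using cmp_assoc[OF mul_hom tensor_hom[OF fh gh'[unfolded H_def]] tr] by simp
    also have "\<dots> = cmp D ?R (?N a b c)"
      by (rule cmp_assoc[OF R[unfolded H_def] mul_hom tr])
    finally show ?thesis .
  qed
  also have "cmp D (cmp D ?R (?N a b c)) (?a a b c) = cmp D ?R (?M a b c)"
    unfolding MN by (rule cmp_assoc[OF R[unfolded H_def] N as])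
  finally show ?thesis
    using cancel_iso[OF mul_assoc_hom(2,1) L[unfolded H_def] R[unfolded H_def]] by simp
qed

lemma one_iso: "tarr D (tone F) (ident D (fobj F a)) \<in> hom D (tobj D (tunit D) (fobj F a)) (tobj D (fobj F []) (fobj F a))"
  "iso D (tarr D (tone F) (ident D (fobj F a)))"
  "tarr D (ident D (fobj F a)) (tone F) \<in> hom D (tobj D (fobj F a) (tunit D)) (tobj D (fobj F a) (fobj F []))"
  "iso D (tarr D (ident D (fobj F a)) (tone F))"
  using tensor_hom[OF tone_hom ident_hom[OF Fobj]] tensor_hom[OF ident_hom[OF Fobj] tone_hom]
    tensor_iso[OF tone_iso tone_hom ident_iso[OF Fobj] ident_hom[OF Fobj]]
    tensor_iso[OF ident_iso[OF Fobj] ident_hom[OF Fobj] tone_iso tone_hom] by simp_all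

lemma mul_unit:
  "cmp D (tmul F [] a) (tarr D (tone F) (ident D (fobj F a))) = lunit D (fobj F a)"
  "cmp D (tmul F a []) (tarr D (ident D (fobj F a)) (tone F)) = runit D (fobj F a)"
proof -
  have l: "farr F (lunit T2T2 a) = ident D (fobj F a)" "farr F (runit T2T2 a) = ident D (fobj F a)"
    using farr_ident[of a] by (simp_all add: T2T2_def)
  show "cmp D (tmul F [] a) (tarr D (tone F) (ident D (fobj F a))) = lunit D (fobj F a)"
    using tmul_lunit[of a] ident_cmp[OF cmp_hom[OF mul_hom one_iso(1)]] l by simp
  show "cmp D (tmul F a []) (tarr D (ident D (fobj F a)) (tone F)) = runit D (fobj F a)"
    using tmul_runit[of a] ident_cmp[OF cmp_hom[OF mul_hom one_iso(3)]] l by simp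
qed

lemma ft_unit:
  assumes f: "f \<in> H a b"
  shows "ft [] [] a b (ident D (fobj F [])) f = f" "ft a b [] [] f (ident D (fobj F [])) = f"
proof -
  let ?i = "\<lambda>w. ident D (fobj F w)"
  note fh = f[unfolded H_def]
  have i: "?i w \<in> hom D (fobj F w) (fobj F w)" for w by (rule ident_hom) simp
  have u: "ident D (tunit D) \<in> hom D (tunit D) (tunit D)" by (rule ident_hom[OF unit_Obj])
  note t = tone_hom[simplified]
  show "ft [] [] a b (?i []) f = f"
  proof (rule ft_eqI)
    note m = mul_hom[of "[]", simplified]
    have "cmp D (cmp D f (tmul F [] a)) (tarr D (tone F) (?i a)) = cmp D f (lunit D (fobj F a))"
      using cmp_assoc[OF fh m one_iso(1)] mul_unit(1) by simp
    also have "\<dots> = cmp D (cmp D (tmul F [] b) (tarr D (tone F) (?i b))) (tarr D (ident D (tunit D)) f)"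
      unfolding mul_unit using lunit_natural[OF fh] by simp
    also have "\<dots> = cmp D (tmul F [] b) (cmp D (tarr D (tone F) (?i b)) (tarr D (ident D (tunit D)) f))"
      by (rule cmp_assoc[OF m one_iso(1) tensor_hom[OF u fh]])
    also have "cmp D (tarr D (tone F) (?i b)) (tarr D (ident D (tunit D)) f) = cmp D (tarr D (?i []) f) (tarr D (tone F) (?i a))"
      using tensor_cmp[OF t u i fh] tensor_cmp[OF i t fh i] cmp_ident[OF t] ident_cmp[OF t]
        cmp_ident[OF fh] ident_cmp[OF fh] by simp
    also have "cmp D (tmul F [] b) \<dots> = cmp D (cmp D (tmul F [] b) (tarr D (?i []) f)) (tarr D (tone F) (?i a))"
      using cmp_assoc[OF m tensor_hom[OF i fh] one_iso(1)] by simp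
    finally show "cmp D f (tmul F [] a) = cmp D (tmul F [] b) (tarr D (?i []) f)"
      by (rule cancel_iso[OF one_iso(2,1) cmp_hom[OF fh m] cmp_hom[OF m tensor_hom[OF i fh]]])
  qed (use f one_hom in simp_all)
  show "ft a b [] [] f (?i []) = f"
  proof (rule ft_eqI)
    note m = mul_hom[of _ "[]", simplified]
    have "cmp D (cmp D f (tmul F a [])) (tarr D (?i a) (tone F)) = cmp D f (runit D (fobj F a))"
      using cmp_assoc[OF fh m one_iso(3)] mul_unit(2) by simp
    also have "\<dots> = cmp D (cmp D (tmul F b []) (tarr D (?i b) (tone F))) (tarr D f (ident D (tunit D)))"
      unfolding mul_unit using runit_natural[OF fh] by simp
    also have "\<dots> = cmp D (tmul F b []) (cmp D (tarr D (?i b) (tone F)) (tarr D f (ident D (tunit D))))"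
      by (rule cmp_assoc[OF m one_iso(3) tensor_hom[OF fh u]])
    also have "cmp D (tarr D (?i b) (tone F)) (tarr D f (ident D (tunit D))) = cmp D (tarr D f (?i [])) (tarr D (?i a) (tone F))"
      using tensor_cmp[OF i fh t u] tensor_cmp[OF fh i i t] cmp_ident[OF t] ident_cmp[OF t]
        cmp_ident[OF fh] ident_cmp[OF fh] by simp
    also have "cmp D (tmul F b []) \<dots> = cmp D (cmp D (tmul F b []) (tarr D f (?i []))) (tarr D (?i a) (tone F))"
      using cmp_assoc[OF m tensor_hom[OF fh i] one_iso(3)] by simp
    finally show "cmp D f (tmul F a []) = cmp D (tmul F b []) (tarr D f (?i []))"
      by (rule cancel_iso[OF one_iso(4,3) cmp_hom[OF fh m] cmp_hom[OF m tensor_hom[OF fh i]]])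
  qed (use f one_hom in simp_all)
qed

end

definition wdm :: "'q warr \<Rightarrow> colour list" where "wdm x = fst x"
definition wcd :: "'q warr \<Rightarrow> colour list" where "wcd x = fst (snd x)"
definition wmor :: "'q warr \<Rightarrow> 'q" where "wmor x = snd (snd x)"

lemma warr_sel [simp]: "wdm (a, b, f) = a" "wcd (a, b, f) = b" "wmor (a, b, f) = f"
  by (simp_all add: wdm_def wcd_def wmor_def)

context free_product_quotient
begin

definition warr :: "'q warr \<Rightarrow> bool" where "warr x \<longleftrightarrow> wmor x \<in> H (wdm x) (wcd x)"
definition widn :: "colour list \<Rightarrow> 'q warr" where "widn w = (w, w, ident D (fobj F w))"
definition wcomp :: "'q warr \<Rightarrow> 'q warr \<Rightarrow> 'q warr" where
  "wcomp y x = (wdm x, wcd y, cmp D (wmor y) (wmor x))"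
definition wtens :: "'q warr \<Rightarrow> 'q warr \<Rightarrow> 'q warr" where
  "wtens x y = (wdm x @ wdm y, wcd x @ wcd y, ft (wdm x) (wcd x) (wdm y) (wcd y) (wmor x) (wmor y))"
definition wzero :: "colour list \<Rightarrow> colour list \<Rightarrow> 'q warr" where
  "wzero u v = (u, v, azero D (fobj F u) (fobj F v))"
definition wadd :: "'q warr \<Rightarrow> 'q warr \<Rightarrow> 'q warr" where
  "wadd x y = (wdm x, wcd x, aplus D (wmor x) (wmor y))"
definition wscl :: "complex \<Rightarrow> 'q warr \<Rightarrow> 'q warr" where
  "wscl a x = (wdm x, wcd x, ascale D a (wmor x))"
definition wstar :: "'q warr \<Rightarrow> 'q warr" where
  "wstar x = (wcd x, wdm x, star D (wmor x))"

lemmas w_defs = warr_def widn_def wcomp_def wtens_def wzero_def wadd_def wscl_def wstar_def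

lemma warr_iff [simp]: "warr (a, b, f) \<longleftrightarrow> f \<in> H a b"
  by (simp add: warr_def)

lemma H_cmp: "g \<in> H b c \<Longrightarrow> f \<in> H a b \<Longrightarrow> cmp D g f \<in> H a c"
  unfolding H_def by (rule cmp_hom)

lemma H_lin: "azero D (fobj F a) (fobj F b) \<in> H a b"
  "f \<in> H a b \<Longrightarrow> g \<in> H a b \<Longrightarrow> aplus D f g \<in> H a b" "f \<in> H a b \<Longrightarrow> ascale D z f \<in> H a b"
  unfolding H_def by (simp_all add: zero_hom plus_hom scale_hom)

lemma H_tensor: "f \<in> H a b \<Longrightarrow> g \<in> H c d \<Longrightarrow>
    tarr D f g \<in> hom D (tobj D (fobj F a) (fobj F c)) (tobj D (fobj F b) (fobj F d))"
  unfolding H_def by (rule tensor_hom)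

lemma ft_linear:
  assumes f: "f \<in> H a b" and g: "g \<in> H c d"
  shows "h \<in> H c d \<Longrightarrow> ft a b c d f (aplus D g h) = aplus D (ft a b c d f g) (ft a b c d f h)"
    and "h \<in> H a b \<Longrightarrow> ft a b c d (aplus D f h) g = aplus D (ft a b c d f g) (ft a b c d h g)"
    and "ft a b c d f (ascale D z g) = ascale D z (ft a b c d f g)"
    and "ft a b c d (ascale D z f) g = ascale D z (ft a b c d f g)"
proof -
  note fh = f[unfolded H_def] and gh = g[unfolded H_def]
  note fg = ft_hom[OF f g]
  show "ft a b c d f (aplus D g h) = aplus D (ft a b c d f g) (ft a b c d f h)" if h: "h \<in> H c d"
  proof (rule ft_eqI)
    note k = ft_hom[OF f h]
    show "cmp D (aplus D (ft a b c d f g) (ft a b c d f h)) (tmul F a c) = cmp D (tmul F b d) (tarr D f (aplus D g h))"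
      using plus_cmp[OF fg[unfolded H_def] k[unfolded H_def] mul_hom] ft_mul[OF f g] ft_mul[OF f h]
        tensor_plus[OF fh gh h[unfolded H_def]] cmp_plus[OF mul_hom H_tensor[OF f g] H_tensor[OF f h]] by simp
  qed (use f g h fg in \<open>simp_all add: H_lin ft_hom\<close>)
  show "ft a b c d (aplus D f h) g = aplus D (ft a b c d f g) (ft a b c d h g)" if h: "h \<in> H a b"
  proof (rule ft_eqI)
    note k = ft_hom[OF h g]
    show "cmp D (aplus D (ft a b c d f g) (ft a b c d h g)) (tmul F a c) = cmp D (tmul F b d) (tarr D (aplus D f h) g)"
      using plus_cmp[OF fg[unfolded H_def] k[unfolded H_def] mul_hom] ft_mul[OF f g] ft_mul[OF h g]
        plus_tensor[OF fh h[unfolded H_def] gh] cmp_plus[OF mul_hom H_tensor[OF f g] H_tensor[OF h g]] by simp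
  qed (use f g h fg in \<open>simp_all add: H_lin ft_hom\<close>)
  show "ft a b c d f (ascale D z g) = ascale D z (ft a b c d f g)"
    by (rule ft_eqI) (use f g fg in \<open>simp_all add: H_lin scale_cmp[OF fg[unfolded H_def] mul_hom] ft_mul
        tensor_scale[OF fh gh] cmp_scale[OF mul_hom H_tensor[OF f g]]\<close>)
  show "ft a b c d (ascale D z f) g = ascale D z (ft a b c d f g)"
    by (rule ft_eqI) (use f g fg in \<open>simp_all add: H_lin scale_cmp[OF fg[unfolded H_def] mul_hom] ft_mul
        scale_tensor[OF fh gh] cmp_scale[OF mul_hom H_tensor[OF f g]]\<close>)
qed

sublocale W: strict_linear_category warr wdm wcd widn wcomp wtens wzero wadd wscl
proof (unfold_locales, goal_cases)
  case (1 w) then show ?case by (simp add: w_defs one_hom)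
next
  case (4 g f) then show ?case by (auto simp: w_defs intro: H_cmp)
next
  case (7 f g) then show ?case by (auto simp: w_defs intro: ft_hom)
next
  case (10 u v) then show ?case by (simp add: w_defs H_lin)
next
  case (13 f g) then show ?case by (auto simp: w_defs intro: H_lin)
next
  case (16 f a) then show ?case by (auto simp: w_defs intro: H_lin)
next
  case (19 h g f) then show ?case by (auto simp: w_defs H_def cmp_assoc)
next
  case (20 f w) then show ?case by (cases f) (auto simp: w_defs H_def ident_cmp)
next
  case (21 f w) then show ?case by (cases f) (auto simp: w_defs H_def cmp_ident)
next
  case (22 f g h) then show ?case by (auto simp: w_defs ft_assoc)
next
  case (23 f) then show ?case by (cases f) (auto simp: w_defs ft_unit)
next
  case (24 f) then show ?case by (cases f) (auto simp: w_defs ft_unit)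
next
  case (25 u v) then show ?case by (simp add: w_defs ft_one)
next
  case (26 g f g' f') then show ?case by (auto simp: w_defs ft_cmp)
next
  case (27 f g h) then show ?case by (auto simp: w_defs H_def plus_assoc)
next
  case (28 f g) then show ?case by (auto simp: w_defs H_def plus_comm)
next
  case (29 f u v) then show ?case by (cases f) (auto simp: w_defs H_def plus_zero)
next
  case (30 f u v) then show ?case by (cases f) (auto simp: w_defs H_def plus_neg)
next
  case (31 f g a) then show ?case by (auto simp: w_defs H_def scale_plus)
next
  case (32 f a b) then show ?case by (auto simp: w_defs H_def plus_scale)
next
  case (33 f a b) then show ?case by (auto simp: w_defs H_def scale_scale)
next
  case (34 f) then show ?case by (cases f) (auto simp: w_defs H_def scale_one)
next
  case (35 h f g) then show ?case by (auto simp: w_defs H_def cmp_plus)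
next
  case (36 h f g) then show ?case by (auto simp: w_defs H_def plus_cmp)
next
  case (37 g f a) then show ?case by (auto simp: w_defs H_def cmp_scale)
next
  case (38 g f a) then show ?case by (auto simp: w_defs H_def scale_cmp)
next
  case (39 h f g) then show ?case by (auto simp: w_defs ft_linear(1))
next
  case (40 h f g) then show ?case by (auto simp: w_defs ft_linear(2))
next
  case (41 f g a) then show ?case by (auto simp: w_defs ft_linear(3))
next
  case (42 f g a) then show ?case by (auto simp: w_defs ft_linear(4))
qed (simp_all add: w_defs)

lemma H_Arr: "f \<in> H a b \<Longrightarrow> f \<in> Arr D" by (simp add: H_def hom_def)

lemma wstar_simps [simp]: "wdm (wstar x) = wcd x" "wcd (wstar x) = wdm x" "warr x \<Longrightarrow> warr (wstar x)"
  "warr x \<Longrightarrow> wstar (wstar x) = x"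
proof -
  show "wdm (wstar x) = wcd x" "wcd (wstar x) = wdm x" by (simp_all add: w_defs)
  show "warr x \<Longrightarrow> warr (wstar x)" by (simp add: w_defs H_def star_hom)
  show "warr x \<Longrightarrow> wstar (wstar x) = x"
    by (cases x) (simp add: w_defs star_star[OF H_Arr])
qed

lemma wstar_comp: "\<lbrakk>warr g; warr f; wdm g = wcd f\<rbrakk> \<Longrightarrow> wstar (wcomp g f) = wcomp (wstar f) (wstar g)"
  by (auto simp: w_defs H_def star_cmp)

lemma wstar_idn [simp]: "wstar (widn w) = widn w"
proof -
  let ?i = "ident D (fobj F w)"
  have i: "?i \<in> hom D (fobj F w) (fobj F w)" by (rule ident_hom) simp
  have "star D ?i = ?i"
    using ident_cmp[OF star_hom[OF i]] cmp_ident[OF star_hom[OF i]] star_cmp[OF star_hom[OF i] i]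
      star_star[of ?i] i by (simp add: hom_def)
  then show ?thesis by (simp add: w_defs)
qed

lemma wstar_scl: "warr f \<Longrightarrow> wstar (wscl a f) = wscl (cnj a) (wstar f)"
  by (simp add: w_defs star_scale[OF H_Arr])

lemma mul_star: "inverse_arr D (tmul F a b) = star D (tmul F a b)"
proof -
  have "is_inverse D (tmul F a b) (star D (tmul F a b))"
    using tmul_unitary[of a b] by (simp add: unitary_arr_def)
  then show ?thesis
    using inverse_unique[OF _ _ mul_hom] unfolding inverse_arr_def by blast
qed

lemma wstar_tens: "\<lbrakk>warr f; warr g\<rbrakk> \<Longrightarrow> wstar (wtens f g) = wtens (wstar f) (wstar g)"
proof -
  have "star D (ft a b c d f g) = ft b a d c (star D f) (star D g)" if f: "f \<in> H a b" and g: "g \<in> H c d" for a b c d f g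
  proof -
    note t = H_tensor[OF f g] and i = star_hom[OF mul_hom[of a c]]
    have "star D (ft a b c d f g) = cmp D (cmp D (star D (star D (tmul F a c))) (star D (tarr D f g))) (star D (tmul F b d))"
      unfolding ftensor_def mul_star
      using star_cmp[OF mul_hom cmp_hom[OF t i]] star_cmp[OF t i] by simp
    also have "star D (star D (tmul F a c)) = tmul F a c"
      using star_star mul_hom[of a c] by (simp add: hom_def)
    also have "star D (tarr D f g) = tarr D (star D f) (star D g)"
      by (rule star_tensor[OF H_Arr[OF f] H_Arr[OF g]])
    also have "cmp D (cmp D (tmul F a c) (tarr D (star D f) (star D g))) (star D (tmul F b d)) = ft b a d c (star D f) (star D g)"
      unfolding ftensor_def mul_star
      by (rule cmp_assoc[OF mul_hom tensor_hom[OF star_hom[OF f[unfolded H_def]] star_hom[OF g[unfolded H_def]]]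
            star_hom[OF mul_hom]])
    finally show ?thesis .
  qed
  then show "\<lbrakk>warr f; warr g\<rbrakk> \<Longrightarrow> wstar (wtens f g) = wtens (wstar f) (wstar g)"
    by (auto simp: w_defs)
qed

definition layers_star :: "(nat \<times> 'q warr) list \<Rightarrow> (nat \<times> 'q warr) list" where
  "layers_star ls = rev (map (\<lambda>(i, g). (i, wstar g)) ls)"

lemma layers_star_simps [simp]: "layers_star [] = []" "layers_star ((i, g) # ls) = layers_star ls @ [(i, wstar g)]"
  by (simp_all add: layers_star_def)

text \<open>The adjoint of a diagram is its reflection: the layers are reversed and replaced by their adjoints,
while positions are kept.\<close>

lemma run_star: "W.ok w ls \<Longrightarrow> wstar (W.run w ls) = W.run (W.tgt w ls) (layers_star ls)
    \<and> W.ok (W.tgt w ls) (layers_star ls) \<and> W.tgt (W.tgt w ls) (layers_star ls) = w"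
proof (induction ls arbitrary: w)
  case (Cons l ls)
  obtain i g where l: "l = (i, g)" by (cases l)
  have f: "W.fits i g w" and k: "W.ok (W.act i g w) ls" using Cons.prems l by auto
  note IH = Cons.IH[OF k]
  obtain u v where w: "w = u @ wdm g @ v" and i: "i = length u" and g: "warr g" using f by (elim W.fitsE)
  have a: "W.act i g w = u @ wcd (wstar (wstar g)) @ v" "W.act i g w = u @ wdm (wstar g) @ v" using g by (simp_all add: w i)
  have s: "W.fits i (wstar g) (W.act i g w)" "W.act i (wstar g) (W.act i g w) = w"
    "W.wh i (wstar g) (W.act i g w) = wstar (W.wh i g w)"
    unfolding a(2) i using W.fits_mid[of "wstar g" u v] W.act_mid[of u "wstar g" v] W.wh_mid[of u "wstar g" v] g
    by (simp_all add: w wstar_tens)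
  have "wstar (W.run w (l # ls)) = wcomp (wstar (W.wh i g w)) (wstar (W.run (W.act i g w) ls))"
    using f k l by (simp add: wstar_comp W.run_props W.wh_props W.run.simps)
  also have "\<dots> = W.run (W.tgt w (l # ls)) (layers_star (l # ls))"
    using IH s l W.wh_props[OF f] by (simp add: W.run_append W.run.simps W.idn_comp)
  finally show ?case using IH s l by simp
qed (simp add: W.run.simps)

lemma rel_star: "W.rel w c xs ys \<Longrightarrow> W.rel (W.tgt w xs) (cnj c) (layers_star xs) (layers_star ys)"
  using run_star[of w xs] run_star[of w ys] W.rel_tgt[of w c xs ys] unfolding W.rel_def
  by (auto simp: wstar_scl W.run_props)

definition lift :: "fp_arr \<Rightarrow> 'q warr" where "lift x = (src x, tgt x, farr F x)"

lemma lift_simps [simp]: "wdm (lift x) = src x" "wcd (lift x) = tgt x" "x \<in> Arr T2T2 \<Longrightarrow> warr (lift x)"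
  using farr_hom[of x "src x" "tgt x"] by (simp_all add: lift_def T2T2_hom H_def)

lemma lift_cmp: "\<lbrakk>g \<in> Arr T2T2; f \<in> Arr T2T2; src g = tgt f\<rbrakk> \<Longrightarrow> lift (cmp T2T2 g f) = wcomp (lift g) (lift f)"
  using farr_cmp[of g "tgt f" "tgt g" f "src f"] by (simp add: lift_def w_defs tcl_cmp T2T2_hom)

lemma lift_ident: "lift (ident T2T2 w) = widn w"
  using farr_ident[of w] by (simp add: lift_def w_defs tcl_ident)

lemma lift_scale: "f \<in> Arr T2T2 \<Longrightarrow> lift (ascale T2T2 a f) = wscl a (lift f)"
  by (simp add: lift_def w_defs tcl_ascale farr_scale)

lemma lift_plus: "\<lbrakk>g \<in> Arr T2T2; f \<in> Arr T2T2; src g = src f; tgt g = tgt f\<rbrakk>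
    \<Longrightarrow> lift (aplus T2T2 g f) = wadd (lift g) (lift f)"
  using farr_plus[of g "src f" "tgt f" f] by (simp add: lift_def w_defs tcl_aplus T2T2_hom)

lemma lift_tensor: "\<lbrakk>g \<in> Arr T2T2; f \<in> Arr T2T2\<rbrakk> \<Longrightarrow> lift (tarr T2T2 g f) = wtens (lift g) (lift f)"
proof -
  assume a: "g \<in> Arr T2T2" "f \<in> Arr T2T2"
  have h: "farr F g \<in> H (src g) (tgt g)" "farr F f \<in> H (src f) (tgt f)"
    using lift_simps(3)[OF a(1)] lift_simps(3)[OF a(2)] by (simp_all add: lift_def)
  have t: "farr F (tarr T2T2 g f) \<in> H (src g @ src f) (tgt g @ tgt f)"
    using lift_simps(3)[OF tcl_tarr(1)[OF a]] tcl_tarr(2,3)[OF a] by (simp add: lift_def)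
  have "ft (src g) (tgt g) (src f) (tgt f) (farr F g) (farr F f) = farr F (tarr T2T2 g f)"
    by (rule ft_eqI[OF t h])
      (use tmul_natural[of g "src g" "tgt g" f "src f" "tgt f"] a in \<open>simp add: T2T2_hom\<close>)
  then show ?thesis using a by (simp add: lift_def w_defs tcl_tarr)
qed

definition ca :: "colour \<Rightarrow> 'q warr" where "ca c = lift (ev T2T2 [c])"
definition co :: "colour \<Rightarrow> 'q warr" where "co c = lift (coev T2T2 [c])"
definition tv :: "colour \<Rightarrow> 'q warr" where "tv c = lift (trivalent c)"
definition vt :: "colour \<Rightarrow> 'q warr" where "vt c = lift (star T2T2 (trivalent c))"

lemma letter_warr [simp]:
  "warr (ca c)" "wdm (ca c) = [c, c]" "wcd (ca c) = []"
  "warr (co c)" "wdm (co c) = []" "wcd (co c) = [c, c]"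
  "warr (tv c)" "wdm (tv c) = [c, c]" "wcd (tv c) = [c]"
  "warr (vt c)" "wdm (vt c) = [c]" "wcd (vt c) = [c, c]"
  by (simp_all add: ca_def co_def tv_def vt_def fp_letter)

lemma lift_star: "f \<in> Arr T2T2 \<Longrightarrow> src (star T2T2 f) = tgt f \<Longrightarrow> tgt (star T2T2 f) = src f
    \<Longrightarrow> lift (star T2T2 f) = wstar (lift f)"
  by (simp add: lift_def w_defs farr_star)

lemma letter_star [simp]: "wstar (co c) = ca c" "wstar (ca c) = co c" "wstar (tv c) = vt c" "wstar (vt c) = tv c"
proof -
  show 1: "wstar (co c) = ca c" unfolding co_def ca_def
    using lift_star[OF coev_letter(1)] by (simp add: coev_letter(5) fp_letter)
  show 2: "wstar (tv c) = vt c" unfolding tv_def vt_def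
    using lift_star[OF trivalent_letter(1)] by (simp add: fp_letter)
  show "wstar (ca c) = co c" using arg_cong[OF 1, of wstar] by simp
  show "wstar (vt c) = tv c" using arg_cong[OF 2, of wstar] by simp
qed

lemmas wlayer = W.fits_def W.act_def W.nf_def
lemmas wrun = W.run.simps W.wh_def W.act_def W.idn_tens W.tens_idn W.idn_comp W.comp_idn W.idn_tens_idn W.comp_assoc

lemma letter_relations:
  "W.rel [c] 1 [(1, co c), (0, ca c)] []"
  "W.rel [c] 1 [(0, co c), (1, ca c)] []"
  "W.rel [] \<tau> [(0, co c), (0, ca c)] []"
  "W.rel [c, c] 1 [(1, vt c), (0, ca c)] [(0, tv c)]"
  "W.rel [c, c] 1 [(0, vt c), (1, ca c)] [(0, tv c)]"
proof -
  note s = letter_zigzag_left[of c, THEN arg_cong, of lift] letter_zigzag_right[of c, THEN arg_cong, of lift]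
    letter_loop[of c, THEN arg_cong, of lift] trivalent_rotation_left[of c, THEN arg_cong, of lift]
    trivalent_rotation_right[of c, THEN arg_cong, of lift]
  show "W.rel [c] 1 [(1, co c), (0, ca c)] []" "W.rel [c] 1 [(0, co c), (1, ca c)] []"
    "W.rel [] \<tau> [(0, co c), (0, ca c)] []" "W.rel [c, c] 1 [(1, vt c), (0, ca c)] [(0, tv c)]"
    "W.rel [c, c] 1 [(0, vt c), (1, ca c)] [(0, tv c)]"
    using s by (simp_all add: W.rel_def wlayer wrun W.scl_one lift_cmp lift_tensor lift_scale lift_ident tcl_tarr fp_letter
      ca_def[symmetric] co_def[symmetric] tv_def[symmetric] vt_def[symmetric])
qed

lemmas zigzag_left = letter_relations(1) and zigzag_right = letter_relations(2) and loop_value = letter_relations(3)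
  and rotate_left = letter_relations(4) and rotate_right = letter_relations(5)

lemma word_decomposition: "widn [c, c] = wadd (wscl (1 / \<tau>) (wcomp (co c) (ca c))) (wscl (\<tau> * \<tau>) (wcomp (vt c) (tv c)))"
  using letter_decomposition[of c, THEN arg_cong, of lift]
  by (simp add: lift_plus lift_cmp lift_scale lift_ident tcl_cmp tcl_ascale fp_letter
      ca_def[symmetric] co_def[symmetric] tv_def[symmetric] vt_def[symmetric])

end

section \<open>Scalars and positivity\<close>

lemma (in strict_linear_category) solve_scalar:
  assumes "add (scl a I) (scl b X) = scl c I" "b \<noteq> 0" "arr I" "arr X" "dm X = dm I" "cd X = cd I"
  shows "X = scl ((c - a) / b) I"
proof -
  have "add (scl a I) (scl b X) = add (scl a I) (scl (c - a) I)"
    using assms add_scl[of I a "c - a"] by simp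
  then have "scl b X = scl (c - a) I"
    by (rule add_cancel_left) (use assms in auto)
  then have "scl (1 / b) (scl b X) = scl (1 / b) (scl (c - a) I)" by simp
  then show ?thesis using assms by (simp add: scl_scl scl_one)
qed

context free_product_quotient
begin

declare W.run.simps [simp del]

lemma wstar_add: "\<lbrakk>warr f; warr g; wdm f = wdm g; wcd f = wcd g\<rbrakk> \<Longrightarrow> wstar (wadd f g) = wadd (wstar f) (wstar g)"
  by (auto simp: w_defs H_def star_plus)

lemma warr_eqI: "\<lbrakk>wdm x = wdm y; wcd x = wcd y; wmor x = wmor y\<rbrakk> \<Longrightarrow> x = y"
  by (simp add: wdm_def wcd_def wmor_def prod_eq_iff)

lemma unit_endo:
  assumes "f \<in> H [] []"
  shows "\<exists>a. f = ascale D a (ident D (fobj F []))"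
proof -
  note t = tone_hom[simplified] and i = inverse_arr[OF tone_iso tone_hom, simplified]
  note f = assms[unfolded H_def]
  have one: "ident D (fobj F []) \<in> hom D (fobj F []) (fobj F [])" by (rule ident_hom) simp
  have k: "cmp D (inverse_arr D (tone F)) (cmp D f (tone F)) \<in> hom D (tunit D) (tunit D)"
    by (rule cmp_hom[OF i(1) cmp_hom[OF f t]])
  then obtain a where a: "cmp D (inverse_arr D (tone F)) (cmp D f (tone F)) = ascale D a (ident D (tunit D))"
    using unit_simple by blast
  have "cmp D f (tone F) = cmp D (cmp D (tone F) (inverse_arr D (tone F))) (cmp D f (tone F))"
    using i(3) ident_cmp[OF cmp_hom[OF f t]] by simp
  also have "\<dots> = cmp D (tone F) (ascale D a (ident D (tunit D)))"
    using cmp_assoc[OF t i(1) cmp_hom[OF f t]] a by simp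
  also have "\<dots> = cmp D (ascale D a (ident D (fobj F []))) (tone F)"
    using cmp_scale[OF t ident_hom[OF unit_Obj]] cmp_ident[OF t] scale_cmp[OF one t] ident_cmp[OF t] by simp
  finally show ?thesis
    using cancel_iso[OF tone_iso tone_hom, simplified, OF f scale_hom[OF one]] by blast
qed

lemma unit_scalar:
  assumes "warr x" "wdm x = []" "wcd x = []"
  obtains a where "x = wscl a (widn [])"
  using assms unit_endo[of "wmor x"] that
  by (metis warr_def w_defs(2,7) warr_eqI warr_sel)

lemma unit_nontrivial: "widn [] \<noteq> wzero [] []"
proof
  assume "widn [] = wzero [] []"
  then have e: "ident D (fobj F []) = azero D (fobj F []) (fobj F [])" by (simp add: w_defs)
  note t = tone_hom[simplified] and i = inverse_arr[OF tone_iso tone_hom, simplified]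
  have one: "ident D (fobj F []) \<in> hom D (fobj F []) (fobj F [])" by (rule ident_hom) simp
  have neg: "aplus D f (ascale D (- 1) f) = ascale D 0 f" if "f \<in> hom D X Y" for f X Y
    using plus_scale[OF that, of 1 "- 1"] scale_one[OF that] by simp
  have z: "ascale D 0 f = azero D X Y" if "f \<in> hom D X Y" for f X Y
    using neg[OF that] plus_neg[OF that] by simp
  have "ident D (fobj F []) = ascale D 0 (ident D (fobj F []))" using e z[OF one] by simp
  then have "tone F = ascale D 0 (tone F)"
    using ident_cmp[OF t] scale_cmp[OF one t, of 0] by simp
  then have "ident D (tunit D) = ascale D 0 (ident D (tunit D))"
    using i(2) cmp_scale[OF i(1) t, of 0] by simp
  then show False using z[OF ident_hom[OF unit_Obj]] unit_nonzero by simp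
qed

lemma unit_scalar_inj: "wscl a (widn []) = wscl b (widn []) \<Longrightarrow> a = b"
proof (rule ccontr)
  assume e: "wscl a (widn []) = wscl b (widn [])" and n: "a \<noteq> b"
  have "wadd (wscl a (widn [])) (wscl (- b) (widn [])) = wadd (wscl b (widn [])) (wscl (- b) (widn []))"
    using e by simp
  then have "wscl (a - b) (widn []) = wscl 0 (widn [])"
    using W.add_scl[of "widn []" a "- b"] W.add_scl[of "widn []" b "- b"] by simp
  then have "wscl (1 / (a - b)) (wscl (a - b) (widn [])) = wscl (1 / (a - b)) (wscl 0 (widn []))" by simp
  then have "widn [] = wscl 0 (widn [])" using n by (simp add: W.scl_scl W.scl_one)
  then show False using W.scl_zero_left[of "widn []" "[]" "[]"] unit_nontrivial by simp
qed

text \<open>Closing the first letter of an identity to a loop gives \<open>\<tau>\<close> times the identity of the rest of the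
word.  Repeating this leads to the unit object, where scalars are determined.\<close>

lemma word_scalar_inj: "wscl a (widn w) = wscl b (widn w) \<Longrightarrow> a = b"
proof (induction w arbitrary: a b)
  case Nil
  then show ?case by (rule unit_scalar_inj)
next
  case (Cons c w)
  let ?\<Phi> = "\<lambda>g. wcomp (wtens (ca c) (widn w)) (wcomp (wtens (widn [c]) g) (wtens (co c) (widn w)))"
  have "?\<Phi> (wscl a (widn (c # w))) = wscl (a * \<tau>) (widn w)" for a
  proof -
    have "?\<Phi> (wscl a (widn (c # w))) = wscl a (wcomp (wtens (ca c) (widn w)) (wtens (co c) (widn w)))"
      by (simp add: W.tens_scl W.comp_scl W.scl_comp W.idn_tens_idn W.idn_comp)
    also have "wcomp (wtens (ca c) (widn w)) (wtens (co c) (widn w)) = wtens (W.run [] [(0, co c), (0, ca c)]) (widn w)"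
      by (simp add: wrun W.interchange)
    also have "\<dots> = wscl \<tau> (widn w)"
      using loop_value[of c] by (simp add: W.rel_def W.run.simps W.scl_tens W.idn_tens_idn)
    finally show ?thesis by (simp add: W.scl_scl)
  qed
  then have "wscl (a * \<tau>) (widn w) = wscl (b * \<tau>) (widn w)" using Cons.prems by metis
  then have "a * \<tau> = b * \<tau>" by (rule Cons.IH)
  then show ?case using tau_nz by simp
qed

text \<open>The positivity axiom gives \<open>x\<^sup>* x = g\<^sup>* g\<close> for an endomorphism \<open>g\<close> of the unit, which is a scalar \<open>a\<close>; so
the value is \<open>\<bar>a\<bar>\<^sup>2\<close>.\<close>

lemma positive:
  assumes "warr x" "wdm x = []"
  obtains r :: real where "r \<ge> 0" "wcomp (wstar x) x = wscl (complex_of_real r) (widn [])"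
proof -
  obtain b f where x: "x = ([], b, f)" and f: "f \<in> H [] b" using assms by (cases x) auto
  obtain g where g: "g \<in> H [] []" "cmp D (star D f) f = cmp D (star D g) g"
    using star_positive f unfolding H_def by blast
  let ?g = "([], [], g) :: 'q warr"
  obtain a where a: "?g = wscl a (widn [])" using unit_scalar[of ?g] g by auto
  have "wcomp (wstar x) x = wcomp (wstar ?g) ?g" using x g(2) by (simp add: w_defs)
  also have "\<dots> = wscl (cnj a * a) (widn [])"
    unfolding a by (simp add: wstar_scl W.scl_comp W.comp_scl W.idn_comp W.scl_scl mult.commute)
  also have "cnj a * a = complex_of_real ((cmod a)\<^sup>2)"
    using complex_norm_square[of a] by (simp add: mult.commute)
  finally show ?thesis using that[of "(cmod a)\<^sup>2"] by simp
qed

lemma definite: "\<lbrakk>warr x; wcomp (wstar x) x = wzero (wdm x) (wdm x)\<rbrakk> \<Longrightarrow> x = wzero (wdm x) (wcd x)"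
  using star_definite[of "wmor x" "fobj F (wdm x)" "fobj F (wcd x)"]
  by (cases x) (simp add: w_defs H_def)

text \<open>Two neighbouring copies of a letter inside a diagram may be cut according to \<open>cc = 1 \<oplus> c\<close>.\<close>

lemma expand_id:
  assumes "W.ok w (pre @ post)" "W.tgt w pre = u @ [c, c] @ v" "i = length u"
  shows "W.run w (pre @ post) = wadd (wscl (1 / \<tau>) (W.run w (pre @ [(i, ca c), (i, co c)] @ post)))
      (wscl (\<tau> * \<tau>) (W.run w (pre @ [(i, tv c), (i, vt c)] @ post)))"
    and "W.ok w (pre @ [(i, ca c), (i, co c)] @ post)" "W.ok w (pre @ [(i, tv c), (i, vt c)] @ post)"
proof -
  have fit: "W.fits i (ca c) (W.tgt w pre)" "W.fits i (tv c) (W.tgt w pre)" "W.fits i (widn [c, c]) (W.tgt w pre)"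
    using assms(2,3) by (simp_all add: W.fits_def)
  have a: "W.act i (ca c) (W.tgt w pre) = u @ v" "W.act i (co c) (u @ v) = W.tgt w pre"
    "W.act i (tv c) (W.tgt w pre) = u @ [c] @ v" "W.act i (vt c) (u @ [c] @ v) = W.tgt w pre"
    "W.act i (widn [c, c]) (W.tgt w pre) = W.tgt w pre"
    using assms(2,3) by (simp_all add: W.act_def)
  have fit': "W.fits i (co c) (u @ v)" "W.fits i (vt c) (u @ [c] @ v)"
    using assms(3) by (simp_all add: W.fits_def)
  show o: "W.ok w (pre @ [(i, ca c), (i, co c)] @ post)" "W.ok w (pre @ [(i, tv c), (i, vt c)] @ post)"
    using assms(1) fit fit' a by simp_all
  have h: "W.wh i (widn [c, c]) (W.tgt w pre) = widn (W.tgt w pre)"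
    using assms(2,3) by (simp add: W.wh_def W.idn_tens_idn)
  have 1: "W.run w (pre @ (i, widn [c, c]) # post) = W.run w (pre @ post)" "W.ok w (pre @ (i, widn [c, c]) # post)"
    using assms(1) fit(3) a(5) h by (simp_all add: W.run_append W.run.simps W.comp_idn W.run_props)
  let ?X = "W.run [c, c] [(0, ca c), (0, co c)]" and ?Y = "W.run [c, c] [(0, tv c), (0, vt c)]"
  have d: "widn [c, c] = wadd (wscl (1 / \<tau>) ?X) (wscl (\<tau> * \<tau>) ?Y)"
  proof -
    have "?X = wcomp (co c) (ca c)" "?Y = wcomp (vt c) (tv c)" by (simp_all add: wrun)
    then show ?thesis using word_decomposition[of c] by metis
  qed
  have oX: "W.ok [c, c] [(0, ca c), (0, co c)]" "W.ok [c, c] [(0, tv c), (0, vt c)]"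
    by (simp_all add: wlayer)
  have 2: "W.ok w (pre @ (i, ?X) # post)" "W.ok w (pre @ (i, ?Y) # post)"
    using assms fit a W.run_props[OF oX(1)] W.run_props[OF oX(2)] by (auto simp: W.fits_def W.act_def)
  have 3: "W.ok w (pre @ (i, wscl (1 / \<tau>) ?X) # post)"
    using 2 by (auto simp: W.fits_def W.act_def)
  have "W.run w (pre @ (i, widn [c, c]) # post)
      = wadd (W.run w (pre @ (i, wscl (1 / \<tau>) ?X) # post)) (W.run w (pre @ (i, wscl (\<tau> * \<tau>) ?Y) # post))"
    unfolding d using W.run_add[OF 3, of "wscl (\<tau> * \<tau>) ?Y"] W.run_props[OF oX(1)] W.run_props[OF oX(2)]
    by (simp add: W.act_def)
  then show "W.run w (pre @ post) = wadd (wscl (1 / \<tau>) (W.run w (pre @ [(i, ca c), (i, co c)] @ post)))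
      (wscl (\<tau> * \<tau>) (W.run w (pre @ [(i, tv c), (i, vt c)] @ post)))"
    unfolding 1 W.run_scl[OF 2(1)] W.run_scl[OF 2(2)] W.run_flatten(2)[OF oX(1) 2(1)] W.run_flatten(2)[OF oX(2) 2(2)]
    by simp
qed

text \<open>A relation between diagrams that start at a word containing \<open>cc\<close> may be tested on the two summands
\<open>1\<close> and \<open>c\<close> of \<open>cc\<close>.\<close>

lemma split_rel:
  assumes w: "w = u @ [c, c] @ v" "i = length u" and o: "W.ok w xs" "W.ok w ys" "W.tgt w xs = W.tgt w ys"
    and 1: "W.rel (u @ v) k ((i, co c) # xs) ((i, co c) # ys)"
    and 2: "W.rel (u @ [c] @ v) k ((i, vt c) # xs) ((i, vt c) # ys)"
  shows "W.rel w k xs ys"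
proof -
  note ex = expand_id[of w "[]" xs u c v i, simplified] expand_id[of w "[]" ys u c v i, simplified]
  have oo: "W.ok w ([(i, ca c)] @ (i, co c) # xs)" "W.ok w ([(i, tv c)] @ (i, vt c) # xs)"
    using ex(2,3) o w by simp_all
  have "W.act i (ca c) w = u @ v" "W.act i (tv c) w = u @ [c] @ v" using w by (simp_all add: W.act_def)
  then have R1: "W.rel w k ([(i, ca c)] @ ((i, co c) # xs) @ []) ([(i, ca c)] @ ((i, co c) # ys) @ [])"
    and R2: "W.rel w k ([(i, tv c)] @ ((i, vt c) # xs) @ []) ([(i, tv c)] @ ((i, vt c) # ys) @ [])"
    using 1 2 oo by (intro W.rel_append; simp)+
  have t: "W.tgt w ((i, ca c) # (i, co c) # ys) = W.tgt w ys" "W.tgt w ((i, tv c) # (i, vt c) # ys) = W.tgt w ys"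
    using w by (simp_all add: W.act_def)
  have "W.run w xs = wscl k (W.run w ys)"
    using ex(1) ex(4) o w R1 R2 t unfolding W.rel_def
    by (simp add: W.scl_add W.scl_scl W.run_props mult.commute del: W.ok.simps W.tgt.simps)
  then show ?thesis using o by (simp add: W.rel_def)
qed

text \<open>Close the right strand of the decomposition of \<open>cc\<close>.  A loop of value \<open>\<tau>\<close> is equal to \<open>\<tau>\<^sup>-\<^sup>1\<close> plus \<open>\<tau>\<^sup>2\<close>
times the bubble, because rotation turns the closed vertices into a bubble.  Finally
\<open>\<tau> - \<tau>\<^sup>-\<^sup>1 = 1\<close>.\<close>

lemma vertex_bubble: "W.rel [c] (1 / (\<tau> * \<tau>)) [(0, vt c), (0, tv c)] []"
proof -
  have rot: "W.rel [c] 1 [(1, co c), (0, tv c)] [(0, vt c)]"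
    using rel_star[OF rotate_right[of c]] by (simp add: wlayer)
  have A: "W.rel [c] \<tau> [(1, co c), (1, ca c)] []"
    by (rule W.rel_at[OF loop_value, of _ "[]" 1 "[]"]) (simp_all add: wlayer)
  have "W.rel [c] 1 [(1, co c), (0, ca c), (0, co c), (1, ca c)] [(0, co c), (1, ca c)]"
    by (rule W.rel_at[OF zigzag_left, of _ "[]" 0 "[(0, co c), (1, ca c)]"]) (simp_all add: wlayer)
  also note zigzag_right
  finally have B: "W.rel [c] 1 [(1, co c), (0, ca c), (0, co c), (1, ca c)] []" by simp
  have "W.rel [c] 1 [(1, co c), (0, tv c), (0, vt c), (1, ca c)] [(0, vt c), (0, vt c), (1, ca c)]"
    by (rule W.rel_at[OF rot, of _ "[]" 0 "[(0, vt c), (1, ca c)]"]) (simp_all add: wlayer)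
  also have "W.rel [c] 1 \<dots> [(0, vt c), (0, tv c)]"
    by (rule W.rel_at[OF rotate_right, of _ "[(0, vt c)]" 0 "[]"]) (simp_all add: wlayer)
  finally have C: "W.run [c] [(1, co c), (0, tv c), (0, vt c), (1, ca c)] = W.run [c] [(0, vt c), (0, tv c)]"
    by (auto dest!: W.rel_run)
  have "W.run [c] [(1, co c), (1, ca c)] = wadd (wscl (1 / \<tau>) (W.run [c] [(1, co c), (0, ca c), (0, co c), (1, ca c)]))
      (wscl (\<tau> * \<tau>) (W.run [c] [(1, co c), (0, tv c), (0, vt c), (1, ca c)]))"
    using expand_id(1)[of "[c]" "[(1, co c)]" "[(1, ca c)]" "[]" c "[c]" 0] by (simp add: wlayer)
  then have "wadd (wscl (1 / \<tau>) (W.run [c] [])) (wscl (\<tau> * \<tau>) (W.run [c] [(0, vt c), (0, tv c)])) = wscl \<tau> (W.run [c] [])"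
    using A B unfolding C by (simp add: W.rel_def W.scl_one W.run_props)
  then have "W.run [c] [(0, vt c), (0, tv c)] = wscl ((\<tau> - 1 / \<tau>) / (\<tau> * \<tau>)) (W.run [c] [])"
    by (rule W.solve_scalar) (use tau_nz in \<open>simp_all add: W.run_props wlayer\<close>)
  moreover have "\<tau> - 1 / \<tau> = 1" using tau_nz tau_sq by (simp add: field_simps)
  ultimately show ?thesis by (simp add: W.rel_def wlayer)
qed

text \<open>In the decomposition of \<open>cc\<close> the first summand already reproduces the cup.  So the second one
annihilates it, and the bubble strips off the superfluous vertex.\<close>

lemma vertex_cup: "W.rel [] 0 [(0, co c), (0, tv c)] [(0, co c), (0, tv c)]"
proof -
  have A: "W.rel [] \<tau> [(0, co c), (0, ca c), (0, co c)] [(0, co c)]"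
    by (rule W.rel_at[OF loop_value, of _ "[]" 0 "[(0, co c)]"]) (simp_all add: wlayer)
  have "W.run [] [(0, co c)] = wadd (wscl (1 / \<tau>) (W.run [] [(0, co c), (0, ca c), (0, co c)]))
      (wscl (\<tau> * \<tau>) (W.run [] [(0, co c), (0, tv c), (0, vt c)]))"
    using expand_id(1)[of "[]" "[(0, co c)]" "[]" "[]" c "[]" 0] by (simp add: wlayer)
  moreover have "wscl (1 / \<tau>) (W.run [] [(0, co c), (0, ca c), (0, co c)]) = wscl 1 (W.run [] [(0, co c)])"
    using A tau_nz by (simp add: W.rel_def W.scl_scl W.run_props)
  moreover have "wscl 1 (W.run [] [(0, co c)]) = W.run [] [(0, co c)]"
    by (simp add: W.scl_one W.run_props wlayer)
  ultimately have "wadd (wscl 1 (W.run [] [(0, co c)])) (wscl (\<tau> * \<tau>) (W.run [] [(0, co c), (0, tv c), (0, vt c)]))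
      = wscl 1 (W.run [] [(0, co c)])"
    by metis
  then have "W.run [] [(0, co c), (0, tv c), (0, vt c)] = wscl ((1 - 1) / (\<tau> * \<tau>)) (W.run [] [(0, co c)])"
    by (rule W.solve_scalar) (use tau_nz in \<open>simp_all add: W.run_props wlayer\<close>)
  then have Z: "W.rel [] 0 [(0, co c), (0, tv c), (0, vt c)] [(0, co c)]"
    by (simp add: W.rel_def wlayer)
  have "W.rel [] (1 / (\<tau> * \<tau>)) [(0, co c), (0, tv c), (0, vt c), (0, tv c)] [(0, co c), (0, tv c)]"
    by (rule W.rel_at[OF vertex_bubble, of _ "[(0, co c), (0, tv c)]" 0 "[]"]) (simp_all add: wlayer)
  then have "W.rel [] (1 / (1 / (\<tau> * \<tau>))) [(0, co c), (0, tv c)] [(0, co c), (0, tv c), (0, vt c), (0, tv c)]"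
    by (rule W.rel_sym) (use tau_nz in simp)
  also have "W.rel [] 0 \<dots> [(0, co c), (0, tv c)]"
    by (rule W.rel_at[OF Z, of _ "[]" 0 "[(0, tv c)]"]) (simp_all add: wlayer)
  finally show ?thesis by simp
qed

section \<open>Letters do not contain the unit\<close>

text \<open>Suppose that \<open>y\<close> embeds the unit isometrically into \<open>c\<close> and is its own dual.  Then \<open>z = cup - y \<otimes> y\<close> is
the cup of the complement of \<open>y\<close>: it is orthogonal to \<open>y\<close>, and \<open>z\<^sup>* z = \<tau> - 1\<close>.  Place two copies of \<open>z\<close> side
by side or nested inside each other.  Both vectors have square norm \<open>(\<tau> - 1)\<^sup>2\<close>, and their inner product is
a single loop, \<open>\<tau> - 1\<close>.  Their difference has square norm \<open>2 (\<tau> - 1) (\<tau> - 2)\<close>, which is negative.\<close>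

lemma no_real_unit_vector:
  assumes y [simp]: "warr y" "wdm y = []" "wcd y = [c]"
    and J: "W.rel [] 1 [(0, co c), (0, wstar y)] [(0, y)]"
    and N: "W.rel [] 1 [(0, y), (0, wstar y)] []"
  shows False
proof -
  let ?y = "wstar y"
  define z where "z = wadd (W.run [] [(0, co c)]) (wscl (- 1) (W.run [] [(0, y), (1, y)]))"
  define zs where "zs = wadd (W.run [c, c] [(0, ca c)]) (wscl (- 1) (W.run [c, c] [(1, ?y), (0, ?y)]))"
  have zsz: "wstar z = zs"
    using run_star[of "[]" "[(0, co c)]"] run_star[of "[]" "[(0, y), (1, y)]"]
    unfolding z_def zs_def by (simp add: wstar_add wstar_scl W.run_props wlayer)
  have z [simp]: "warr z" "wdm z = []" "wcd z = [c, c]" unfolding z_def by (simp_all add: W.run_props wlayer)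
  have zs [simp]: "warr zs" "wdm zs = [c, c]" "wcd zs = []" "wstar zs = z" "wstar z = zs"
    using zsz[symmetric] by simp_all
  note zrun = W.run_expand[OF z_def] and zsrun = W.run_expand[OF zs_def]
  have J': "W.rel [c] 1 [(0, y), (0, ca c)] [(0, ?y)]"
    using rel_star[OF J] by (simp add: wlayer)
  \<comment> \<open>The vector \<open>z\<close> is orthogonal to \<open>y\<close> on the left strand.\<close>
  have "W.rel [c] (1 + (- 1) * 1) [(0, y), (0, zs)] [(0, ?y)]"
  proof (rule W.rel_addI[OF _ _ J'])
    show "W.run [c] [(0, y), (0, zs)] = wadd (W.run [c] [(0, y), (0, ca c)]) (wscl (- 1) (W.run [c] [(0, y), (1, ?y), (0, ?y)]))"
      using zsrun(1)[of "[c]" "[(0, y)]" 0 "[]"] by (simp add: wlayer)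
    show "W.rel [c] 1 [(0, y), (1, ?y), (0, ?y)] [(0, ?y)]"
      by (rule W.rel_at[OF N, of _ "[(0, ?y)]" 0 "[]"]) (simp_all add: wlayer)
  qed (simp add: wlayer)
  then have Z1: "W.rel [c] 0 [(0, y), (0, zs)] [(0, ?y)]" by simp
  have Z1': "W.rel [] 0 [(0, z), (0, ?y)] [(0, y)]"
    using rel_star[OF Z1] by (simp add: wlayer)
  \<comment> \<open>The loop \<open>z\<^sup>* z\<close>: by orthogonality, \<open>z\<^sup>*\<close> may be replaced by the cap.\<close>
  have "W.rel [] (\<tau> + (- 1) * 1) [(0, z), (0, ca c)] []"
  proof (rule W.rel_addI[OF _ _ loop_value])
    show "W.run [] [(0, z), (0, ca c)] = wadd (W.run [] [(0, co c), (0, ca c)]) (wscl (- 1) (W.run [] [(0, y), (1, y), (0, ca c)]))"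
      using zrun(1)[of "[]" "[]" 0 "[(0, ca c)]"] by (simp add: wlayer)
    have "W.rel [] 1 [(0, y), (1, y), (0, ca c)] [(0, y), (0, ?y)]"
      by (rule W.rel_at[OF J', of _ "[(0, y)]" 0 "[]"]) (simp_all add: wlayer)
    also note N
    finally show "W.rel [] 1 [(0, y), (1, y), (0, ca c)] []" by simp
  qed (simp add: wlayer)
  then have zca: "W.rel [] (\<tau> - 1) [(0, z), (0, ca c)] []" by simp
  have "W.rel [] ((\<tau> - 1) + (- 1) * 0) [(0, z), (0, zs)] []"
  proof (rule W.rel_addI[OF _ _ zca])
    show "W.run [] [(0, z), (0, zs)] = wadd (W.run [] [(0, z), (0, ca c)]) (wscl (- 1) (W.run [] [(0, z), (1, ?y), (0, ?y)]))"
      using zsrun(1)[of "[]" "[(0, z)]" 0 "[]"] by (simp add: wlayer)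
    have "W.rel [] 0 [(0, z), (1, ?y), (0, ?y)] [(0, y), (0, ?y)]"
      by (rule W.rel_at[OF Z1', of _ "[]" 0 "[(0, ?y)]"]) (simp_all add: wlayer)
    then show "W.rel [] 0 [(0, z), (1, ?y), (0, ?y)] []"
      by (rule W.rel_zero_any) (simp_all add: wlayer)
  qed (simp add: wlayer)
  then have Z2: "W.rel [] (\<tau> - 1) [(0, z), (0, zs)] []" by simp
  \<comment> \<open>Nested copies of \<open>z\<close> are paired with adjacent copies of \<open>z\<^sup>*\<close>.  Replacing one \<open>z\<^sup>*\<close> by the cap and the inner \<open>z\<close> by the cup straightens the diagram to a loop.\<close>
  have "W.rel [] ((\<tau> - 1) + (- 1) * 0) [(0, z), (1, z), (0, ca c), (0, zs)] []"
  proof (rule W.rel_addI)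
    show "W.run [] [(0, z), (1, z), (0, ca c), (0, zs)] = wadd (W.run [] [(0, z), (1, co c), (0, ca c), (0, zs)])
       (wscl (- 1) (W.run [] [(0, z), (1, y), (2, y), (0, ca c), (0, zs)]))"
      using zrun(1)[of "[]" "[(0, z)]" 1 "[(0, ca c), (0, zs)]"] by (simp add: wlayer numeral_2_eq_2)
    have "W.rel [] 1 [(0, z), (1, co c), (0, ca c), (0, zs)] [(0, z), (0, zs)]"
      by (rule W.rel_at[OF zigzag_left, of _ "[(0, z)]" 0 "[(0, zs)]"]) (simp_all add: wlayer)
    also note Z2
    finally show "W.rel [] (\<tau> - 1) [(0, z), (1, co c), (0, ca c), (0, zs)] []" by simp
    have "W.rel [] 0 [(0, z), (1, y), (2, y), (0, ca c), (0, zs)] [(0, z), (1, y), (0, ca c), (0, ?y)]"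
      by (rule W.rel_at[OF Z1, of _ "[(0, z), (1, y), (0, ca c)]" 0 "[]"]) (simp_all add: wlayer)
    then show "W.rel [] 0 [(0, z), (1, y), (2, y), (0, ca c), (0, zs)] []"
      by (rule W.rel_zero_any) (simp_all add: wlayer)
  qed (simp add: wlayer)
  then have I1: "W.rel [] (\<tau> - 1) [(0, z), (1, z), (0, ca c), (0, zs)] []" by simp
  have "W.rel [] ((\<tau> - 1) + (- 1) * 0) [(0, z), (1, z), (0, zs), (0, zs)] []"
  proof (rule W.rel_addI[OF _ _ I1])
    show "W.run [] [(0, z), (1, z), (0, zs), (0, zs)] = wadd (W.run [] [(0, z), (1, z), (0, ca c), (0, zs)])
       (wscl (- 1) (W.run [] [(0, z), (1, z), (1, ?y), (0, ?y), (0, zs)]))"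
      using zsrun(1)[of "[]" "[(0, z), (1, z)]" 0 "[(0, zs)]"] by (simp add: wlayer)
    have "W.rel [] 0 [(0, z), (1, z), (1, ?y), (0, ?y), (0, zs)] [(0, z), (1, y), (0, ?y), (0, zs)]"
      by (rule W.rel_at[OF Z1', of _ "[(0, z)]" 1 "[(0, ?y), (0, zs)]"]) (simp_all add: wlayer)
    then show "W.rel [] 0 [(0, z), (1, z), (1, ?y), (0, ?y), (0, zs)] []"
      by (rule W.rel_zero_any) (simp_all add: wlayer)
  qed (simp add: wlayer)
  then have I2: "W.rel [] (\<tau> - 1) [(0, z), (1, z), (0, zs), (0, zs)] []" by simp
  have "W.rel [] 1 [(0, z), (1, z), (2, zs), (0, zs)] [(0, z), (1, z), (0, zs), (0, zs)]"
    by (rule W.rel_nf) (simp_all add: wlayer)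
  also note I2
  finally have AB: "W.rel [] (\<tau> - 1) [(0, z), (1, z), (2, zs), (0, zs)] []" by simp
  have BA: "W.rel [] (\<tau> - 1) [(0, z), (2, z), (1, zs), (0, zs)] []"
    using rel_star[OF AB] by (simp add: wlayer)
  have "W.rel [] (\<tau> - 1) [(0, z), (2, z), (2, zs), (0, zs)] [(0, z), (0, zs)]"
    by (rule W.rel_at[OF Z2, of _ "[(0, z)]" 2 "[(0, zs)]"]) (simp_all add: wlayer)
  also note Z2
  finally have AA: "W.rel [] ((\<tau> - 1) * (\<tau> - 1)) [(0, z), (2, z), (2, zs), (0, zs)] []" .
  have "W.rel [] (\<tau> - 1) [(0, z), (1, z), (1, zs), (0, zs)] [(0, z), (0, zs)]"
    by (rule W.rel_at[OF Z2, of _ "[(0, z)]" 1 "[(0, zs)]"]) (simp_all add: wlayer)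
  also note Z2
  finally have BB: "W.rel [] ((\<tau> - 1) * (\<tau> - 1)) [(0, z), (1, z), (1, zs), (0, zs)] []" .
  let ?A = "W.run [] [(0, z), (2, z)]" and ?B = "W.run [] [(0, z), (1, z)]"
  let ?A' = "W.run [c, c, c, c] [(2, zs), (0, zs)]" and ?B' = "W.run [c, c, c, c] [(1, zs), (0, zs)]"
  let ?v = "wadd ?A (wscl (- 1) ?B)"
  have v: "warr ?v" "wdm ?v = []" by (simp_all add: W.run_props wlayer)
  obtain r :: real where r: "r \<ge> 0" "wcomp (wstar ?v) ?v = wscl (complex_of_real r) (widn [])"
    using positive[OF v] by blast
  have s: "wstar ?A = ?A'" "wstar ?B = ?B'"
    using run_star[of "[]" "[(0, z), (2, z)]"] run_star[of "[]" "[(0, z), (1, z)]"] by (simp_all add: wlayer)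
  have p: "warr ?A" "wdm ?A = []" "wcd ?A = [c, c, c, c]" "warr ?B" "wdm ?B = []" "wcd ?B = [c, c, c, c]"
    "warr ?A'" "wdm ?A' = [c, c, c, c]" "wcd ?A' = []" "warr ?B'" "wdm ?B' = [c, c, c, c]" "wcd ?B' = []"
    by (simp_all add: W.run_props wlayer)
  have m: "wcomp ?A' ?A = wscl ((\<tau> - 1) * (\<tau> - 1)) (widn [])" "wcomp ?B' ?B = wscl ((\<tau> - 1) * (\<tau> - 1)) (widn [])"
    "wcomp ?A' ?B = wscl (\<tau> - 1) (widn [])" "wcomp ?B' ?A = wscl (\<tau> - 1) (widn [])"
    using AA BB AB BA by (simp_all add: W.run_comp wlayer W.rel_def) (simp_all add: W.run.simps)
  have "wcomp (wstar ?v) ?v = wadd (wadd (wcomp ?A' ?A) (wscl (- 1) (wcomp ?B' ?A)))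
      (wadd (wscl (- 1) (wcomp ?A' ?B)) (wscl (- 1) (wscl (- 1) (wcomp ?B' ?B))))"
    using p by (simp add: wstar_add wstar_scl s s(2)[unfolded One_nat_def] W.scl_add W.add_comp W.comp_add W.scl_comp W.comp_scl)
  also have "\<dots> = wscl (((\<tau> - 1) * (\<tau> - 1) - (\<tau> - 1)) + (- (\<tau> - 1) + (\<tau> - 1) * (\<tau> - 1))) (widn [])"
    unfolding m by (simp add: W.scl_scl W.add_scl[symmetric])
  finally have "complex_of_real r = ((\<tau> - 1) * (\<tau> - 1) - (\<tau> - 1)) + (- (\<tau> - 1) + (\<tau> - 1) * (\<tau> - 1))"
    unfolding r(2) by (rule unit_scalar_inj)
  also have "\<dots> = complex_of_real (2 * (golden - 1) * (golden - 2))"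
    by (simp add: algebra_simps)
  finally have "r = 2 * (golden - 1) * (golden - 2)" using of_real_eq_iff by blast
  moreover have "golden > 1" "golden < 2"
  proof -
    have "sqrt 5 > 1" by simp
    moreover have "sqrt 5 < 3" by (rule real_less_lsqrt) simp_all
    ultimately show "golden > 1" "golden < 2" unfolding golden_def by simp_all
  qed
  ultimately show False using r(1) by (simp add: zero_le_mult_iff)
qed

text \<open>Duality gives an antilinear involution \<open>J\<close> on the morphisms from the unit to a letter.  A nonzero
\<open>x\<close> yields a nonzero \<open>y\<close> with \<open>J y = y\<close>: either \<open>x + J x\<close>, or \<open>i x\<close> when \<open>J x = - x\<close>.  Normalised, it
contradicts the preceding lemma.\<close>

lemma letter_no_vector:
  assumes x [simp]: "warr x" "wdm x = []" "wcd x = [c]"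
  shows "x = wzero [] [c]"
proof (rule ccontr)
  assume nz: "x \<noteq> wzero [] [c]"
  define J where "J = (\<lambda>x. W.run [] [(0, co c), (0, wstar x)])"
  have ok: "W.ok [] [(0, co c), (0, wstar x)]" if "warr x" "wdm x = []" "wcd x = [c]" for x
    using that by (simp add: wlayer)
  have J_arr: "warr (J x)" "wdm (J x) = []" "wcd (J x) = [c]" if "warr x" "wdm x = []" "wcd x = [c]" for x
    using W.run_props[OF ok[OF that]] that by (simp_all add: J_def wlayer)
  have J_add: "J (wadd x y) = wadd (J x) (J y)" if "warr x" "wdm x = []" "wcd x = [c]" "warr y" "wdm y = []" "wcd y = [c]" for x y
    using that W.run_add[of "[]" "[(0, co c)]" 0 "wstar x" "[]" "wstar y"] ok[of x] by (simp add: J_def wstar_add)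
  have J_scl: "J (wscl a x) = wscl (cnj a) (J x)" if "warr x" "wdm x = []" "wcd x = [c]" for a x
    using that W.run_scl[of "[]" "[(0, co c)]" 0 "wstar x" "[]"] ok[of x] by (simp add: J_def wstar_scl)
  have JJ: "J (J x) = x"
  proof -
    have s: "wstar (J x) = W.run [c] [(0, x), (0, ca c)]"
      using run_star[OF ok[OF x]] by (simp add: J_def wlayer)
    have "J (J x) = W.run [] ([(0, co c)] @ (0, W.run [c] [(0, x), (0, ca c)]) # [])"
      unfolding J_def[of] using s by (simp add: J_def)
    also have "\<dots> = W.run [] ([(0, co c)] @ W.shift 0 [(0, x), (0, ca c)] @ [])"
      by (rule W.run_flatten(2)) (simp_all add: wlayer W.run_props)
    also have "\<dots> = W.run [] [(0, x)]"
    proof (rule W.rel_run)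
      show "W.rel [] 1 ([(0, co c)] @ W.shift 0 [(0, x), (0, ca c)] @ []) [(0, x)]"
        by (rule W.rel_at[OF zigzag_left, of _ "[(0, x)]" 0 "[]"]) (simp_all add: wlayer)
    qed
    also have "\<dots> = x" by (simp add: W.run_single)
    finally show ?thesis .
  qed
  have "\<exists>y. warr y \<and> wdm y = [] \<and> wcd y = [c] \<and> J y = y \<and> y \<noteq> wzero [] [c]"
  proof (cases "wadd x (J x) = wzero [] [c]")
    case False
    moreover have "J (wadd x (J x)) = wadd x (J x)"
      using J_add[OF x J_arr[OF x]] JJ W.add_comm[of x "J x"] J_arr[OF x] by simp
    ultimately show ?thesis using J_arr[OF x] by (intro exI[of _ "wadd x (J x)"]) simp
  next
    case True
    then have "wadd x (J x) = wadd x (wscl (- 1) x)" using W.add_neg[of x "[]" "[c]"] by simp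
    then have Jx: "J x = wscl (- 1) x"
      by (rule W.add_cancel_left) (use J_arr[OF x] in simp_all)
    have "J (wscl \<i> x) = wscl \<i> x" using J_scl[OF x, of \<i>] Jx by (simp add: W.scl_scl)
    moreover have "wscl \<i> x \<noteq> wzero [] [c]"
    proof
      assume "wscl \<i> x = wzero [] [c]"
      then have "wscl (- \<i>) (wscl \<i> x) = wzero [] [c]" by (simp add: W.scl_zero)
      then show False using nz by (simp add: W.scl_scl W.scl_one)
    qed
    ultimately show ?thesis by (intro exI[of _ "wscl \<i> x"]) simp
  qed
  then obtain y where y: "warr y" "wdm y = []" "wcd y = [c]" and Jy: "J y = y" and ynz: "y \<noteq> wzero [] [c]" by blast
  obtain r :: real where r: "r \<ge> 0" "wcomp (wstar y) y = wscl (complex_of_real r) (widn [])"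
    using positive[OF y(1,2)] by blast
  have "r \<noteq> 0"
  proof
    assume "r = 0"
    then have "wcomp (wstar y) y = wzero (wdm y) (wdm y)" using r(2) y W.scl_zero_left[of "widn []" "[]" "[]"] by simp
    then show False using definite[OF y(1)] ynz y by simp
  qed
  then have r0: "r > 0" using r(1) by simp
  let ?k = "complex_of_real (1 / sqrt r)"
  let ?y = "wscl ?k y"
  have y': "warr ?y" "wdm ?y = []" "wcd ?y = [c]" using y by simp_all
  have "J ?y = ?y" using J_scl[OF y, of ?k] Jy by simp
  then have "W.rel [] 1 [(0, co c), (0, wstar ?y)] [(0, ?y)]"
    using y' by (intro W.rel_runI) (simp_all add: wlayer J_def W.run_single)
  moreover have "W.rel [] 1 [(0, ?y), (0, wstar ?y)] []"
  proof (rule W.rel_runI)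
    have "W.run [] [(0, ?y), (0, wstar ?y)] = wcomp (wstar ?y) ?y"
      using y' by (simp add: W.run.simps W.wh_def W.act_def W.idn_tens W.tens_idn W.idn_comp)
    also have "\<dots> = wscl (cnj ?k * (?k * complex_of_real r)) (widn [])"
      using y r by (simp add: wstar_scl W.scl_comp W.comp_scl W.scl_scl)
    also have "cnj ?k * (?k * complex_of_real r) = complex_of_real ((1 / sqrt r) * (1 / sqrt r) * r)"
      by (simp only: of_real_mult complex_cnj_complex_of_real mult.assoc)
    also have "(1 / sqrt r) * (1 / sqrt r) * r = 1" using r0 by (simp add: field_simps)
    finally show "W.run [] [(0, ?y), (0, wstar ?y)] = W.run [] []" by (simp add: W.scl_one W.run.simps)
  qed (use y' in \<open>simp_all add: wlayer\<close>)
  ultimately show False using no_real_unit_vector[OF y'] by blast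
qed

section \<open>Irreducible words\<close>

definition nohom :: "colour list \<Rightarrow> colour list \<Rightarrow> bool" where
  "nohom a b \<longleftrightarrow> (\<forall>x. warr x \<longrightarrow> wdm x = a \<longrightarrow> wcd x = b \<longrightarrow> x = wzero a b)"

definition scalar_end :: "colour list \<Rightarrow> bool" where
  "scalar_end a \<longleftrightarrow> (\<forall>x. warr x \<longrightarrow> wdm x = a \<longrightarrow> wcd x = a \<longrightarrow> (\<exists>z. x = wscl z (widn a)))"

lemma nohomD: "\<lbrakk>nohom a b; warr x; wdm x = a; wcd x = b\<rbrakk> \<Longrightarrow> x = wzero a b"
  unfolding nohom_def by blast

lemma nohom_rel: "\<lbrakk>nohom a b; W.ok a xs; W.tgt a xs = b; W.ok a ys; W.tgt a ys = b\<rbrakk> \<Longrightarrow> W.rel a k xs ys"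
  using nohomD[of a b "W.run a xs"] nohomD[of a b "W.run a ys"] W.run_props[of a xs] W.run_props[of a ys]
  by (simp add: W.rel_def W.scl_zero)

lemma nohom_slice:
  assumes "nohom a b" "W.ok a (xs @ ys)" "W.tgt a xs = b" "W.ok a zs" "W.tgt a zs = W.tgt a (xs @ ys)"
  shows "W.rel a 0 (xs @ ys) zs"
proof (rule W.rel_zero_any)
  show "W.rel a 0 (xs @ ys) (xs @ ys)"
    using W.rel_append[of a "[]" 0 xs xs ys] nohom_rel[OF assms(1), of xs xs] assms by simp
qed (use assms in simp_all)

lemma nohomI:
  assumes "\<And>x. \<lbrakk>warr x; wdm x = a; wcd x = b\<rbrakk> \<Longrightarrow> \<exists>zs. W.rel a 0 [(0, x)] zs"
  shows "nohom a b"
  unfolding nohom_def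
proof (intro allI impI)
  fix x assume x: "warr x" "wdm x = a" "wcd x = b"
  obtain zs where "W.rel a 0 [(0, x)] zs" using assms[OF x] by blast
  then have "W.rel a 0 [(0, x)] [(0, x)]" by (rule W.rel_zero_any) (use x in \<open>simp_all add: wlayer\<close>)
  moreover have r: "W.run a [(0, x)] = x" by (rule W.run_single) (use x in simp_all)
  ultimately have "x = wscl 0 x" unfolding W.rel_def r by blast
  then show "x = wzero a b" using W.scl_zero_left[OF x] by simp
qed

lemma nohom_star: "nohom a b \<Longrightarrow> nohom b a"
  unfolding nohom_def
proof (intro allI impI)
  fix x assume h: "\<forall>x. warr x \<longrightarrow> wdm x = a \<longrightarrow> wcd x = b \<longrightarrow> x = wzero a b" and x: "warr x" "wdm x = b" "wcd x = a"
  have "wstar x = wzero a b" using h[rule_format, of "wstar x"] x by simp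
  then show "x = wzero b a" using definite[OF x(1)] x W.zero_comp[of x a b b] by simp
qed

lemma scalar_endD: "\<lbrakk>scalar_end a; warr x; wdm x = a; wcd x = a\<rbrakk> \<Longrightarrow> \<exists>z. x = wscl z (widn a)"
  unfolding scalar_end_def by blast

lemma scalar_rel:
  assumes "scalar_end a" "W.ok a xs" "W.tgt a xs = a"
  obtains z where "W.rel a z xs []"
proof -
  obtain z where "W.run a xs = wscl z (widn a)"
    using scalar_endD[OF assms(1), of "W.run a xs"] W.run_props[OF assms(2)] assms(3) by auto
  then show ?thesis using that[of z] assms by (simp add: W.rel_def W.run.simps)
qed

lemma scalar_endI:
  assumes "\<And>x. \<lbrakk>warr x; wdm x = a; wcd x = a\<rbrakk> \<Longrightarrow> \<exists>z. W.rel a z [(0, x)] []"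
  shows "scalar_end a"
  unfolding scalar_end_def
proof (intro allI impI)
  fix x assume x: "warr x" "wdm x = a" "wcd x = a"
  obtain z where "W.rel a z [(0, x)] []" using assms[OF x] by blast
  moreover have r: "W.run a [(0, x)] = x" by (rule W.run_single) (use x in simp_all)
  ultimately have "x = wscl z (widn a)" unfolding W.rel_def r W.run.simps(1) by blast
  then show "\<exists>z. x = wscl z (widn a)" by blast
qed

lemma nohom_unit_letter: "nohom [] [c]" "nohom [c] []"
proof -
  show 1: "nohom [] [c]" unfolding nohom_def using letter_no_vector by auto
  show "nohom [c] []" by (rule nohom_star[OF 1])
qed

lemma scalar_end_unit: "scalar_end []"
  unfolding scalar_end_def using unit_scalar by blast

lemma rel_scalar_inj: "W.rel w a xs [] \<Longrightarrow> W.rel w b xs [] \<Longrightarrow> a = b"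
  unfolding W.rel_def using word_scalar_inj by (simp add: W.run.simps) metis

lemma rel_prefix: "W.rel w a xs ys \<Longrightarrow> W.ok v pre \<Longrightarrow> W.tgt v pre = w \<Longrightarrow> W.rel v a (pre @ xs) (pre @ ys)"
  using W.rel_append[of v pre a xs ys "[]"] by simp

text \<open>Two scalar multiples of the same diagram are compared by completing the diagram to a nonzero multiple
of an identity.\<close>

lemma rel_cancel:
  assumes "W.rel w a xs zs" "W.rel w b xs zs" "W.rel v m (pre @ zs) []" "m \<noteq> 0" "W.tgt v pre = w"
  shows "a = b"
proof -
  have p: "W.ok v pre" using assms(3) by (simp add: W.rel_def)
  have "a * m = b * m"
    using rel_scalar_inj[OF W.rel_trans[OF rel_prefix[OF assms(1) p assms(5)] assms(3)]
        W.rel_trans[OF rel_prefix[OF assms(2) p assms(5)] assms(3)]] .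
  then show ?thesis using assms(4) by simp
qed

lemma expand_rel:
  assumes "W.rel w a (pre @ [(i, ca c), (i, co c)] @ post) zs" "W.rel w b (pre @ [(i, tv c), (i, vt c)] @ post) zs"
    "W.ok w (pre @ post)" "W.tgt w pre = u @ [c, c] @ v" "i = length u"
  shows "W.rel w (a / \<tau> + b * (\<tau> * \<tau>)) (pre @ post) zs"
  using expand_id(1)[OF assms(3-5)] assms(1-3) unfolding W.rel_def
  by (simp add: W.scl_scl W.add_scl W.run_props mult.commute)

lemma nohom_split:
  assumes "nohom (u @ v) b" "nohom (u @ [c] @ v) b"
  shows "nohom (u @ [c, c] @ v) b"
proof (rule nohomI)
  fix x assume x [simp]: "warr x" "wdm x = u @ [c, c] @ v" "wcd x = b"
  have "W.rel (u @ [c, c] @ v) 0 [(0, x)] [(0, x)]"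
  proof (rule split_rel[of _ u c v "length u"])
    show "W.rel (u @ v) 0 [(length u, co c), (0, x)] [(length u, co c), (0, x)]"
      by (rule nohom_rel[OF assms(1)]) (simp_all add: wlayer)
    show "W.rel (u @ [c] @ v) 0 [(length u, vt c), (0, x)] [(length u, vt c), (0, x)]"
      by (rule nohom_rel[OF assms(2)]) (simp_all add: wlayer)
  qed (simp_all add: wlayer)
  then show "\<exists>zs. W.rel (u @ [c, c] @ v) 0 [(0, x)] zs" by blast
qed

text \<open>Compose with the decomposition of \<open>cc\<close> at the target.  The summand through \<open>u c v\<close> vanishes, and the
summand through \<open>u v\<close> is a scalar endomorphism followed by the cup.\<close>

lemma cup_scalar:
  assumes "scalar_end (u @ v)" "nohom (u @ v) (u @ [c] @ v)"
    and o: "W.ok (u @ v) xs" "W.tgt (u @ v) xs = u @ [c, c] @ v"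
  obtains s where "W.rel (u @ v) s xs [(length u, co c)]"
proof -
  let ?w = "u @ v" and ?i = "length u"
  obtain s where s: "W.rel ?w s (xs @ [(?i, ca c)]) []"
    by (rule scalar_rel[OF assms(1), of "xs @ [(?i, ca c)]"]) (use o in \<open>simp_all add: wlayer\<close>)
  have 1: "W.rel ?w s (xs @ [(?i, ca c), (?i, co c)]) [(?i, co c)]"
    using W.rel_append[of ?w "[]" s "xs @ [(?i, ca c)]" "[]" "[(?i, co c)]"] s o by (simp add: wlayer)
  have 2: "W.rel ?w 0 (xs @ [(?i, tv c), (?i, vt c)]) [(?i, co c)]"
    using nohom_slice[OF assms(2), of "xs @ [(?i, tv c)]" "[(?i, vt c)]" "[(?i, co c)]"] o by (simp add: wlayer)
  have "W.rel ?w (s / \<tau> + 0 * (\<tau> * \<tau>)) (xs @ []) [(?i, co c)]"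
    by (rule expand_rel[where i = ?i and u = u and v = v and c = c]) (use 1 2 o in simp_all)
  then show thesis using that by simp
qed

lemma cap_scalar:
  assumes "W.ok [c, c] xs" "W.tgt [c, c] xs = []"
  obtains q where "W.rel [c, c] q xs [(0, ca c)]"
proof -
  define x where "x = W.run [c, c] xs"
  have x [simp]: "warr x" "wdm x = [c, c]" "wcd x = []"
    using W.run_props[OF assms(1)] assms(2) by (simp_all add: x_def)
  obtain s where s: "W.rel [] s [(0, wstar x)] [(0, co c)]"
    by (rule cup_scalar[of "[]" "[]" c "[(0, wstar x)]"])
      (use scalar_end_unit nohom_unit_letter(1) in \<open>simp_all add: wlayer\<close>)
  have "W.rel [c, c] (cnj s) [(0, x)] [(0, ca c)]"
    using rel_star[OF s] by (simp add: wlayer)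
  then have "W.rel [c, c] (cnj s) xs [(0, ca c)]"
    using assms by (simp add: W.rel_def W.run_single x_def[symmetric])
  then show thesis by (rule that)
qed

lemma scalar_end_letter: "scalar_end [c]"
proof (rule scalar_endI)
  fix g assume g [simp]: "warr g" "wdm g = [c]" "wcd g = [c]"
  obtain s where s: "W.rel [] s [(0, co c), (0, g)] [(0, co c)]"
    by (rule cup_scalar[of "[]" "[]" c "[(0, co c), (0, g)]"])
      (use scalar_end_unit nohom_unit_letter(1) in \<open>simp_all add: wlayer\<close>)
  have "W.rel [c] 1 [(0, g)] [(0, co c), (0, g), (1, ca c)]"
    by (rule W.rel_back[OF zigzag_right, of _ "[]" 0 "[(0, g)]"]) (simp_all add: wlayer)
  also have "W.rel [c] s \<dots> [(0, co c), (1, ca c)]"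
    by (rule W.rel_at[OF s, of _ "[]" 0 "[(1, ca c)]"]) (simp_all add: wlayer)
  also note zigzag_right
  finally show "\<exists>z. W.rel [c] z [(0, g)] []" by blast
qed

text \<open>Let \<open>g\<close> be an endomorphism of \<open>c M e\<close>.  Bending the letter \<open>e\<close> of its source to the target and the
letter \<open>c\<close> of its target to the source gives a morphism \<open>h : c c M \<rightarrow> M e e\<close>.  Cut \<open>cc\<close> at its source: the summand \<open>c\<close> contributes nothing, and on the
summand \<open>1\<close> it is a multiple of the cup on \<open>e\<close>.  So \<open>h\<close> is a multiple of the bent identity.\<close>

lemma scalar_end_bend:
  assumes "scalar_end M" "nohom M (M @ [e])" "nohom (c # M) M" "nohom (c # M) (M @ [e])"
  shows "scalar_end (c # M @ [e])"
proof (rule scalar_endI)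
  fix g assume g [simp]: "warr g" "wdm g = c # M @ [e]" "wcd g = c # M @ [e]"
  let ?m = "length M" and ?w = "c # M @ [e]"
  let ?h = "[(?m + 2, co e), (1, g), (0, ca c)]"
  obtain s where s: "W.rel M s ((0, co c) # ?h) [(?m, co e)]"
    by (rule cup_scalar[of M "[]" e "(0, co c) # ?h"]) (use assms in \<open>simp_all add: wlayer\<close>)
  have "W.rel M \<tau> [(0, co c), (0, ca c), (?m, co e)] [(?m, co e)]"
    by (rule W.rel_at[OF loop_value, of _ "[]" 0 "[(?m, co e)]"]) (simp_all add: wlayer)
  from W.rel_trans[OF s W.rel_sym[OF this tau_nz]]
  have cup: "W.rel M (s / \<tau>) ((0, co c) # ?h) [(0, co c), (0, ca c), (?m, co e)]" by simp
  have none: "nohom (c # M) (M @ [e, e])"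
    using nohom_star[OF nohom_split[of M "[]" "c # M" e]] nohom_star assms(3,4) by simp
  have h: "W.rel (c # c # M) (s / \<tau>) ?h [(0, ca c), (?m, co e)]"
  proof (rule split_rel[of _ "[]" c M 0])
    show "W.rel ([] @ M) (s / \<tau>) ((0, co c) # ?h) [(0, co c), (0, ca c), (?m, co e)]"
      using cup by simp
    show "W.rel ([] @ [c] @ M) (s / \<tau>) ((0, vt c) # ?h) [(0, vt c), (0, ca c), (?m, co e)]"
      using nohom_rel[OF none] by (simp add: wlayer)
  qed (simp_all add: wlayer)
  \<comment> \<open>Unbending: zigzags on both sides express \<open>g\<close> by \<open>h\<close>.\<close>
  have "W.rel ?w 1 [(0, g)] [(?m + 1, co e), (0, g), (?m + 2, ca e)]"
    by (rule W.rel_back[OF zigzag_right, of _ "[]" "?m + 1" "[(0, g)]"]) (simp_all add: wlayer)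
  also have "W.rel ?w 1 \<dots> [(0, co c), (?m + 3, co e), (2, g), (1, ca c), (?m + 2, ca e)]"
    by (rule W.rel_back[OF zigzag_right, of _ "[(?m + 1, co e), (0, g)]" 0 "[(?m + 2, ca e)]"])
      (simp_all add: wlayer numeral_2_eq_2 numeral_3_eq_3)
  also have "W.rel ?w (s / \<tau>) \<dots> [(0, co c), (1, ca c), (?m + 1, co e), (?m + 2, ca e)]"
    by (rule W.rel_at[OF h, of _ "[(0, co c)]" 1 "[(?m + 2, ca e)]"])
      (simp_all add: wlayer numeral_2_eq_2 numeral_3_eq_3)
  also have "W.rel ?w 1 \<dots> [(?m + 1, co e), (?m + 2, ca e)]"
    by (rule W.rel_at[OF zigzag_right, of _ "[]" 0 "[(?m + 1, co e), (?m + 2, ca e)]"]) (simp_all add: wlayer)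
  also have "W.rel ?w 1 \<dots> []"
    by (rule W.rel_at[OF zigzag_right, of _ "[]" "?m + 1" "[]"]) (simp_all add: wlayer)
  finally show "\<exists>z. W.rel ?w z [(0, g)] []" by blast
qed

lemma scalar_end_two: "nohom [c] [d] \<Longrightarrow> scalar_end [c, d]"
  using scalar_end_bend[of "[]" d c] scalar_end_unit nohom_unit_letter by simp

text \<open>Bending the letter \<open>d\<close> turns a morphism \<open>d \<rightarrow> d c\<close> or \<open>d \<rightarrow> c d\<close> into one from \<open>dd\<close> to \<open>c\<close>, and \<open>dd\<close> is
\<open>1 \<oplus> d\<close>.\<close>

lemma nohom_one_two:
  assumes "nohom [d] [c]"
  shows "nohom [d] [d, c]" and "nohom [d] [c, d]"
proof -
  have two: "nohom [d, d] [c]" using nohom_split[of "[]" "[]" "[c]" d] nohom_unit_letter(1) assms by simp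
  show "nohom [d] [d, c]"
  proof (rule nohomI)
    fix x assume x [simp]: "warr x" "wdm x = [d]" "wcd x = [d, c]"
    have h: "W.rel [d, d] 0 [(1, x), (0, ca d)] [(1, x), (0, ca d)]"
      by (rule nohom_rel[OF two]) (simp_all add: wlayer)
    have "W.rel [d] 1 [(0, x)] [(0, co d), (2, x), (1, ca d)]"
      by (rule W.rel_back[OF zigzag_right, of _ "[(0, x)]" 0 "[]"]) (simp_all add: wlayer)
    also have "W.rel [d] 0 \<dots> [(0, co d), (2, x), (1, ca d)]"
      by (rule W.rel_at[OF h, of _ "[(0, co d)]" 1 "[]"]) (simp_all add: wlayer)
    finally show "\<exists>zs. W.rel [d] 0 [(0, x)] zs" by auto
  qed
  show "nohom [d] [c, d]"
  proof (rule nohomI)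
    fix x assume x [simp]: "warr x" "wdm x = [d]" "wcd x = [c, d]"
    have h: "W.rel [d, d] 0 [(0, x), (1, ca d)] [(0, x), (1, ca d)]"
      by (rule nohom_rel[OF two]) (simp_all add: wlayer)
    have "W.rel [d] 1 [(0, x)] [(1, co d), (0, x), (1, ca d)]"
      by (rule W.rel_back[OF zigzag_left, of _ "[(0, x)]" 1 "[]"]) (simp_all add: wlayer)
    also have "W.rel [d] 0 \<dots> [(1, co d), (0, x), (1, ca d)]"
      by (rule W.rel_at[OF h, of _ "[(1, co d)]" 0 "[]"]) (simp_all add: wlayer)
    finally show "\<exists>zs. W.rel [d] 0 [(0, x)] zs" by auto
  qed
qed

lemma scalar_end_three:
  assumes "nohom [c] [d]" "nohom [c, d] [d, c]"
  shows "scalar_end [c, d, c]"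
  using scalar_end_bend[of "[d]" c c] scalar_end_letter nohom_one_two[OF nohom_star[OF assms(1)]] nohom_star assms(2)
  by simp

section \<open>Passing a trivalent vertex\<close>

text \<open>The rotation equations are put into a form without cups: the cup is straightened against the cap that
appears on the other side.\<close>

lemma cap_of_rotation:
  assumes u [simp]: "warr u" "wdm u = c # B" "wcd u = B @ [d]"
    and A: "W.rel (B @ [d]) k [(0, co c), (1, u), (Suc (length B), ca d)] [(0, wstar u)]"
  shows "W.rel (c # B @ [d]) k [(0, u), (length B, ca d)] [(1, wstar u), (0, ca c)]"
proof -
  let ?w = "c # B @ [d]" and ?i = "length B"
  have "W.rel ?w 1 [(0, u), (?i, ca d)] [(1, co c), (2, u), (?i + 2, ca d), (0, ca c)]"
    by (rule W.rel_back[OF zigzag_left, of _ "[]" 0 "[(0, u), (?i, ca d)]"]) (simp_all add: wlayer)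
  also have "W.rel ?w k \<dots> [(1, wstar u), (0, ca c)]"
    by (rule W.rel_at[OF A, of _ "[]" 1 "[(0, ca c)]"]) (simp_all add: wlayer)
  finally show ?thesis by simp
qed

lemma cap_of_inverse_rotation:
  assumes u [simp]: "warr u" "wdm u = B @ [x]" "wcd u = c # B"
    and A: "W.rel (c # B) 1 [(Suc (length B), co x), (1, u), (0, ca c)] [(0, wstar u)]"
  shows "W.rel (c # B @ [x]) 1 [(0, wstar u), (length B, ca x)] [(1, u), (0, ca c)]"
proof -
  let ?w = "c # B @ [x]" and ?i = "length B"
  have "W.rel ?w 1 [(0, wstar u), (?i, ca x)] [(?i + 1, co x), (1, u), (0, ca c), (?i, ca x)]"
    by (rule W.rel_back[OF A, of _ "[]" 0 "[(?i, ca x)]"]) (simp_all add: wlayer)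
  also have "W.rel ?w 1 \<dots> [(1, u), (0, ca c)]"
    by (rule W.rel_at[OF zigzag_right, of _ "[]" "?i + 1" "[(1, u), (0, ca c)]"]) (simp_all add: wlayer)
  finally show ?thesis by simp
qed

lemma zero_zero: "W.rel w 0 xs ys \<Longrightarrow> W.rel w 0 ys zs \<Longrightarrow> W.rel w l xs ys"
  using W.rel_zero_any[of w xs ys xs] W.rel_tgt[of w 0 xs ys] W.rel_zero_run[of w xs ys] W.rel_zero_run[of w ys zs]
  unfolding W.rel_def by (simp add: W.scl_zero)

text \<open>Conjugating \<open>t\<^sub>c\<close> by \<open>u\<close> gives a morphism \<open>f : B d d \<rightarrow> B d\<close>.  It vanishes on the cup of \<open>dd\<close>, because the
cup can be slid through \<open>u\<close> and \<open>t\<^sub>c\<close> vanishes on cups.  On the other summand of \<open>dd\<close> it is a scalar, by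
irreducibility of \<open>B d\<close>.  Hence \<open>f = l (1 \<otimes> t\<^sub>d)\<close>.

Unitarity of \<open>u\<close> gives \<open>\<bar>l\<bar> = 1\<close>.  The adjoint of the relation contains \<open>t\<^sub>c\<^sup>*\<close> and the conjugate of
\<open>l\<close>; rotating it back by caps costs the factor \<open>k\<close> and yields the relation itself.  Hence \<open>l\<close> is its own
conjugate divided by \<open>k\<close>, and \<open>l\<^sup>2 k = 1\<close>.\<close>

lemma trivalent_passes:
  fixes c d :: colour and B :: "colour list"
  assumes u [simp]: "warr u" "wdm u = c # B" "wcd u = B @ [d]"
    and uu: "W.rel (c # B) 1 [(0, u), (0, wstar u)] []"
    and uu': "W.rel (B @ [d]) 1 [(0, wstar u), (0, u)] []"
    and cap: "W.rel (c # B @ [d]) k [(0, u), (length B, ca d)] [(1, wstar u), (0, ca c)]" and k: "k \<noteq> 0"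
    and sc: "scalar_end (B @ [d])"
  obtains l where "l * l * k = 1" and "W.rel (c # c # B) l [(0, tv c), (0, u)] [(1, u), (0, u), (length B, tv d)]"
    and "W.rel (B @ [d, d]) l [(0, wstar u), (1, wstar u), (0, tv c)] [(length B, tv d), (0, wstar u)]"
    and "W.rel (c # B @ [d]) l [(1, wstar u), (0, tv c)] [(0, u), (length B, tv d), (0, wstar u)]"
proof -
  let ?v = "wstar u" and ?i = "length B"
  let ?f = "[(0, ?v), (1, ?v), (0, tv c), (0, u)]"
  have cap': "W.rel B (cnj k) [(?i, co d), (0, ?v)] [(0, co c), (1, u)]"
    using rel_star[OF cap] by (simp add: wlayer)
  have "W.rel B (cnj k) ([(?i, co d)] @ ?f) ([(0, co c), (1, u), (1, ?v), (0, tv c), (0, u)])"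
    by (rule W.rel_at[OF cap', of _ "[]" 0 "[(1, ?v), (0, tv c), (0, u)]"]) (simp_all add: wlayer)
  also have "W.rel B 1 \<dots> [(0, co c), (0, tv c), (0, u)]"
    by (rule W.rel_at[OF uu, of _ "[(0, co c)]" 1 "[(0, tv c), (0, u)]"]) (simp_all add: wlayer)
  also have "W.rel B 0 \<dots> [(0, co c), (0, tv c), (0, u)]"
    by (rule W.rel_at[OF vertex_cup, of _ "[]" 0 "[(0, u)]"]) (simp_all add: wlayer)
  finally have "W.rel B 0 ([(?i, co d)] @ ?f) [(0, co c), (0, tv c), (0, u)]" by simp
  then have 1: "W.rel B 0 ((?i, co d) # ?f) [(?i, co d), (?i, tv d)]"
    using W.rel_zero_any[of B "(?i, co d) # ?f" _ "[(?i, co d), (?i, tv d)]"] by (simp add: wlayer)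
  \<comment> \<open>Both sides of the claim vanish on the cup.\<close>
  have 2: "W.rel B 0 [(?i, co d), (?i, tv d)] [(?i, co d), (?i, tv d)]"
    by (rule W.rel_at[OF vertex_cup, of _ "[]" ?i "[]"]) (simp_all add: wlayer)
  obtain s where s: "W.rel (B @ [d]) s ((?i, vt d) # ?f) []"
    by (rule scalar_rel[OF sc, of "(?i, vt d) # ?f"]) (simp_all add: wlayer)
  \<comment> \<open>The scalar is compared with the bubble \<open>\<tau>\<^sup>-\<^sup>2\<close>, which is the value of the right-hand side on the same summand.\<close>
  define l where "l = s * (\<tau> * \<tau>)"
  have bub: "W.rel (B @ [d]) (1 / (\<tau> * \<tau>)) [(?i, vt d), (?i, tv d)] []"
    by (rule W.rel_at[OF vertex_bubble, of _ "[]" ?i "[]"]) (simp_all add: wlayer)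
  have 3: "W.rel (B @ [d]) l ((?i, vt d) # ?f) [(?i, vt d), (?i, tv d)]"
    using W.rel_trans[OF s W.rel_sym[OF bub]] tau_nz by (simp add: l_def)
  have 4: "W.rel (B @ [d, d]) l ?f [(?i, tv d)]"
  proof (rule split_rel[where u = B and v = "[]" and c = d and i = ?i])
    show "W.rel (B @ []) l ((?i, co d) # ?f) ((?i, co d) # [(?i, tv d)])"
      using zero_zero[OF 1 2] by simp
    show "W.rel (B @ [d] @ []) l ((?i, vt d) # ?f) ((?i, vt d) # [(?i, tv d)])"
      using 3 by simp
  qed (simp_all add: wlayer)
  have "W.rel (c # c # B) 1 [(0, tv c), (0, u)] [(1, u), (1, ?v), (0, tv c), (0, u)]"
    by (rule W.rel_back[OF uu, of _ "[]" 1 "[(0, tv c), (0, u)]"]) (simp_all add: wlayer)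
  also have "W.rel (c # c # B) 1 \<dots> [(1, u), (0, u), (0, ?v), (1, ?v), (0, tv c), (0, u)]"
    by (rule W.rel_back[OF uu, of _ "[(1, u)]" 0 "[(1, ?v), (0, tv c), (0, u)]"]) (simp_all add: wlayer)
  also have "W.rel (c # c # B) l \<dots> [(1, u), (0, u), (?i, tv d)]"
    by (rule W.rel_at[OF 4, of _ "[(1, u), (0, u)]" 0 "[]"]) (simp_all add: wlayer)
  finally have 5: "W.rel (c # c # B) l [(0, tv c), (0, u)] [(1, u), (0, u), (?i, tv d)]" by simp
  have 6: "W.rel (B @ [d]) (cnj l) [(0, ?v), (0, vt c)] [(?i, vt d), (0, ?v), (1, ?v)]"
    using rel_star[OF 5] by (simp add: wlayer)
  have 7: "W.rel (B @ [d, d]) l [(0, ?v), (1, ?v), (0, tv c)] [(?i, tv d), (0, ?v)]"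
  proof -
    have "W.rel (B @ [d, d]) 1 [(0, ?v), (1, ?v), (0, tv c)] (?f @ [(0, ?v)])"
      by (rule W.rel_back[OF uu, of _ "[(0, ?v), (1, ?v), (0, tv c)]" 0 "[]"]) (simp_all add: wlayer)
    also have "W.rel (B @ [d, d]) l \<dots> [(?i, tv d), (0, ?v)]"
      by (rule W.rel_at[OF 4, of _ "[]" 0 "[(0, ?v)]"]) (simp_all add: wlayer)
    finally show ?thesis by simp
  qed
  have Z1: "W.rel (c # B @ [d]) l [(1, ?v), (0, tv c)] [(0, u), (?i, tv d), (0, ?v)]"
  proof -
    have "W.rel (c # B @ [d]) 1 [(1, ?v), (0, tv c)] [(0, u), (0, ?v), (1, ?v), (0, tv c)]"
      by (rule W.rel_back[OF uu, of _ "[]" 0 "[(1, ?v), (0, tv c)]"]) (simp_all add: wlayer)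
    also have "W.rel (c # B @ [d]) l \<dots> [(0, u), (?i, tv d), (0, ?v)]"
      by (rule W.rel_at[OF 7, of _ "[(0, u)]" 0 "[]"]) (simp_all add: wlayer)
    finally show ?thesis by simp
  qed
  \<comment> \<open>The same relation, obtained from the adjoint by rotating the vertex.\<close>
  have Z2: "W.rel (c # B @ [d]) (cnj l / k) [(1, ?v), (0, tv c)] [(0, u), (?i, tv d), (0, ?v)]"
  proof -
    have "W.rel (c # B @ [d]) 1 [(1, ?v), (0, tv c)] [(1, ?v), (1, vt c), (0, ca c)]"
      by (rule W.rel_back[OF rotate_left, of _ "[(1, ?v)]" 0 "[]"]) (simp_all add: wlayer)
    also have "W.rel (c # B @ [d]) (cnj l) \<dots> [(?i + 1, vt d), (1, ?v), (0, ca c), (0, ?v)]"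
      by (rule W.rel_at[OF 6, of _ "[]" 1 "[(0, ca c)]"]) (simp_all add: wlayer)
    also have "W.rel (c # B @ [d]) (1 / k) \<dots> [(?i + 1, vt d), (0, u), (?i, ca d), (0, ?v)]"
      by (rule W.rel_at[OF W.rel_sym[OF cap k], of _ "[(?i + 1, vt d)]" 0 "[(0, ?v)]"]) (simp_all add: wlayer)
    also have "W.rel (c # B @ [d]) 1 \<dots> [(0, u), (?i, tv d), (0, ?v)]"
      by (rule W.rel_at[OF rotate_left, of _ "[(0, u)]" ?i "[(0, ?v)]"]) (simp_all add: wlayer)
    finally show ?thesis by simp
  qed
  have m: "W.rel (c # B) (1 / (\<tau> * \<tau>)) ([(0, u), (?i, vt d), (0, ?v)] @ [(0, u), (?i, tv d), (0, ?v)]) []"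
  proof -
    have "W.rel (c # B) 1 ([(0, u), (?i, vt d), (0, ?v)] @ [(0, u), (?i, tv d), (0, ?v)]) [(0, u), (?i, vt d), (?i, tv d), (0, ?v)]"
      by (rule W.rel_at[OF uu', of _ "[(0, u), (?i, vt d)]" 0 "[(?i, tv d), (0, ?v)]"]) (simp_all add: wlayer)
    also have "W.rel (c # B) (1 / (\<tau> * \<tau>)) \<dots> [(0, u), (0, ?v)]"
      by (rule W.rel_at[OF vertex_bubble, of _ "[(0, u)]" ?i "[(0, ?v)]"]) (simp_all add: wlayer)
    also note uu
    finally show ?thesis by simp
  qed
  have lk: "l = cnj l / k"
    by (rule rel_cancel[OF Z1 Z2 m]) (use tau_nz in \<open>simp_all add: wlayer\<close>)
  \<comment> \<open>The composite of \<open>f\<close> with its adjoint, computed by the relation and by cancelling \<open>u\<close> against its adjoint.\<close>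
  have ll: "cnj l * s = 1 / (\<tau> * \<tau>)"
  proof (rule rel_scalar_inj)
    let ?X = "[(0, ?v), (0, vt c), (1, u), (0, u)] @ ?f"
    have "W.rel (B @ [d]) (cnj l) ([(0, ?v), (0, vt c)] @ [(1, u), (0, u)] @ ?f) ([(?i, vt d), (0, ?v), (1, ?v)] @ [(1, u), (0, u)] @ ?f)"
      by (rule W.rel_at[OF 6, of _ "[]" 0 "[(1, u), (0, u)] @ ?f"]) (simp_all add: wlayer)
    also have "W.rel (B @ [d]) 1 \<dots> ([(?i, vt d), (0, ?v), (0, u)] @ ?f)"
      by (rule W.rel_at[OF uu', of _ "[(?i, vt d), (0, ?v)]" 1 "[(0, u)] @ ?f"]) (simp_all add: wlayer)
    also have "W.rel (B @ [d]) 1 \<dots> ((?i, vt d) # ?f)"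
      by (rule W.rel_at[OF uu', of _ "[(?i, vt d)]" 0 "?f"]) (simp_all add: wlayer)
    also note s
    finally show "W.rel (B @ [d]) (cnj l * s) ?X []" by simp
    have "W.rel (B @ [d]) 1 ?X [(0, ?v), (0, vt c), (1, u), (1, ?v), (0, tv c), (0, u)]"
      by (rule W.rel_at[OF uu, of _ "[(0, ?v), (0, vt c), (1, u)]" 0 "[(1, ?v), (0, tv c), (0, u)]"]) (simp_all add: wlayer)
    also have "W.rel (B @ [d]) 1 \<dots> [(0, ?v), (0, vt c), (0, tv c), (0, u)]"
      by (rule W.rel_at[OF uu, of _ "[(0, ?v), (0, vt c)]" 1 "[(0, tv c), (0, u)]"]) (simp_all add: wlayer)
    also have "W.rel (B @ [d]) (1 / (\<tau> * \<tau>)) \<dots> [(0, ?v), (0, u)]"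
      by (rule W.rel_at[OF vertex_bubble, of _ "[(0, ?v)]" 0 "[(0, u)]"]) (simp_all add: wlayer)
    also note uu'
    finally show "W.rel (B @ [d]) (1 / (\<tau> * \<tau>)) ?X []" by simp
  qed
  have "cnj l * l = cnj l * s * (\<tau> * \<tau>)" by (simp add: l_def)
  then have "cnj l * l = 1" using ll tau_nz by simp
  then have "l * l * k = 1" using lk k by (metis mult.commute mult.left_commute nonzero_eq_divide_eq)
  then show thesis using that 5 7 Z1 by blast
qed

text \<open>Take a nonzero \<open>f\<close>.  The endomorphisms \<open>f\<^sup>* f\<close> and \<open>f f\<^sup>*\<close> are scalars; they agree because both
multiply \<open>f\<close>, and they are not zero.\<close>

lemma schur:
  assumes a: "scalar_end a" and b: "scalar_end b" and n: "\<not> nohom a b"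
  obtains f g where "warr f" "wdm f = a" "wcd f = b" "warr g" "wdm g = b" "wcd g = a"
    "wcomp g f = widn a" "wcomp f g = widn b"
proof -
  obtain f where f: "warr f" "wdm f = a" "wcd f = b" and nz: "f \<noteq> wzero a b"
    using n unfolding nohom_def by blast
  obtain s where s: "wcomp (wstar f) f = wscl s (widn a)"
    using scalar_endD[OF a, of "wcomp (wstar f) f"] f by auto
  obtain s' where s': "wcomp f (wstar f) = wscl s' (widn b)"
    using scalar_endD[OF b, of "wcomp f (wstar f)"] f by auto
  have "s \<noteq> 0"
  proof
    assume "s = 0"
    then have "wcomp (wstar f) f = wzero (wdm f) (wdm f)" using s f W.scl_zero_left[of "widn a" a a] by simp
    then show False using definite[OF f(1)] nz f by simp
  qed
  have "wscl s f = wcomp f (wcomp (wstar f) f)" unfolding s using f by (simp add: W.comp_scl W.comp_idn)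
  also have "\<dots> = wscl s' f" using f W.comp_assoc[of f "wstar f" f] s' by (simp add: W.scl_comp W.idn_comp)
  finally have e: "wscl s f = wscl s' f" .
  have "s = s'"
  proof (rule ccontr)
    assume ne: "s \<noteq> s'"
    have "wscl (s - s') f = wadd (wscl s f) (wscl (- s') f)" using f W.add_scl[of f s "- s'"] by simp
    also have "\<dots> = wzero a b" unfolding e using f W.add_scl[of f s' "- s'"] W.scl_zero_left[of f a b] by simp
    finally have "wscl (1 / (s - s')) (wscl (s - s') f) = wzero a b" by (simp add: W.scl_zero)
    then show False using ne nz f by (simp add: W.scl_scl W.scl_one)
  qed
  then show thesis
    using that[of f "wscl (1 / s) (wstar f)"] f s s' \<open>s \<noteq> 0\<close>
    by (simp add: W.scl_comp W.comp_scl W.scl_scl W.scl_one)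
qed

lemma rotate_left': "W.rel [c] 1 [(0, co c), (1, tv c)] [(0, vt c)]"
  using rel_star[OF rotate_left[of c]] by (simp add: wlayer)

lemma rotate_right': "W.rel [c] 1 [(1, co c), (0, tv c)] [(0, vt c)]"
  using rel_star[OF rotate_right[of c]] by (simp add: wlayer)

section \<open>Words of two letters\<close>

text \<open>Let \<open>C\<close> be the move of a \<open>\<rho>\<close>-cap across one \<open>\<mu>\<close>-strand, which costs \<open>\<omega>\<close>.  A \<open>\<rho>\<close>-cap that crosses the
strand leaving a \<open>\<mu>\<close>-vertex can also be moved across the vertex.  This takes the vertex across the two
legs of the cap, at the cost of \<open>n\<^sup>-\<^sup>2 = 1\<close>, and then moves the cap across both strands that enter the
vertex, at the cost of \<open>\<omega>\<^sup>2\<close>.\<close>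

lemma two_letters_disjoint:
  assumes u [simp]: "warr u" "wdm u = [Rho, Mu]" "wcd u = [Mu, Rho]"
    and uu: "W.rel [Rho, Mu] 1 [(0, u), (0, wstar u)] []"
    and uu': "W.rel [Mu, Rho] 1 [(0, wstar u), (0, u)] []"
    and A: "W.rel [Mu, Rho] \<omega> [(0, co Rho), (1, u), (2, ca Rho)] [(0, wstar u)]"
    and B: "W.rel [Mu, Rho] 1 [(2, co Mu), (1, u), (0, ca Mu)] [(0, wstar u)]"
    and nz: "\<omega> \<noteq> 0" and no: "nohom [Rho] [Mu]"
  shows "\<omega> = 1"
proof -
  let ?v = "wstar u"
  have capB: "W.rel [Mu, Rho, Mu] 1 [(0, ?v), (1, ca Mu)] [(1, u), (0, ca Mu)]"
    using cap_of_inverse_rotation[of u "[Rho]" Mu Mu] B by (simp add: numeral_2_eq_2)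
  have capA: "W.rel [Rho, Mu, Rho] \<omega> [(0, u), (1, ca Rho)] [(1, ?v), (0, ca Rho)]"
    using cap_of_rotation[of u Rho "[Mu]" Rho \<omega>] A by (simp add: numeral_2_eq_2)
  have v: "warr ?v" "wdm ?v = Mu # [Rho]" "wcd ?v = [Rho] @ [Mu]" by simp_all
  obtain n where n: "n * n * 1 = 1" and N: "W.rel ([Rho] @ [Mu, Mu]) n [(0, u), (1, u), (0, tv Mu)] [(1, tv Mu), (0, u)]"
    by (rule trivalent_passes[OF v, of 1]) (use uu uu' capB scalar_end_two[OF no] in simp_all)
  have V: "W.rel [Rho, Mu, Mu] (1 / n) [(1, tv Mu), (0, u)] [(0, u), (1, u), (0, tv Mu)]"
    using W.rel_sym[OF N] n by (cases "n = 0") auto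
  have "W.rel [Rho, Rho, Mu] \<omega> [(1, u), (0, u), (1, ca Rho)] [(1, u), (1, ?v), (0, ca Rho)]"
    by (rule W.rel_at[OF capA, of _ "[(1, u)]" 0 "[]"]) (simp_all add: wlayer)
  also have "W.rel [Rho, Rho, Mu] 1 \<dots> [(0, ca Rho)]"
    by (rule W.rel_at[OF uu, of _ "[]" 1 "[(0, ca Rho)]"]) (simp_all add: wlayer)
  finally have C: "W.rel [Rho, Rho, Mu] \<omega> [(1, u), (0, u), (1, ca Rho)] [(0, ca Rho)]" by simp
  let ?w = "[Rho, Rho, Mu, Mu]"
  have 1: "W.rel ?w \<omega> [(2, tv Mu), (1, u), (0, u), (1, ca Rho)] [(0, ca Rho), (0, tv Mu)]"
    by (rule W.rel_at[OF C, of _ "[(2, tv Mu)]" 0 "[]"]) (simp_all add: wlayer)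
  have "W.rel ?w (1 / n) [(2, tv Mu), (1, u), (0, u), (1, ca Rho)] [(1, u), (2, u), (1, tv Mu), (0, u), (1, ca Rho)]"
    by (rule W.rel_at[OF V, of _ "[]" 1 "[(0, u), (1, ca Rho)]"]) (simp_all add: wlayer)
  also have "W.rel ?w (1 / n) \<dots> [(1, u), (2, u), (0, u), (1, u), (0, tv Mu), (1, ca Rho)]"
    by (rule W.rel_at[OF V, of _ "[(1, u), (2, u)]" 0 "[(1, ca Rho)]"]) (simp_all add: wlayer)
  also have "W.rel ?w \<omega> \<dots> [(1, u), (0, u), (1, ca Rho), (0, tv Mu)]"
    by (rule W.rel_at[OF C, of _ "[(1, u), (0, u)]" 1 "[(0, tv Mu)]"]) (simp_all add: wlayer)
  also have "W.rel ?w \<omega> \<dots> [(0, ca Rho), (0, tv Mu)]"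
    by (rule W.rel_at[OF C, of _ "[]" 0 "[(0, tv Mu)]"]) (simp_all add: wlayer)
  finally have 2: "W.rel ?w (1 / n * (1 / n) * \<omega> * \<omega>) [(2, tv Mu), (1, u), (0, u), (1, ca Rho)] [(0, ca Rho), (0, tv Mu)]" .
  have "W.rel [Mu] \<tau> [(0, vt Mu), (0, co Rho), (0, ca Rho), (0, tv Mu)] [(0, vt Mu), (0, tv Mu)]"
    by (rule W.rel_at[OF loop_value, of _ "[(0, vt Mu)]" 0 "[(0, tv Mu)]"]) (simp_all add: wlayer)
  also note vertex_bubble
  finally have 3: "W.rel [Mu] (\<tau> * (1 / (\<tau> * \<tau>))) ([(0, vt Mu), (0, co Rho)] @ [(0, ca Rho), (0, tv Mu)]) []" by simp
  have "\<omega> = 1 / n * (1 / n) * \<omega> * \<omega>"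
    by (rule rel_cancel[OF 1 2 3]) (use tau_nz in \<open>simp_all add: wlayer\<close>)
  moreover have "1 / n * (1 / n) = 1" using n by (simp add: field_simps)
  ultimately show ?thesis using nz by simp
qed

lemma (in strict_linear_category) add_shuffle:
  assumes "arr A" "arr B" "arr C" "dm B = dm A" "dm C = dm A" "cd B = cd A" "cd C = cd A"
  shows "add (add A B) C = add (add A C) B"
proof -
  have "add (add A B) C = add A (add B C)" by (rule add_assoc) (use assms in simp_all)
  also have "add B C = add C B" by (rule add_comm) (use assms in simp_all)
  also have "add A (add C B) = add (add A C) B" by (rule add_assoc[symmetric]) (use assms in simp_all)
  finally show ?thesis .
qed

lemma (in strict_linear_category) run_combination:
  assumes g: "g = add (scl a (run w0 xs)) (scl b (run w0 ys))"
    and k: "ok w0 xs" "ok w0 ys" "tgt w0 xs = tgt w0 ys"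
    and o: "ok w (pre @ (i, g) # post)"
  shows "run w (pre @ (i, g) # post)
      = add (scl a (run w (pre @ shift i xs @ post))) (scl b (run w (pre @ shift i ys @ post)))"
proof -
  have x: "ok w (pre @ (i, run w0 xs) # post)" "ok w (pre @ (i, run w0 ys) # post)"
    using o k run_props[OF k(1)] run_props[OF k(2)] unfolding g by (auto simp: fits_def act_def)
  have y: "ok w (pre @ (i, scl a (run w0 xs)) # post)" using x(1) by (simp add: fits_def act_def)
  show ?thesis
    unfolding g using run_add[OF y, of "scl b (run w0 ys)"] run_props[OF k(1)] run_props[OF k(2)]
      run_scl[OF x(1)] run_scl[OF x(2)] run_flatten(2)[OF k(1) x(1)] run_flatten(2)[OF k(2) x(2)] k by simp
qed

lemma rel_eq: "W.rel w k xs ys \<Longrightarrow> W.run w xs = wscl k (W.run w ys)"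
  by (simp add: W.rel_def)

text \<open>By the decomposition of \<open>cc\<close> into distinct irreducible summands \<open>1\<close> and \<open>c\<close>, the endomorphisms are
spanned by \<open>cup cap\<close> and \<open>t\<^sub>c\<^sup>* t\<^sub>c\<close>, and the latter can be traded for \<open>1\<close>.\<close>

lemma two_strand_endomorphism:
  assumes g [simp]: "warr g" "wdm g = [c, c]" "wcd g = [c, c]"
  obtains x y where "g = wadd (wscl x (W.run [c, c] [])) (wscl y (W.run [c, c] [(0, ca c), (0, co c)]))"
proof -
  obtain a where a: "W.rel [c, c] a [(0, g), (0, ca c)] [(0, ca c)]"
    by (rule cap_scalar[of c "[(0, g), (0, ca c)]"]) (simp_all add: wlayer)
  have A: "W.rel [c, c] a [(0, g), (0, ca c), (0, co c)] [(0, ca c), (0, co c)]"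
    by (rule W.rel_at[OF a, of _ "[]" 0 "[(0, co c)]"]) (simp_all add: wlayer)
  obtain b where b: "W.rel [c] b [(0, vt c), (0, g), (0, tv c)] []"
    by (rule scalar_rel[OF scalar_end_letter, of c "[(0, vt c), (0, g), (0, tv c)]"]) (simp_all add: wlayer)
  have b': "W.rel [c, c] b ([(0, tv c)] @ [(0, vt c), (0, g), (0, tv c)]) ([(0, tv c)] @ [])"
    by (rule rel_prefix[OF b]) (simp_all add: wlayer)
  have z: "W.rel [c, c] 0 ([(0, ca c)] @ [(0, co c), (0, g), (0, tv c)]) [(0, tv c)]"
  proof (rule W.rel_zero_any)
    show "W.rel [c, c] 0 ([(0, ca c)] @ [(0, co c), (0, g), (0, tv c)]) ([(0, ca c)] @ [(0, co c), (0, g), (0, tv c)])"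
      by (rule rel_prefix[OF nohom_rel[OF nohom_unit_letter(1)]]) (simp_all add: wlayer)
  qed (simp_all add: wlayer)
  have "W.rel [c, c] (0 / \<tau> + b * (\<tau> * \<tau>)) ([] @ [(0, g), (0, tv c)]) [(0, tv c)]"
    by (rule expand_rel[where i = 0 and c = c and u = "[]" and v = "[]"]) (use z b' in \<open>simp_all add: wlayer\<close>)
  then have t: "W.rel [c, c] (b * (\<tau> * \<tau>)) [(0, g), (0, tv c)] [(0, tv c)]" by simp
  have T: "W.rel [c, c] (b * (\<tau> * \<tau>)) [(0, g), (0, tv c), (0, vt c)] [(0, tv c), (0, vt c)]"
    by (rule W.rel_at[OF t, of _ "[]" 0 "[(0, vt c)]"]) (simp_all add: wlayer)
  let ?I = "W.run [c, c] []" and ?E = "W.run [c, c] [(0, ca c), (0, co c)]" and ?V = "W.run [c, c] [(0, tv c), (0, vt c)]"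
  have arrs: "warr ?I" "wdm ?I = [c, c]" "wcd ?I = [c, c]" "warr ?E" "wdm ?E = [c, c]" "wcd ?E = [c, c]"
    "warr ?V" "wdm ?V = [c, c]" "wcd ?V = [c, c]" by (simp_all add: W.run_props wlayer)
  have I: "?I = wadd (wscl (1 / \<tau>) ?E) (wscl (\<tau> * \<tau>) ?V)"
    using expand_id(1)[of "[c, c]" "[]" "[]" "[]" c "[]" 0] by (simp add: wlayer)
  have G: "W.run [c, c] [(0, g)] = wadd (wscl (1 / \<tau>) (W.run [c, c] [(0, g), (0, ca c), (0, co c)]))
      (wscl (\<tau> * \<tau>) (W.run [c, c] [(0, g), (0, tv c), (0, vt c)]))"
    using expand_id(1)[of "[c, c]" "[(0, g)]" "[]" "[]" c "[]" 0] by (simp add: wlayer)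
  let ?p = "b * (\<tau> * \<tau>)" and ?q = "a / \<tau> - b * \<tau>"
  have "W.run [c, c] [(0, g)] = wadd (wscl (a / \<tau>) ?E) (wscl (\<tau> * \<tau> * ?p) ?V)"
  proof -
    have "W.run [c, c] [(0, g), (0, ca c), (0, co c)] = wscl a ?E"
      "W.run [c, c] [(0, g), (0, tv c), (0, vt c)] = wscl ?p ?V"
      by (rule rel_eq[OF A], rule rel_eq[OF T])
    then show ?thesis unfolding G using arrs by (simp only: W.scl_scl times_divide_eq_left mult_1_left)
  qed
  also have "\<dots> = wadd (wscl ?p ?I) (wscl ?q ?E)"
  proof -
    have "wadd (wscl ?p ?I) (wscl ?q ?E) = wadd (wadd (wscl (?p / \<tau>) ?E) (wscl (?p * (\<tau> * \<tau>)) ?V)) (wscl ?q ?E)"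
    proof -
      have "wscl ?p ?I = wadd (wscl ?p (wscl (1 / \<tau>) ?E)) (wscl ?p (wscl (\<tau> * \<tau>) ?V))"
        unfolding I by (rule W.scl_add) (use arrs in simp_all)
      then show ?thesis using arrs by (simp only: W.scl_scl times_divide_eq_right mult_1_right)
    qed
    also have "\<dots> = wadd (wadd (wscl (?p / \<tau>) ?E) (wscl ?q ?E)) (wscl (?p * (\<tau> * \<tau>)) ?V)"
      by (rule W.add_shuffle) (use arrs in simp_all)
    also have "wadd (wscl (?p / \<tau>) ?E) (wscl ?q ?E) = wscl (a / \<tau>) ?E"
      using arrs W.add_scl[of ?E "?p / \<tau>" ?q] tau_nz by simp
    finally show ?thesis by (simp only: mult.commute)
  qed
  finally have e: "W.run [c, c] [(0, g)] = wadd (wscl ?p ?I) (wscl ?q ?E)" .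
  have "g = W.run [c, c] [(0, g)]" by (rule W.run_single[symmetric]) simp_all
  also note e
  finally show thesis by (rule that)
qed

text \<open>With \<open>V\<close> and its inverse \<open>X\<close>, all strands become \<open>\<rho>\<close>-strands and \<open>u\<close> becomes an endomorphism \<open>g\<close> of
\<open>\<rho>\<rho>\<close>, that is, a combination of \<open>1\<close> and \<open>cup cap\<close>.  Since \<open>V\<close> respects caps, rotation in either
direction exchanges these two diagrams.  So the two rotations of \<open>u\<close> are equal.  They are also \<open>\<omega>\<close> and
\<open>1\<close> times the adjoint of \<open>u\<close>.\<close>

lemma two_letters_identified:
  assumes u [simp]: "warr u" "wdm u = [Rho, Mu]" "wcd u = [Mu, Rho]"
    and uu: "W.rel [Rho, Mu] 1 [(0, u), (0, wstar u)] []"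
    and A: "W.rel [Mu, Rho] \<omega> [(0, co Rho), (1, u), (2, ca Rho)] [(0, wstar u)]"
    and B: "W.rel [Mu, Rho] 1 [(2, co Mu), (1, u), (0, ca Mu)] [(0, wstar u)]"
    and V [simp]: "warr V" "wdm V = [Rho]" "wcd V = [Mu]"
    and X [simp]: "warr X" "wdm X = [Mu]" "wcd X = [Rho]"
    and XV: "W.rel [Mu] 1 [(0, X), (0, V)] []"
    and cap: "W.rel [Rho, Rho] 1 [(0, V), (1, V), (0, ca Mu)] [(0, ca Rho)]"
  shows "\<omega> = 1"
proof -
  have cap_right: "W.rel [Mu, Rho] 1 [(1, V), (0, ca Mu)] [(0, X), (0, ca Rho)]"
  proof -
    have "W.rel [Mu, Rho] 1 [(1, V), (0, ca Mu)] [(0, X), (0, V), (1, V), (0, ca Mu)]"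
      by (rule W.rel_back[OF XV, of _ "[]" 0 "[(1, V), (0, ca Mu)]"]) (simp_all add: wlayer)
    also have "W.rel [Mu, Rho] 1 \<dots> [(0, X), (0, ca Rho)]"
      by (rule W.rel_at[OF cap, of _ "[(0, X)]" 0 "[]"]) (simp_all add: wlayer)
    finally show ?thesis by simp
  qed
  have cap_left: "W.rel [Rho, Mu] 1 [(0, V), (0, ca Mu)] [(1, X), (0, ca Rho)]"
  proof -
    have "W.rel [Rho, Mu] 1 [(0, V), (0, ca Mu)] [(1, X), (0, V), (1, V), (0, ca Mu)]"
      by (rule W.rel_back[OF XV, of _ "[]" 1 "[(0, V), (0, ca Mu)]"]) (simp_all add: wlayer)
    also have "W.rel [Rho, Mu] 1 \<dots> [(1, X), (0, ca Rho)]"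
      by (rule W.rel_at[OF cap, of _ "[(1, X)]" 0 "[]"]) (simp_all add: wlayer)
    finally show ?thesis by simp
  qed
  have cup: "W.rel [] 1 [(0, co Mu), (0, X)] [(0, co Rho), (1, V)]"
  proof -
    have "W.rel [] 1 [(0, co Rho), (1, V)] [(0, co Rho), (1, V), (2, co Mu), (1, ca Mu)]"
      by (rule W.rel_back[OF zigzag_left, of _ "[(0, co Rho), (1, V)]" 1 "[]"]) (simp_all add: wlayer)
    also have "W.rel [] 1 \<dots> [(0, co Rho), (2, co Mu), (2, X), (1, ca Rho)]"
      by (rule W.rel_at[OF cap_left, of _ "[(0, co Rho), (2, co Mu)]" 1 "[]"]) (simp_all add: wlayer)
    also have "W.rel [] 1 \<dots> [(0, co Mu), (0, X)]"
      by (rule W.rel_at[OF zigzag_right, of _ "[(0, co Mu), (0, X)]" 0 "[]"]) (simp_all add: wlayer)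
    finally have "W.rel [] 1 [(0, co Rho), (1, V)] [(0, co Mu), (0, X)]" by simp
    from W.rel_sym[OF this] show ?thesis by simp
  qed
  define g where "g = W.run [Rho, Rho] [(1, V), (0, u), (0, X)]"
  have g [simp]: "warr g" "wdm g = [Rho, Rho]" "wcd g = [Rho, Rho]"
    unfolding g_def by (simp_all add: W.run_props wlayer)
  obtain x y where xy: "g = wadd (wscl x (W.run [Rho, Rho] [])) (wscl y (W.run [Rho, Rho] [(0, ca Rho), (0, co Rho)]))"
    by (rule two_strand_endomorphism[OF g])
  have U: "W.rel [Rho, Mu] 1 [(1, X), (1, V), (0, u), (0, X), (0, V)] [(0, u)]"
  proof -
    have "W.rel [Rho, Mu] 1 [(1, X), (1, V), (0, u), (0, X), (0, V)] [(0, u), (0, X), (0, V)]"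
      by (rule W.rel_at[OF XV, of _ "[]" 1 "[(0, u), (0, X), (0, V)]"]) (simp_all add: wlayer)
    also have "W.rel [Rho, Mu] 1 \<dots> [(0, u)]"
      by (rule W.rel_at[OF XV, of _ "[(0, u)]" 0 "[]"]) (simp_all add: wlayer)
    finally show ?thesis by simp
  qed
  let ?w = "[Mu, Rho]"
  have okg: "W.ok [Rho, Rho] [(1, V), (0, u), (0, X)]" by (simp add: wlayer)
  have runA: "W.run ?w [(0, co Rho), (1, u), (2, ca Rho)] = W.run ?w [(0, co Rho), (2, X), (1, g), (1, V), (2, ca Rho)]"
  proof -
    have "W.rel ?w 1 ([(0, co Rho), (2, X)] @ W.shift 1 [(1, V), (0, u), (0, X)] @ [(1, V), (2, ca Rho)]) [(0, co Rho), (1, u), (2, ca Rho)]"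
      by (rule W.rel_at[OF U, of _ "[(0, co Rho)]" 1 "[(2, ca Rho)]"]) (simp_all add: wlayer)
    moreover have "W.run ?w ([(0, co Rho), (2, X)] @ (1, g) # [(1, V), (2, ca Rho)])
       = W.run ?w ([(0, co Rho), (2, X)] @ W.shift 1 [(1, V), (0, u), (0, X)] @ [(1, V), (2, ca Rho)])"
      unfolding g_def by (rule W.run_flatten(2)[OF okg]) (simp_all add: wlayer W.run_props)
    ultimately show ?thesis by (auto dest!: W.rel_run)
  qed
  have runB: "W.run ?w [(2, co Mu), (1, u), (0, ca Mu)] = W.run ?w [(2, co Mu), (2, X), (1, g), (1, V), (0, ca Mu)]"
  proof -
    have "W.rel ?w 1 ([(2, co Mu), (2, X)] @ W.shift 1 [(1, V), (0, u), (0, X)] @ [(1, V), (0, ca Mu)]) [(2, co Mu), (1, u), (0, ca Mu)]"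
      by (rule W.rel_at[OF U, of _ "[(2, co Mu)]" 1 "[(0, ca Mu)]"]) (simp_all add: wlayer)
    moreover have "W.run ?w ([(2, co Mu), (2, X)] @ (1, g) # [(1, V), (0, ca Mu)])
       = W.run ?w ([(2, co Mu), (2, X)] @ W.shift 1 [(1, V), (0, u), (0, X)] @ [(1, V), (0, ca Mu)])"
      unfolding g_def by (rule W.run_flatten(2)[OF okg]) (simp_all add: wlayer W.run_props)
    ultimately show ?thesis by (auto dest!: W.rel_run)
  qed
  let ?h = "[(0, X), (0, ca Rho), (0, co Rho), (1, V)]" and ?k = "[(0, X), (1, V)]"
  \<comment> \<open>Both rotations of \<open>1\<close> give \<open>cup cap\<close>, and both rotations of \<open>cup cap\<close> give \<open>1\<close>.\<close>
  have xA: "W.rel ?w 1 [(0, co Rho), (2, X), (1, V), (2, ca Rho)] ?h"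
    by (rule W.rel_nf) (simp_all add: wlayer)
  have xB: "W.rel ?w 1 [(2, co Mu), (2, X), (1, V), (0, ca Mu)] ?h"
  proof -
    have "W.rel ?w 1 [(2, co Mu), (2, X), (1, V), (0, ca Mu)] [(2, co Rho), (3, V), (1, V), (0, ca Mu)]"
      by (rule W.rel_at[OF cup, of _ "[]" 2 "[(1, V), (0, ca Mu)]"]) (simp_all add: wlayer)
    also have "W.rel ?w 1 \<dots> [(2, co Rho), (3, V), (0, X), (0, ca Rho)]"
      by (rule W.rel_at[OF cap_right, of _ "[(2, co Rho), (3, V)]" 0 "[]"]) (simp_all add: wlayer)
    also have "W.rel ?w 1 \<dots> ?h"
      by (rule W.rel_nf) (simp_all add: wlayer)
    finally show ?thesis by simp
  qed
  have yA: "W.rel ?w 1 [(0, co Rho), (2, X), (1, ca Rho), (1, co Rho), (1, V), (2, ca Rho)] ?k"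
  proof -
    have "W.rel ?w 1 [(0, co Rho), (2, X), (1, ca Rho), (1, co Rho), (1, V), (2, ca Rho)] [(0, X), (1, co Rho), (1, V), (2, ca Rho)]"
      by (rule W.rel_at[OF zigzag_right, of _ "[(0, X)]" 0 "[(1, co Rho), (1, V), (2, ca Rho)]"]) (simp_all add: wlayer)
    also have "W.rel ?w 1 \<dots> ?k"
      by (rule W.rel_at[OF zigzag_right, of _ "[(0, X)]" 1 "[(1, V)]"]) (simp_all add: wlayer)
    finally show ?thesis by simp
  qed
  have yB: "W.rel ?w 1 [(2, co Mu), (2, X), (1, ca Rho), (1, co Rho), (1, V), (0, ca Mu)] ?k"
  proof -
    have "W.rel ?w 1 [(2, co Mu), (2, X), (1, ca Rho), (1, co Rho), (1, V), (0, ca Mu)] [(2, co Rho), (3, V), (1, ca Rho), (1, co Rho), (1, V), (0, ca Mu)]"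
      by (rule W.rel_at[OF cup, of _ "[]" 2 "[(1, ca Rho), (1, co Rho), (1, V), (0, ca Mu)]"]) (simp_all add: wlayer)
    also have "W.rel ?w 1 \<dots> [(1, V), (1, co Rho), (1, V), (0, ca Mu)]"
      by (rule W.rel_at[OF zigzag_left, of _ "[]" 1 "[(1, V), (1, co Rho), (1, V), (0, ca Mu)]"]) (simp_all add: wlayer)
    also have "W.rel ?w 1 \<dots> [(1, V), (1, co Rho), (0, X), (0, ca Rho)]"
      by (rule W.rel_at[OF cap_right, of _ "[(1, V), (1, co Rho)]" 0 "[]"]) (simp_all add: wlayer)
    also have "W.rel ?w 1 \<dots> ?k"
      by (rule W.rel_at[OF zigzag_left, of _ "[(0, X), (1, V)]" 0 "[]"]) (simp_all add: wlayer)
    finally show ?thesis by simp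
  qed
  have okE: "W.ok [Rho, Rho] []" "W.ok [Rho, Rho] [(0, ca Rho), (0, co Rho)]"
    "W.tgt [Rho, Rho] [] = W.tgt [Rho, Rho] [(0, ca Rho), (0, co Rho)]" by (simp_all add: wlayer)
  have "W.run ?w [(0, co Rho), (2, X), (1, g), (1, V), (2, ca Rho)] = wadd (wscl x (W.run ?w ?h)) (wscl y (W.run ?w ?k))"
    using W.run_combination[OF xy okE, of ?w "[(0, co Rho), (2, X)]" 1 "[(1, V), (2, ca Rho)]"]
      W.rel_run[OF xA] W.rel_run[OF yA] by (simp add: wlayer)
  moreover have "W.run ?w [(2, co Mu), (2, X), (1, g), (1, V), (0, ca Mu)] = wadd (wscl x (W.run ?w ?h)) (wscl y (W.run ?w ?k))"
    using W.run_combination[OF xy okE, of ?w "[(2, co Mu), (2, X)]" 1 "[(1, V), (0, ca Mu)]"]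
      W.rel_run[OF xB] W.rel_run[OF yB] by (simp add: wlayer)
  ultimately have "W.run ?w [(0, co Rho), (1, u), (2, ca Rho)] = W.run ?w [(2, co Mu), (1, u), (0, ca Mu)]"
    unfolding runA runB by (rule HOL.trans[OF _ HOL.sym])
  also have "\<dots> = wscl 1 (W.run ?w [(0, wstar u)])" by (rule rel_eq[OF B])
  finally have e: "W.run ?w [(0, co Rho), (1, u), (2, ca Rho)] = wscl 1 (W.run ?w [(0, wstar u)])" .
  have B': "W.rel ?w 1 [(0, co Rho), (1, u), (2, ca Rho)] [(0, wstar u)]"
    unfolding W.rel_def e using A by (simp add: W.rel_def)
  have "W.rel [Rho, Mu] 1 ([(0, u)] @ [(0, wstar u)]) []" using uu by simp
  then show ?thesis by (rule rel_cancel[OF A B']) (simp_all add: wlayer)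
qed

text \<open>Pulling the cap of \<open>d\<close> back along an isomorphism \<open>f\<close> gives a nonzero multiple \<open>q\<close> of the cap of \<open>c\<close>.
Dividing \<open>f\<close> by a square root of \<open>q\<close> makes it compatible with caps.\<close>

lemma identify_letters:
  assumes "\<not> nohom [c] [d]"
  obtains V X where "warr V" "wdm V = [c]" "wcd V = [d]" "warr X" "wdm X = [d]" "wcd X = [c]"
    "wcomp X V = widn [c]" "wcomp V X = widn [d]"
    "W.rel [d] 1 [(0, X), (0, V)] []"
    "W.rel [c, c] 1 [(0, V), (1, V), (0, ca d)] [(0, ca c)]"
proof -
  obtain f g where f [simp]: "warr f" "wdm f = [c]" "wcd f = [d]" and g [simp]: "warr g" "wdm g = [d]" "wcd g = [c]"
    and gf: "wcomp g f = widn [c]" and fg: "wcomp f g = widn [d]"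
    by (rule schur[OF scalar_end_letter scalar_end_letter assms])
  have fg': "W.rel [d] 1 [(0, g), (0, f)] []"
    using fg by (intro W.rel_runI) (simp_all add: wlayer wrun)
  obtain q where q: "W.rel [c, c] q [(0, f), (1, f), (0, ca d)] [(0, ca c)]"
    by (rule cap_scalar[of c "[(0, f), (1, f), (0, ca d)]"]) (simp_all add: wlayer)
  have "q \<noteq> 0"
  proof
    assume "q = 0"
    have "W.rel [] 1 [(0, co d), (0, g), (1, g), (0, f), (1, f), (0, ca d)] [(0, co d), (1, g), (1, f), (0, ca d)]"
      by (rule W.rel_at[OF fg', of _ "[(0, co d)]" 0 "[(1, g), (1, f), (0, ca d)]"]) (simp_all add: wlayer)
    also have "W.rel [] 1 \<dots> [(0, co d), (0, ca d)]"
      by (rule W.rel_at[OF fg', of _ "[(0, co d)]" 1 "[(0, ca d)]"]) (simp_all add: wlayer)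
    also note loop_value
    finally have 1: "W.rel [] \<tau> [(0, co d), (0, g), (1, g), (0, f), (1, f), (0, ca d)] []" by simp
    have "W.rel [] 0 [(0, co d), (0, g), (1, g), (0, f), (1, f), (0, ca d)] [(0, co d), (0, g), (1, g), (0, ca c)]"
      by (rule W.rel_at[OF q[unfolded \<open>q = 0\<close>], of _ "[(0, co d), (0, g), (1, g)]" 0 "[]"]) (simp_all add: wlayer)
    then have "W.rel [] 0 [(0, co d), (0, g), (1, g), (0, f), (1, f), (0, ca d)] []"
      by (rule W.rel_zero_any) (simp_all add: wlayer)
    from rel_scalar_inj[OF 1 this] show False using tau_nz by simp
  qed
  define r where "r = csqrt q"
  have r: "r * r = q" "r \<noteq> 0" using \<open>q \<noteq> 0\<close> power2_csqrt[of q] by (auto simp: r_def power2_eq_square)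
  let ?V = "wscl (1 / r) f" and ?X = "wscl r g"
  have V: "warr ?V" "wdm ?V = [c]" "wcd ?V = [d]" "warr ?X" "wdm ?X = [d]" "wcd ?X = [c]" by simp_all
  have i: "wcomp ?X ?V = widn [c]" "wcomp ?V ?X = widn [d]"
    using r gf fg by (simp_all add: W.scl_comp W.comp_scl W.scl_scl W.scl_one)
  have 1: "W.rel [d] 1 [(0, ?X), (0, ?V)] []"
    using i V by (intro W.rel_runI) (simp_all add: wlayer wrun)
  have "W.run [c, c] [(0, ?V), (1, ?V), (0, ca d)] = wscl (1 / r) (W.run [c, c] [(0, f), (1, ?V), (0, ca d)])"
    using W.run_scl[of "[c, c]" "[]" 0 f "[(1, ?V), (0, ca d)]" "1 / r"] by (simp add: wlayer)
  also have "W.run [c, c] [(0, f), (1, ?V), (0, ca d)] = wscl (1 / r) (W.run [c, c] [(0, f), (1, f), (0, ca d)])"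
    using W.run_scl[of "[c, c]" "[(0, f)]" 1 f "[(0, ca d)]" "1 / r"] by (simp add: wlayer)
  also have "W.run [c, c] [(0, f), (1, f), (0, ca d)] = wscl q (W.run [c, c] [(0, ca c)])"
    using q by (simp add: W.rel_def)
  finally have e: "W.run [c, c] [(0, ?V), (1, ?V), (0, ca d)] = wscl (1 / r * (1 / r * q)) (W.run [c, c] [(0, ca c)])"
    by (simp add: W.scl_scl W.run_props wlayer)
  have "1 / r * (1 / r * q) = 1" using r(2) unfolding r(1)[symmetric] by simp
  with e have "W.run [c, c] [(0, ?V), (1, ?V), (0, ca d)] = wscl 1 (W.run [c, c] [(0, ca c)])" by metis
  then have 2: "W.rel [c, c] 1 [(0, ?V), (1, ?V), (0, ca d)] [(0, ca c)]"
    unfolding W.rel_def by (simp add: wlayer)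
  show thesis by (rule that[OF V i 1 2])
qed

section \<open>Words of three letters\<close>

text \<open>Let \<open>l\<close> and \<open>n\<close> be the factors with which vertices pass \<open>u\<close> and its adjoint, so \<open>l\<^sup>2 \<omega> = 1\<close> and
\<open>n\<^sup>2 = 1\<close>.  Opening the first \<open>\<rho>\<close>-strand of \<open>u (1 \<otimes> t\<^sub>\<mu> \<otimes> 1)\<close> by a zigzag and passing the \<open>\<mu>\<close>-vertex
through the adjoint of \<open>u\<close> gives a relation \<open>M\<close> that trades the \<open>\<mu>\<close>-vertex for a \<open>\<rho>\<close>-vertex between two
copies of \<open>u\<close>, with factor \<open>m = n / \<omega>\<close>.

The diagram \<open>B = u (t\<^sub>\<rho> \<otimes> 1 \<otimes> t\<^sub>\<rho>) (1 \<otimes> u\<^sup>* \<otimes> 1)\<close> is now rewritten in two ways.  Either the left or the right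
\<open>\<rho>\<close>-vertex passes the adjoint of \<open>u\<close> first; in both cases this costs \<open>l / n\<close>.  Then \<open>M\<close>
applies.  The remaining \<open>\<mu>\<close>-vertex passes one more copy of \<open>u\<close>, with factor \<open>n\<close> in the first case and
\<open>l\<^sup>-\<^sup>1\<close> in the second.  The results coincide and do not vanish, so \<open>n = l\<^sup>-\<^sup>1\<close>.\<close>

lemma three_letters:
  assumes u [simp]: "warr u" "wdm u = [Rho, Mu, Rho]" "wcd u = [Mu, Rho, Mu]"
    and uu: "W.rel [Rho, Mu, Rho] 1 [(0, u), (0, wstar u)] []"
    and uu': "W.rel [Mu, Rho, Mu] 1 [(0, wstar u), (0, u)] []"
    and A: "W.rel [Mu, Rho, Mu] \<omega> [(0, co Rho), (1, u), (3, ca Mu)] [(0, wstar u)]"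
    and B: "W.rel [Mu, Rho, Mu] 1 [(3, co Rho), (1, u), (0, ca Mu)] [(0, wstar u)]"
    and nz: "\<omega> \<noteq> 0" and no: "nohom [Rho] [Mu]" and no2: "nohom [Rho, Mu] [Mu, Rho]"
  shows "\<omega> = 1"
proof -
  let ?v = "wstar u"
  have capB: "W.rel [Mu, Rho, Mu, Rho] 1 [(0, ?v), (2, ca Rho)] [(1, u), (0, ca Mu)]"
    using cap_of_inverse_rotation[of u "[Rho, Mu]" Rho Mu] B by (simp add: numeral_2_eq_2 numeral_3_eq_3)
  have capA: "W.rel [Rho, Mu, Rho, Mu] \<omega> [(0, u), (2, ca Mu)] [(1, ?v), (0, ca Rho)]"
    using cap_of_rotation[of u Rho "[Mu, Rho]" Mu \<omega>] A by (simp add: numeral_2_eq_2 numeral_3_eq_3)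
  have sP: "scalar_end [Rho, Mu, Rho]" by (rule scalar_end_three[OF no no2])
  have sQ: "scalar_end [Mu, Rho, Mu]" by (rule scalar_end_three[OF nohom_star[OF no] nohom_star[OF no2]])
  have u': "warr u" "wdm u = Rho # [Mu, Rho]" "wcd u = [Mu, Rho] @ [Mu]" by simp_all
  obtain l where l: "l * l * \<omega> = 1"
    and L: "W.rel (Rho # Rho # [Mu, Rho]) l [(0, tv Rho), (0, u)] [(1, u), (0, u), (2, tv Mu)]"
    and Z: "W.rel (Rho # [Mu, Rho] @ [Mu]) l [(1, ?v), (0, tv Rho)] [(0, u), (2, tv Mu), (0, ?v)]"
    by (rule trivalent_passes[OF u', of \<omega>]) (use uu uu' capA nz sQ in \<open>simp_all add: numeral_2_eq_2\<close>)
  have v: "warr ?v" "wdm ?v = Mu # [Rho, Mu]" "wcd ?v = [Rho, Mu] @ [Rho]" by simp_all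
  obtain n where n: "n * n * 1 = 1"
    and N3: "W.rel (Mu # Mu # [Rho, Mu]) n [(0, tv Mu), (0, ?v)] [(1, ?v), (0, ?v), (2, tv Rho)]"
    and N: "W.rel ([Rho, Mu] @ [Rho, Rho]) n [(0, u), (1, u), (0, tv Mu)] [(2, tv Rho), (0, u)]"
    and Y: "W.rel (Mu # [Rho, Mu] @ [Rho]) n [(1, u), (0, tv Mu)] [(0, ?v), (2, tv Rho), (0, u)]"
    by (rule trivalent_passes[OF v, of 1]) (use uu uu' capB sP in \<open>simp_all add: numeral_2_eq_2\<close>)
  have n0: "n \<noteq> 0" and l0: "l \<noteq> 0" using n l by auto
  let ?r4 = "[Rho, Mu, Mu, Rho]"
  let ?M = "[(2, co Rho), (0, u), (3, u), (2, ca Mu), (1, tv Rho)]"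
  have cup: "W.rel [Mu, Rho] (cnj \<omega>) [(2, co Mu), (0, ?v)] [(0, co Rho), (1, u)]"
    using rel_star[OF capA] by (simp add: wlayer)
  have cup': "W.rel [Mu, Rho] (1 / cnj \<omega>) [(0, co Rho), (1, u)] [(2, co Mu), (0, ?v)]"
    by (rule W.rel_sym[OF cup]) (use nz in simp)
  have capA': "W.rel [Rho, Mu, Rho, Mu] (1 / \<omega>) [(1, ?v), (0, ca Rho)] [(0, u), (2, ca Mu)]"
    by (rule W.rel_sym[OF capA nz])
  have "W.rel ?r4 1 [(1, tv Mu), (0, u)] [(1, tv Mu), (1, co Rho), (2, u), (0, ca Rho)]"
    by (rule W.rel_back[OF zigzag_left, of _ "[(1, tv Mu)]" 0 "[(0, u)]"]) (simp_all add: wlayer)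
  also have "W.rel ?r4 (1 / cnj \<omega>) \<dots> [(1, tv Mu), (3, co Mu), (1, ?v), (0, ca Rho)]"
    by (rule W.rel_at[OF cup', of _ "[(1, tv Mu)]" 1 "[(0, ca Rho)]"]) (simp_all add: wlayer)
  also have "W.rel ?r4 n \<dots> [(4, co Mu), (2, ?v), (1, ?v), (3, tv Rho), (0, ca Rho)]"
    by (rule W.rel_at[OF N3, of _ "[(4, co Mu)]" 1 "[(0, ca Rho)]"]) (simp_all add: wlayer numeral_3_eq_3)
  also have "W.rel ?r4 (cnj \<omega>) \<dots> [(2, co Rho), (3, u), (1, ?v), (3, tv Rho), (0, ca Rho)]"
    by (rule W.rel_at[OF cup, of _ "[]" 2 "[(1, ?v), (3, tv Rho), (0, ca Rho)]"]) (simp_all add: wlayer)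
  also have "W.rel ?r4 (1 / \<omega>) \<dots> ?M"
    by (rule W.rel_at[OF capA', of _ "[(2, co Rho), (3, u)]" 0 "[(1, tv Rho)]"]) (simp_all add: wlayer)
  finally have M0: "W.rel ?r4 (1 * (1 / cnj \<omega>) * n * cnj \<omega> * (1 / \<omega>)) [(1, tv Mu), (0, u)] ?M" .
  define m where "m = n / \<omega>"
  have M: "W.rel ?r4 m [(1, tv Mu), (0, u)] ?M"
    using M0 nz by (simp add: m_def)
  have m0: "m \<noteq> 0" using n0 nz by (simp add: m_def)
  let ?w = "[Rho, Mu, Rho, Mu, Rho]"
  let ?B = "[(1, ?v), (0, tv Rho), (2, tv Rho), (0, u)]"
  have Y': "W.rel [Mu, Rho, Mu, Rho] (1 / n) [(0, ?v), (2, tv Rho), (0, u)] [(1, u), (0, tv Mu)]"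
    using W.rel_sym[OF Y n0] by simp
  have Y'': "W.rel [Mu, Rho, Mu, Rho] (1 / n) [(0, ?v), (2, tv Rho)] [(1, u), (0, tv Mu), (0, ?v)]"
  proof -
    have "W.rel [Mu, Rho, Mu, Rho] 1 [(0, ?v), (2, tv Rho)] [(0, ?v), (2, tv Rho), (0, u), (0, ?v)]"
      by (rule W.rel_back[OF uu, of _ "[(0, ?v), (2, tv Rho)]" 0 "[]"]) (simp_all add: wlayer)
    also have "W.rel [Mu, Rho, Mu, Rho] (1 / n) \<dots> [(1, u), (0, tv Mu), (0, ?v)]"
      by (rule W.rel_at[OF Y', of _ "[]" 0 "[(0, ?v)]"]) (simp_all add: wlayer)
    finally show ?thesis by simp
  qed
  have left: "W.rel ?w (l * (1 / n)) ?B [(0, u), (2, tv Mu), (1, u), (0, tv Mu)]"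
  proof -
    have "W.rel ?w l ?B [(0, u), (2, tv Mu), (0, ?v), (2, tv Rho), (0, u)]"
      by (rule W.rel_at[OF Z, of _ "[]" 0 "[(2, tv Rho), (0, u)]"]) (simp_all add: wlayer)
    also have "W.rel ?w (1 / n) \<dots> [(0, u), (2, tv Mu), (1, u), (0, tv Mu)]"
      by (rule W.rel_at[OF Y', of _ "[(0, u), (2, tv Mu)]" 0 "[]"]) (simp_all add: wlayer)
    finally show ?thesis by simp
  qed
  have right: "W.rel ?w (l * (1 / n)) ?B [(2, u), (1, tv Mu), (0, u), (2, tv Mu)]"
  proof -
    have "W.rel ?w (1 / n) ?B [(2, u), (1, tv Mu), (1, ?v), (0, tv Rho), (0, u)]"
      by (rule W.rel_at[OF Y'', of _ "[]" 1 "[(0, tv Rho), (0, u)]"]) (simp_all add: wlayer)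
    also have "W.rel ?w l \<dots> [(2, u), (1, tv Mu), (0, u), (2, tv Mu), (0, ?v), (0, u)]"
      by (rule W.rel_at[OF Z, of _ "[(2, u), (1, tv Mu)]" 0 "[(0, u)]"]) (simp_all add: wlayer)
    also have "W.rel ?w 1 \<dots> [(2, u), (1, tv Mu), (0, u), (2, tv Mu)]"
      by (rule W.rel_at[OF uu', of _ "[(2, u), (1, tv Mu), (0, u), (2, tv Mu)]" 0 "[]"]) (simp_all add: wlayer)
    finally show ?thesis by (simp add: mult.commute)
  qed
  let ?BL = "[(2, vt Rho), (0, u), (3, u), (2, ca Mu), (1, tv Rho)]"
  have left': "W.rel ?w (m * n) [(0, u), (2, tv Mu), (1, u), (0, tv Mu)] ?BL"
  proof -
    have "W.rel ?w m [(0, u), (2, tv Mu), (1, u), (0, tv Mu)] [(0, u), (3, co Rho), (1, u), (4, u), (3, ca Mu), (2, tv Rho), (0, tv Mu)]"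
      by (rule W.rel_at[OF M, of _ "[(0, u)]" 1 "[(0, tv Mu)]"]) (simp_all add: wlayer)
    also have "W.rel ?w n \<dots> [(3, co Rho), (2, tv Rho), (0, u), (3, u), (2, ca Mu), (1, tv Rho)]"
      by (rule W.rel_at[OF N, of _ "[(3, co Rho)]" 0 "[(3, u), (2, ca Mu), (1, tv Rho)]"]) (simp_all add: wlayer)
    also have "W.rel ?w 1 \<dots> ?BL"
      by (rule W.rel_at[OF rotate_right', of _ "[]" 2 "[(0, u), (3, u), (2, ca Mu), (1, tv Rho)]"]) (simp_all add: wlayer)
    finally show ?thesis by simp
  qed
  have right': "W.rel ?w (m * (1 / l)) [(2, u), (1, tv Mu), (0, u), (2, tv Mu)] ?BL"
  proof -
    have "W.rel ?w m [(2, u), (1, tv Mu), (0, u), (2, tv Mu)] [(2, u), (2, co Rho), (0, u), (3, u), (2, ca Mu), (1, tv Rho), (2, tv Mu)]"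
      by (rule W.rel_at[OF M, of _ "[(2, u)]" 0 "[(2, tv Mu)]"]) (simp_all add: wlayer)
    also have "W.rel ?w (1 / l) \<dots> [(2, co Rho), (3, tv Rho), (0, u), (3, u), (2, ca Mu), (1, tv Rho)]"
      by (rule W.rel_at[OF W.rel_sym[OF L l0], of _ "[(2, co Rho), (0, u)]" 3 "[(2, ca Mu), (1, tv Rho)]"]) (simp_all add: wlayer numeral_2_eq_2)
    also have "W.rel ?w 1 \<dots> ?BL"
      by (rule W.rel_at[OF rotate_left', of _ "[]" 2 "[(0, u), (3, u), (2, ca Mu), (1, tv Rho)]"]) (simp_all add: wlayer)
    finally show ?thesis by simp
  qed
  note final_left = W.rel_trans[OF left left'] and final_right = W.rel_trans[OF right right']
  let ?S = "[(0, ?v), (2, vt Rho), (0, vt Rho), (1, u)]"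
  \<comment> \<open>The diagram \<open>B\<close> does not vanish: composed with its adjoint, it gives two bubbles.\<close>
  have inv: "W.rel [Mu, Rho, Mu] ((1 / (\<tau> * \<tau>)) * (1 / (\<tau> * \<tau>))) (?S @ ?B) []"
  proof -
    have "W.rel [Mu, Rho, Mu] 1 (?S @ ?B) [(0, ?v), (2, vt Rho), (0, vt Rho), (0, tv Rho), (2, tv Rho), (0, u)]"
      by (rule W.rel_at[OF uu, of _ "[(0, ?v), (2, vt Rho), (0, vt Rho)]" 1 "[(0, tv Rho), (2, tv Rho), (0, u)]"]) (simp_all add: wlayer)
    also have "W.rel [Mu, Rho, Mu] (1 / (\<tau> * \<tau>)) \<dots> [(0, ?v), (2, vt Rho), (2, tv Rho), (0, u)]"
      by (rule W.rel_at[OF vertex_bubble, of _ "[(0, ?v), (2, vt Rho)]" 0 "[(2, tv Rho), (0, u)]"]) (simp_all add: wlayer)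
    also have "W.rel [Mu, Rho, Mu] (1 / (\<tau> * \<tau>)) \<dots> [(0, ?v), (0, u)]"
      by (rule W.rel_at[OF vertex_bubble, of _ "[(0, ?v)]" 2 "[(0, u)]"]) (simp_all add: wlayer)
    also note uu'
    finally show ?thesis by simp
  qed
  let ?k = "l * (1 / n) * (m * n)"
  have k0: "?k \<noteq> 0" using l0 n0 m0 by simp
  have "W.rel [Mu, Rho, Mu] (1 / ?k) (?S @ ?BL) (?S @ ?B)"
    by (rule rel_prefix[OF W.rel_sym[OF final_left k0]]) (simp_all add: wlayer)
  from W.rel_trans[OF this inv]
  have "W.rel [Mu, Rho, Mu] ((1 / ?k) * ((1 / (\<tau> * \<tau>)) * (1 / (\<tau> * \<tau>)))) (?S @ ?BL) []" .
  from rel_cancel[OF final_left final_right this] k0 tau_nz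
  have "?k = l * (1 / n) * (m * (1 / l))" by (simp add: wlayer)
  then have "l * n = 1" using l0 n0 m0 by (simp add: field_simps)
  then have "l = n" using n by (metis mult_cancel_right n0 mult.right_neutral)
  then show ?thesis using l n by simp
qed

end

section \<open>Rotational eigenvectors\<close>

lemma PQ_words: "P 2 = [Rho, Mu]" "Q 2 = [Mu, Rho]" "P 3 = [Rho, Mu, Rho]" "Q 3 = [Mu, Rho, Mu]"
  by (simp_all add: P_def Q_def numeral_eq_Suc)

context free_product_quotient
begin

lemma isomorphic_words:
  assumes "warr f" "wdm f = a" "wcd f = b" "warr g" "wdm g = b" "wcd g = a" "wcomp g f = widn a" "wcomp f g = widn b"
  shows "isomorphic D (fobj F a) (fobj F b)"
proof -
  have h: "wmor f \<in> hom D (fobj F a) (fobj F b)" "wmor g \<in> hom D (fobj F b) (fobj F a)"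
    using assms by (simp_all add: warr_def H_def)
  have "cmp D (wmor g) (wmor f) = ident D (fobj F a)" "cmp D (wmor f) (wmor g) = ident D (fobj F b)"
    using assms(7,8) by (simp_all add: w_defs)
  then show ?thesis unfolding isomorphic_def using h isoI[OF h] by blast
qed

lemma unitary_word:
  assumes "U \<in> hom D (fobj F a) (fobj F b)" "unitary_arr D U"
  shows "warr (a, b, U)" "W.rel a 1 [(0, (a, b, U)), (0, wstar (a, b, U))] []"
    "W.rel b 1 [(0, wstar (a, b, U)), (0, (a, b, U))] []"
proof -
  show w: "warr (a, b, U)" using assms by (simp add: H_def)
  have d: "dom D U = fobj F a" "cod D U = fobj F b" using assms(1) by (simp_all add: hom_def)
  have "cmp D (star D U) U = ident D (fobj F a)" "cmp D U (star D U) = ident D (fobj F b)"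
    using assms(2) d by (simp_all add: unitary_arr_def is_inverse_def)
  then have "wcomp (wstar (a, b, U)) (a, b, U) = widn a" "wcomp (a, b, U) (wstar (a, b, U)) = widn b"
    by (simp_all add: w_defs)
  then show "W.rel a 1 [(0, (a, b, U)), (0, wstar (a, b, U))] []" "W.rel b 1 [(0, wstar (a, b, U)), (0, (a, b, U))] []"
    using w by (intro W.rel_runI; simp add: wlayer wrun)+
qed

text \<open>The rotations are defined with explicit structure isomorphisms, which \<open>ft\<close> absorbs; so they are
three-layer diagrams in the strict category of words.\<close>

lemma rotation_run:
  fixes U :: 'q
  shows "U \<in> H (P 2) (Q 2) \<Longrightarrow> W.run [Mu, Rho] [(0, co Rho), (1, ([Rho, Mu], [Mu, Rho], U)), (2, ca Rho)] = ([Mu, Rho], [Rho, Mu], rotation D F 2 U)"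
    and "U \<in> H (P 2) (Q 2) \<Longrightarrow> W.run [Mu, Rho] [(2, co Mu), (1, ([Rho, Mu], [Mu, Rho], U)), (0, ca Mu)] = ([Mu, Rho], [Rho, Mu], rotation_inv D F 2 U)"
    and "U \<in> H (P 3) (Q 3) \<Longrightarrow> W.run [Mu, Rho, Mu] [(0, co Rho), (1, ([Rho, Mu, Rho], [Mu, Rho, Mu], U)), (3, ca Mu)] = ([Mu, Rho, Mu], [Rho, Mu, Rho], rotation D F 3 U)"
    and "U \<in> H (P 3) (Q 3) \<Longrightarrow> W.run [Mu, Rho, Mu] [(3, co Rho), (1, ([Rho, Mu, Rho], [Mu, Rho, Mu], U)), (0, ca Mu)] = ([Mu, Rho, Mu], [Rho, Mu, Rho], rotation_inv D F 3 U)"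
proof -
  have r: "([Mu, Rho], [Rho, Mu], rotation D F 2 U) = wcomp (wtens (widn [Rho, Mu]) (ca Rho))
      (wcomp (wtens (widn [Rho]) (wtens ([Rho, Mu], [Mu, Rho], U) (widn [Rho]))) (wtens (co Rho) (widn [Mu, Rho])))"
    "([Mu, Rho], [Rho, Mu], rotation_inv D F 2 U) = wcomp (wtens (ca Mu) (widn [Rho, Mu]))
      (wcomp (wtens (widn [Mu]) (wtens ([Rho, Mu], [Mu, Rho], U) (widn [Mu]))) (wtens (widn [Mu, Rho]) (co Mu)))"
    "([Mu, Rho, Mu], [Rho, Mu, Rho], rotation D F 3 U) = wcomp (wtens (widn [Rho, Mu, Rho]) (ca Mu))
      (wcomp (wtens (widn [Rho]) (wtens ([Rho, Mu, Rho], [Mu, Rho, Mu], U) (widn [Mu]))) (wtens (co Rho) (widn [Mu, Rho, Mu])))"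
    "([Mu, Rho, Mu], [Rho, Mu, Rho], rotation_inv D F 3 U) = wcomp (wtens (ca Mu) (widn [Rho, Mu, Rho]))
      (wcomp (wtens (widn [Mu]) (wtens ([Rho, Mu, Rho], [Mu, Rho, Mu], U) (widn [Rho]))) (wtens (widn [Mu, Rho, Mu]) (co Rho)))"
    by (simp_all add: rotation_def rotation_inv_def PQ_words Let_def w_defs ca_def co_def lift_def fp_letter)
  show "U \<in> H (P 2) (Q 2) \<Longrightarrow> W.run [Mu, Rho] [(0, co Rho), (1, ([Rho, Mu], [Mu, Rho], U)), (2, ca Rho)] = ([Mu, Rho], [Rho, Mu], rotation D F 2 U)"
    "U \<in> H (P 2) (Q 2) \<Longrightarrow> W.run [Mu, Rho] [(2, co Mu), (1, ([Rho, Mu], [Mu, Rho], U)), (0, ca Mu)] = ([Mu, Rho], [Rho, Mu], rotation_inv D F 2 U)"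
    "U \<in> H (P 3) (Q 3) \<Longrightarrow> W.run [Mu, Rho, Mu] [(0, co Rho), (1, ([Rho, Mu, Rho], [Mu, Rho, Mu], U)), (3, ca Mu)] = ([Mu, Rho, Mu], [Rho, Mu, Rho], rotation D F 3 U)"
    "U \<in> H (P 3) (Q 3) \<Longrightarrow> W.run [Mu, Rho, Mu] [(3, co Rho), (1, ([Rho, Mu, Rho], [Mu, Rho, Mu], U)), (0, ca Mu)] = ([Mu, Rho, Mu], [Rho, Mu, Rho], rotation_inv D F 3 U)"
    unfolding r by (simp_all add: wrun PQ_words)
qed

end

theorem theorem5p2:
  fixes n :: nat and \<omega> :: complex and D :: "('o, 'm) pivotal_data"
  assumes "n = 2 \<or> n = 3"
    and "\<omega> ^ n = 1"
    and "TT n \<omega> D"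
  shows "\<omega> = 1"
proof -
  obtain F U where q: "unitary_quotient T2T2 D F"
    and min: "\<forall>k. 2 \<le> k \<and> k < n \<longrightarrow> \<not> isomorphic D (fobj F (P k)) (fobj F (Q k))"
    and U: "U \<in> hom D (fobj F (P n)) (fobj F (Q n))" "unitary_arr D U"
    and rot: "rotation_inv D F n U = star D U" "star D U = ascale D (inverse \<omega>) (rotation D F n U)"
    using assms(3) unfolding TT_def by blast
  interpret free_product_quotient D F by (rule free_product_quotient.intro[OF q])
  have nz: "\<omega> \<noteq> 0" using assms(1,2) by auto
  have UH: "U \<in> H (P n) (Q n)" using U(1) by (simp add: H_def)
  note uw = unitary_word[OF U]
  let ?u = "(P n, Q n, U)"
  have star: "wstar ?u = (Q n, P n, star D U)" by (simp add: w_defs)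
  have starH: "star D U \<in> H (Q n) (P n)" using wstar_simps(3)[OF uw(1)] by (simp add: star)
  have scaled: "(Q n, P n, rotation D F n U) = wscl \<omega> (wstar ?u)" if "(Q n, P n, rotation D F n U) = x" "warr x" for x
  proof -
    have "wstar ?u = wscl (inverse \<omega>) x" unfolding star rot(2) using that(1)[symmetric] by (simp add: w_defs)
    then show ?thesis using that nz by (simp add: W.scl_scl W.scl_one)
  qed
  have single: "W.run (Q n) [(0, wstar ?u)] = wstar ?u" using uw(1) by (intro W.run_single) simp_all
  from assms(1) show ?thesis
  proof
    assume n: "n = 2"
    note w = PQ_words(1,2)
    let ?u = "([Rho, Mu], [Mu, Rho], U)"
    have A: "W.rel [Mu, Rho] \<omega> [(0, co Rho), (1, ?u), (2, ca Rho)] [(0, wstar ?u)]"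
    proof -
      have o: "W.ok [Mu, Rho] [(0, co Rho), (1, ?u), (2, ca Rho)]"
        using uw(1) n w by (simp add: wlayer)
      have "warr (W.run [Mu, Rho] [(0, co Rho), (1, ?u), (2, ca Rho)])" by (rule W.run_props[OF o])
      then have "W.run [Mu, Rho] [(0, co Rho), (1, ?u), (2, ca Rho)] = wscl \<omega> (wstar ?u)"
        using scaled rotation_run(1) UH n w by metis
      then show ?thesis using o single uw(1) n w by (simp add: W.rel_def wlayer)
    qed
    have B: "W.rel [Mu, Rho] 1 [(2, co Mu), (1, ?u), (0, ca Mu)] [(0, wstar ?u)]"
      using rotation_run(2) UH rot(1) star starH single uw(1) n w by (intro W.rel_runI) (simp_all add: wlayer)
    \<comment> \<open>Minimality only concerns words of at least two letters, so the letters themselves may be isomorphic here.\<close>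
    show ?thesis
    proof (cases "nohom [Rho] [Mu]")
      case True
      show ?thesis
        by (rule two_letters_disjoint[OF _ _ _ _ _ A B nz True]) (use uw n w in simp_all)
    next
      case False
      then obtain V X where VX: "warr V" "wdm V = [Rho]" "wcd V = [Mu]" "warr X" "wdm X = [Mu]" "wcd X = [Rho]"
        "W.rel [Mu] 1 [(0, X), (0, V)] []"
        "W.rel [Rho, Rho] 1 [(0, V), (1, V), (0, ca Mu)] [(0, ca Rho)]"
        by (rule identify_letters)
      show ?thesis
        by (rule two_letters_identified[OF _ _ _ _ A B VX]) (use uw n w in simp_all)
    qed
  next
    assume n: "n = 3"
    note w = PQ_words(3,4)
    let ?u = "([Rho, Mu, Rho], [Mu, Rho, Mu], U)"
    have A: "W.rel [Mu, Rho, Mu] \<omega> [(0, co Rho), (1, ?u), (3, ca Mu)] [(0, wstar ?u)]"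
    proof -
      have o: "W.ok [Mu, Rho, Mu] [(0, co Rho), (1, ?u), (3, ca Mu)]"
        using uw(1) n w by (simp add: wlayer)
      have "warr (W.run [Mu, Rho, Mu] [(0, co Rho), (1, ?u), (3, ca Mu)])" by (rule W.run_props[OF o])
      then have "W.run [Mu, Rho, Mu] [(0, co Rho), (1, ?u), (3, ca Mu)] = wscl \<omega> (wstar ?u)"
        using scaled rotation_run(3) UH n w by metis
      then show ?thesis using o single uw(1) n w by (simp add: W.rel_def wlayer)
    qed
    have B: "W.rel [Mu, Rho, Mu] 1 [(3, co Rho), (1, ?u), (0, ca Mu)] [(0, wstar ?u)]"
      using rotation_run(4) UH rot(1) star starH single uw(1) n w by (intro W.rel_runI) (simp_all add: wlayer)
    have noiso: "\<not> isomorphic D (fobj F [Rho, Mu]) (fobj F [Mu, Rho])"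
      using min[rule_format, of 2] n by (simp add: PQ_words)
    \<comment> \<open>If the letters were isomorphic, exchanging them would identify the two words of length two.\<close>
    have no: "nohom [Rho] [Mu]"
    proof (rule ccontr)
      assume "\<not> nohom [Rho] [Mu]"
      then obtain V X where V: "warr V" "wdm V = [Rho]" "wcd V = [Mu]" "warr X" "wdm X = [Mu]" "wcd X = [Rho]"
        "wcomp X V = widn [Rho]" "wcomp V X = widn [Mu]"
        by (rule identify_letters)
      have "isomorphic D (fobj F [Rho, Mu]) (fobj F [Mu, Rho])"
        by (rule isomorphic_words[of "wtens V X" _ _ "wtens X V"]) (use V in \<open>simp_all add: W.interchange W.idn_tens_idn\<close>)
      with noiso show False ..
    qed
    have no2: "nohom [Rho, Mu] [Mu, Rho]"
    proof (rule ccontr)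
      assume "\<not> nohom [Rho, Mu] [Mu, Rho]"
      with scalar_end_two[OF no] scalar_end_two[OF nohom_star[OF no]] show False
        by (rule schur) (use noiso isomorphic_words in blast)
    qed
    show ?thesis
      by (rule three_letters[OF _ _ _ _ _ A B nz no no2]) (use uw n w in simp_all)
  qed
qed

end
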